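(* There is a universal constant $c>0$ such that the following holds. For every sufficiently large $n$, every $t\geq 1$ and every word size $w\geq 7\log_2 n$, every array $A\in\{0,1\}^n$ can be preprocessed into a data structure in the cell-probe model with word size $w$ that occupies \[ n+\left\lceil \frac{n}{w^{ct}}\right\rceil \] bits of memory and answers every rank query $\mathrm{rank}(u)=\sum_{i=0}^{u-1}A[i]$, $0\le u\le n$, using $O(t)$ cell probes. Here the constant hidden in $O(t)$ is universal.
   Context: Cell-probe model with word size $w$: memory is an array of cells of $w$ bits each. A query algorithm may probe (read) cells adaptively, choosing each probe as an arbitrary function of the query and the contents of the cells read so far; arbitrary computation is free (equivalently, arbitrary operations on $O(w)$-bit words cost nothing). The query time is the number of cells probed. *)

theory Defs
  imports Complex_Main
begin

text \<open>
  A memory is a string of bits, split into consecutive cells of \<open>w\<close> bits. If \<open>w\<close> does not divide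
  the number of bits, the last cell holds the remaining bits only, so the space is exactly the
  length of the string. An address beyond the last cell reads as the empty word.
\<close>

definition cell :: "nat \<Rightarrow> bool list \<Rightarrow> nat \<Rightarrow> bool list" where
  "cell w mem j = take w (drop (j * w) mem)"

text \<open>
  An adaptive query algorithm (for a fixed query) as a decision tree: in \<open>Probe j next\<close> the cell
  with address \<open>j\<close> is read and its contents determine, without any restriction, the
  continuation. Hence every address and the final answer are arbitrary functions of the contents
  read so far, and nothing else about the memory can influence them.
\<close>

datatype 'r query_alg = Answer 'r | Probe nat "bool list \<Rightarrow> 'r query_alg"

primrec answer :: "nat \<Rightarrow> bool list \<Rightarrow> 'r query_alg \<Rightarrow> 'r" where
  "answer w mem (Answer r) = r"
| "answer w mem (Probe j next) = answer w mem (next (cell w mem j))"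

primrec num_probes :: "nat \<Rightarrow> bool list \<Rightarrow> 'r query_alg \<Rightarrow> nat" where
  "num_probes w mem (Answer r) = 0"
| "num_probes w mem (Probe j next) = Suc (num_probes w mem (next (cell w mem j)))"

definition rank_query :: "bool list \<Rightarrow> nat \<Rightarrow> nat" where
  "rank_query A u = (\<Sum>i<u. of_bool (A ! i))"

end

theory Submission
  imports Defs "HOL-Library.FuncSet"
begin

text \<open>
  The array is cut recursively into \<open>b = w ^ \<Omega>(1)\<close> blocks, and every block of size \<open>s\<close> is stored, with
  exponentially small loss, relative to the residue of its number of ones modulo \<open>L = 2 ^ l\<close>, where \<open>L\<close> is
  about \<open>sqrt (s / w)\<close>. Since binomial coefficients are equidistributed modulo \<open>L\<close> up to \<open>2 ^ (- \<Omega>(w))\<close>,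
  the prefix sums modulo \<open>L\<close> of the blocks can be stored verbatim, independently of the headers of the blocks.

  What remains is the part of the prefix sums above \<open>L\<close>. The carry at a block depends on the two adjacent residues and
  on the header of the block, but usually already on their \<open>O(log w)\<close> leading bits, and the probability that
  \<open>t\<close> leading bits do not suffice is \<open>w ^ O(1) * 2 ^ (- t)\<close>. Hence \<open>O(w)\<close> leading bits determine all \<open>b\<close> carries,
  except for a fraction \<open>2 ^ (- \<Omega>(w))\<close> of the arrays, which may be stored wastefully. These bits form the header of the
  combined block; it has \<open>O(w)\<close> bits, so one level of the recursion costs \<open>O(1)\<close> probes. In total one bit
  of redundancy and \<open>O(log n / log w)\<close> probes suffice. For smaller \<open>t\<close> this is applied to
  pieces of length about \<open>w ^ (t + 1)\<close>, each with an explicit prefix sum.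
\<close>

subsection \<open>Reads of consecutive bits\<close>

text \<open>Headers are counted, not padded to whole bits, until the root header is written out in
  \<open>\<kappa>\<close> bits although it takes only slightly more than
  \<open>2 ^ (\<kappa> - 1)\<close> values; this is the one bit of redundancy. The obstacle is that
  a header must keep O(w) bits although it stands for \<open>b\<close> child headers of the same
  length. Nearly all of their bits must therefore move to fixed places in memory, where a query for
  one child finds them with O(1) reads. The choice of \<open>L\<close> is a compromise: a much
  larger modulus would spoil the equidistribution, a much smaller one would leave each carry more
  than \<open>w ^ O(1)\<close> typical values, and then the \<open>b\<close> carries could no longer
  be listed with a factor \<open>2 ^ O(w)\<close>. The same requirement, \<open>b * log w\<close> at
  most about \<open>w\<close>, limits \<open>b\<close>; here \<open>b\<close> is at most the fourth
  root of \<open>w\<close>. The condition that \<open>w\<close> is at least \<open>7 * log n\<close>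
  makes a whole prefix sum, and the growth of the loss over all levels, small against the errors
  \<open>2 ^ (- \<Omega>(w))\<close>.\<close>

text \<open>A read returns \<open>W\<close> consecutive bits from an arbitrary bit position. For \<open>W = c * w\<close> it costs at most
  \<open>c + 1\<close> cell probes, and unlike cell probes reads are invariant under moving the data inside the memory.\<close>

inductive reads :: "nat \<Rightarrow> nat \<Rightarrow> (bool list \<Rightarrow> 'r) \<Rightarrow> bool" for W where
  const: "reads W p (\<lambda>m. r)"
| read: "(\<And>x. reads W p (g x)) \<Longrightarrow> reads W (Suc p) (\<lambda>m. g (take W (drop pos m)) m)"

lemma reads_mono: "reads W p f \<Longrightarrow> p \<le> q \<Longrightarrow> reads W q f"
proof (induction arbitrary: q rule: reads.induct)
  case (const p r) show ?case by (rule reads.const)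
next
  case (read p g pos)
  then obtain q' where "q = Suc q'" "p \<le> q'" by (cases q) auto
  with read show ?case by (auto intro: reads.read)
qed

lemma reads_bind:
  assumes "reads W p f" "\<And>x. reads W q (g x)"
  shows "reads W (p + q) (\<lambda>m. g (f m) m)"
  using assms(1)
proof (induction rule: reads.induct)
  case (const p r) show ?case using reads_mono[OF assms(2)[of r], of "p + q"] by simp
next
  case (read p h pos)
  have "reads W (Suc (p + q)) (\<lambda>m. (\<lambda>x m. g (h x m) m) (take W (drop pos m)) m)"
    by (rule reads.read) (rule read.IH)
  thus ?case by simp
qed

lemma reads_map: "reads W p f \<Longrightarrow> reads W p (\<lambda>m. h (f m))"
  using reads_bind[of W p f 0 "\<lambda>x m. h x"] by (auto intro: reads.const)

lemma reads_one: "reads W (Suc 0) (\<lambda>m. take W (drop pos m))"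
  using reads.read[of W 0 "\<lambda>x m. x" pos] by (auto intro: reads.const)

primrec read_cells :: "nat \<Rightarrow> nat \<Rightarrow> bool list \<Rightarrow> (bool list \<Rightarrow> 'r query_alg) \<Rightarrow> 'r query_alg" where
  "read_cells 0 j acc next = next acc"
| "read_cells (Suc c) j acc next = Probe j (\<lambda>x. read_cells c (Suc j) (acc @ x) next)"

lemma cell_append: "cell w m j @ take (c * w) (drop (Suc j * w) m) = take (Suc c * w) (drop (j * w) m)"
proof -
  have "take (w + c * w) (drop (j * w) m) = take w (drop (j * w) m) @ take (c * w) (drop w (drop (j * w) m))"
    by (rule take_add)
  thus ?thesis by (simp add: cell_def add.commute)
qed

lemma answer_read_cells:
  "answer w m (read_cells c j acc next) = answer w m (next (acc @ take (c * w) (drop (j * w) m)))"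
proof (induction c arbitrary: j acc)
  case (Suc c)
  have "answer w m (read_cells (Suc c) j acc next) =
     answer w m (next (acc @ (cell w m j @ take (c * w) (drop (Suc j * w) m))))"
    by (simp only: read_cells.simps answer.simps Suc append_assoc)
  thus ?case by (simp only: cell_append)
qed simp

lemma num_probes_read_cells:
  "num_probes w m (read_cells c j acc next) = c + num_probes w m (next (acc @ take (c * w) (drop (j * w) m)))"
proof (induction c arbitrary: j acc)
  case (Suc c)
  have "num_probes w m (read_cells (Suc c) j acc next) =
     Suc c + num_probes w m (next (acc @ (cell w m j @ take (c * w) (drop (Suc j * w) m))))"
    by (simp only: read_cells.simps num_probes.simps Suc append_assoc add_Suc)
  thus ?case by (simp only: cell_append)
qed simp

lemma reads_imp_query_alg:
  assumes "reads W p f" "W \<le> c * w" "w > 0"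
  shows "\<exists>alg. \<forall>m. answer w m alg = f m \<and> num_probes w m alg \<le> p * Suc c"
  using assms(1)
proof (induction rule: reads.induct)
  case (const p r) show ?case by (rule exI[of _ "Answer r"]) simp
next
  case (read p g pos)
  then obtain al where al: "\<And>x m. answer w m (al x) = g x m \<and> num_probes w m (al x) \<le> p * Suc c"
    by metis
  define alg where "alg = read_cells (Suc c) (pos div w) [] (\<lambda>x. al (take W (drop (pos mod w) x)))"
  have seg: "take W (drop (pos mod w) (take (Suc c * w) (drop (pos div w * w) m))) = take W (drop pos m)" for m :: "bool list"
  proof -
    have "pos mod w + W \<le> Suc c * w"
      using assms(2) mod_less_divisor[OF assms(3), of pos] by simp
    hence "min W (Suc c * w - pos mod w) = W" by simp
    moreover have "pos mod w + pos div w * w = pos" by simp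
    ultimately show ?thesis by (simp add: drop_take)
  qed
  have "answer w m alg = g (take W (drop pos m)) m \<and> num_probes w m alg \<le> Suc p * Suc c" for m
    using al[of m "take W (drop pos m)"] seg[of m]
    unfolding alg_def answer_read_cells num_probes_read_cells by simp
  thus ?case by blast
qed

section \<open>Bit strings as numbers, ranks and residue classes of arrays\<close>

definition bl :: "nat \<Rightarrow> nat \<Rightarrow> bool list" where "bl n x = map (bit x) [0..<n]"
definition nb :: "bool list \<Rightarrow> nat" where "nb xs = horner_sum of_bool 2 xs"

lemma length_bl [simp]: "length (bl n x) = n" by (simp add: bl_def)

lemma nb_bl: "nb (bl n x) = x mod 2 ^ n"
  by (simp add: nb_def bl_def horner_sum_bit_eq_take_bit take_bit_eq_mod)

lemma bl_nb: "bl (length xs) (nb xs) = xs"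
  by (auto simp: bl_def nb_def bit_horner_sum_bit_iff intro!: nth_equalityI)

lemma bl_eq: "x mod 2 ^ n = y mod 2 ^ n \<Longrightarrow> bl n x = bl n y"
  by (metis length_bl bl_nb nb_bl)

definition ones :: "bool list \<Rightarrow> nat" where "ones xs = length (filter id xs)"

lemma ones_append: "ones (xs @ ys) = ones xs + ones ys" by (simp add: ones_def)
lemma ones_le: "ones xs \<le> length xs" by (simp add: ones_def)

lemma rank_query_eq: "u \<le> length A \<Longrightarrow> rank_query A u = ones (take u A)"
proof (induction u)
  case (Suc u)
  thus ?case by (simp add: rank_query_def take_Suc_conv_app_nth ones_append) (simp add: ones_def)
qed (simp add: rank_query_def ones_def)

lemma eq_if_ranks_eq:
  assumes "length A = s" "length A' = s" "\<And>u. u \<le> s \<Longrightarrow> ones (take u A) = ones (take u A')"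
  shows "A = A'"
proof (rule nth_equalityI)
  show "length A = length A'" using assms by simp
  fix i assume i: "i < length A"
  have "ones (take (Suc i) A) = ones (take (Suc i) A')" "ones (take i A) = ones (take i A')"
    using assms i by auto
  thus "A ! i = A' ! i" using i assms
    by (simp add: take_Suc_conv_app_nth ones_append) (simp add: ones_def split: if_splits)
qed

definition arrays :: "nat \<Rightarrow> nat \<Rightarrow> nat \<Rightarrow> bool list set" where
  "arrays s l \<rho> = {A. length A = s \<and> ones A mod 2 ^ l = \<rho>}"

lemma finite_lists: "finite {A :: bool list. length A = s}"
  using finite_lists_length_eq[of "UNIV :: bool set" s] by simp

lemma card_lists: "card {A :: bool list. length A = s} = 2 ^ s"
  using card_lists_length_eq[of "UNIV :: bool set" s] by (simp add: card_UNIV_bool)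

lemma finite_arrs [simp]: "finite (arrays s l \<rho>)"
  by (rule finite_subset[OF _ finite_lists[of s]]) (auto simp: arrays_def)

subsection \<open>Binomial sums\<close>

text \<open>\<open>bop s F v\<close> is the sum over all bit strings \<open>A\<close> of length \<open>s\<close> of \<open>F (v - ones A)\<close>.\<close>

primrec bop :: "nat \<Rightarrow> (int \<Rightarrow> real) \<Rightarrow> int \<Rightarrow> real" where
  "bop 0 F v = F v"
| "bop (Suc s) F v = bop s F v + bop s F (v - 1)"

lemma bop_add: "bop (s + s') F v = bop s (bop s' F) v"
  by (induction s arbitrary: v) auto

lemma bop_plus: "bop s (\<lambda>x. F x + G x) v = bop s F v + bop s G v"
  by (induction s arbitrary: v) auto

lemma bop_scale: "bop s (\<lambda>x. c * F x) v = c * bop s F v"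
  by (induction s arbitrary: v) (auto simp: algebra_simps)

lemma bop_diff: "bop s (\<lambda>x. F x - G x) v = bop s F v - bop s G v"
  by (induction s arbitrary: v) auto

lemma bop_sum: "bop s (\<lambda>x. \<Sum>i\<in>I. F i x) v = (\<Sum>i\<in>I. bop s (F i) v)"
  by (induction s arbitrary: v) (auto simp: sum.distrib)

lemma bop_shift: "bop s (\<lambda>x. F (x + c)) v = bop s F (v + c)"
  by (induction s arbitrary: v) (auto simp: algebra_simps)

lemma bop_const: "bop s (\<lambda>x. c) v = 2 ^ s * c"
  by (induction s arbitrary: v) auto

lemma bop_mono: "(\<And>x. F x \<le> G x) \<Longrightarrow> bop s F v \<le> bop s G v"
  by (induction s arbitrary: v) (auto intro: add_mono)

lemma bop_abs_le: "(\<And>x. \<bar>F x\<bar> \<le> m) \<Longrightarrow> \<bar>bop s F v\<bar> \<le> 2 ^ s * m"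
proof (induction s arbitrary: v)
  case (Suc s)
  have "\<bar>bop s F v\<bar> \<le> 2 ^ s * m" "\<bar>bop s F (v - 1)\<bar> \<le> 2 ^ s * m" by (rule Suc.IH[OF Suc.prems])+
  thus ?case by simp
qed simp

lemma bop_choose: "bop s F v = (\<Sum>u\<le>s. real (s choose u) * F (v - int u))"
proof (induction s arbitrary: v)
  case (Suc s)
  have "(\<Sum>u\<le>Suc s. real (Suc s choose u) * F (v - int u))
    = F v + (\<Sum>u\<le>s. real (Suc s choose Suc u) * F (v - int (Suc u)))"
    by (subst sum.atMost_Suc_shift) simp
  also have "\<dots> = F v + (\<Sum>u\<le>s. real (s choose Suc u) * F (v - int (Suc u))) + (\<Sum>u\<le>s. real (s choose u) * F (v - 1 - int u))"
    by (simp add: sum.distrib algebra_simps)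
  also have "F v + (\<Sum>u\<le>s. real (s choose Suc u) * F (v - int (Suc u))) = (\<Sum>u\<le>Suc s. real (s choose u) * F (v - int u))"
    by (subst sum.atMost_Suc_shift) simp
  also have "\<dots> = (\<Sum>u\<le>s. real (s choose u) * F (v - int u))" by (simp add: binomial_eq_0)
  finally show ?case by (simp add: Suc)
qed simp

lemma card_ones: "real (card {A. length A = s \<and> Q (v - int (ones A))}) = bop s (\<lambda>x. of_bool (Q x)) v"
proof (induction s arbitrary: v)
  case 0
  have "{A :: bool list. length A = 0 \<and> Q (v - int (ones A))} = (if Q v then {[]} else {})"
    by (auto simp: ones_def)
  thus ?case by simp
next
  case (Suc s)
  let ?S = "\<lambda>s v. {A. length A = s \<and> Q (v - int (ones A))}"
  have eq: "?S (Suc s) v = (#) False ` ?S s v \<union> (#) True ` ?S s (v - 1)"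
  proof (intro set_eqI iffI)
    fix A assume "A \<in> ?S (Suc s) v"
    then obtain a A' where "A = a # A'" "length A' = s" "Q (v - int (ones A))" by (cases A) auto
    thus "A \<in> (#) False ` ?S s v \<union> (#) True ` ?S s (v - 1)"
      by (cases a) (auto simp: ones_def algebra_simps)
  qed (auto simp: ones_def algebra_simps)
  have fin: "finite (?S s v)" for v by (rule finite_subset[OF _ finite_lists[of s]]) auto
  have "card (?S (Suc s) v) = card (?S s v) + card (?S s (v - 1))"
    unfolding eq by (subst card_Un_disjoint) (auto simp: fin card_image)
  thus ?case using Suc by simp
qed

text \<open>Summation by parts moves the difference onto the binomial coefficients. They are
  unimodal, so their total variation is twice the central one.\<close>

lemma bop_lipschitz:
  assumes "\<And>x. \<bar>F x\<bar> \<le> m"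
  shows "\<bar>bop s F (v + 1) - bop s F v\<bar> \<le> 2 * real (s choose (s div 2)) * m"
proof -
  \<comment> \<open>\<open>c u\<close> is the coefficient at \<open>u - 1\<close>; the case
    \<open>u = 0\<close> is separate because truncated subtraction would repeat
    \<open>s choose 0\<close>.\<close>
  define c where "c u = (if u = 0 then 0 else real (s choose (u - 1)))" for u
  define d where "d u = real (s choose u) - c u" for u
  define h where "h = s div 2"
  have c0: "c 0 = 0" and cS: "c (Suc u) = real (s choose u)" for u by (auto simp: c_def)
  have m0: "m \<ge> 0" using assms[of 0] by linarith
  have "bop s F (v + 1) = (\<Sum>u\<le>Suc s. real (s choose u) * F (v + 1 - int u))"
    unfolding bop_choose by (simp add: binomial_eq_0)
  moreover have "bop s F v = (\<Sum>u\<le>Suc s. c u * F (v + 1 - int u))"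
  proof -
    have "(\<Sum>u\<le>Suc s. c u * F (v + 1 - int u)) = c 0 * F (v + 1 - int 0) + (\<Sum>u\<le>s. c (Suc u) * F (v + 1 - int (Suc u)))"
      by (rule sum.atMost_Suc_shift)
    thus ?thesis by (simp add: c0 cS bop_choose)
  qed
  ultimately have "bop s F (v + 1) - bop s F v = (\<Sum>u\<le>Suc s. d u * F (v + 1 - int u))"
    by (simp add: d_def sum_subtractf algebra_simps)
  also have "\<bar>\<dots>\<bar> \<le> (\<Sum>u\<le>Suc s. \<bar>d u\<bar> * m)"
    by (rule order.trans[OF sum_abs sum_mono]) (auto simp: abs_mult intro: mult_left_mono assms)
  also have "\<dots> = (\<Sum>u\<le>Suc s. \<bar>d u\<bar>) * m" by (simp only: sum_distrib_right)
  also have "(\<Sum>u\<le>Suc s. \<bar>d u\<bar>) = 2 * real (s choose h)"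
  proof -
    have pos: "d u \<ge> 0" if "u \<le> h" for u
    proof (cases u)
      case (Suc u')
      have "s choose u' \<le> s choose u"
        by (rule binomial_mono) (use that Suc in \<open>auto simp: h_def\<close>)
      thus ?thesis using Suc by (simp add: d_def cS)
    qed (simp add: d_def c0)
    have neg: "d u \<le> 0" if gt: "u > h" for u
    proof -
      obtain u' where u: "u = Suc u'" using gt by (cases u) auto
      have "s choose u \<le> s choose u'"
      proof (cases "u \<le> s")
        case True
        show ?thesis by (rule binomial_antimono) (use gt True u in \<open>auto simp: h_def\<close>)
      qed (simp add: binomial_eq_0)
      thus ?thesis using u by (simp add: d_def cS)
    qed
    have t1: "(\<Sum>u\<le>k. d u) = real (s choose k)" for k
      by (induction k) (auto simp: d_def c0 cS)
    have hs: "h < Suc s" by (simp add: h_def)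
    have sp: "(\<Sum>u\<le>Suc s. g u) = (\<Sum>u\<le>h. g u) + (\<Sum>u\<in>{h<..Suc s}. g u)" for g :: "nat \<Rightarrow> real"
    proof -
      have "{..Suc s} = {..h} \<union> {h<..Suc s}" using hs by auto
      thus ?thesis by (simp only:) (rule sum.union_disjoint; auto)
    qed
    have "(\<Sum>u\<le>h. \<bar>d u\<bar>) = real (s choose h)" using pos t1[of h] by simp
    moreover have "(\<Sum>u\<in>{h<..Suc s}. \<bar>d u\<bar>) = - (\<Sum>u\<in>{h<..Suc s}. d u)"
      using neg by (simp add: sum_negf[symmetric])
    moreover have "(\<Sum>u\<in>{h<..Suc s}. d u) = - real (s choose h)"
      using sp[of d] t1[of "Suc s"] t1[of h] by (simp add: binomial_eq_0)
    ultimately show ?thesis using sp[of "\<lambda>u. \<bar>d u\<bar>"] by simp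
  qed
  finally show ?thesis by (simp add: h_def)
qed

text \<open>Consecutive central coefficients have the ratio
  \<open>2 * (2 * a + 1) / (a + 1)\<close>, so the induction step reduces to
  \<open>(2 * a + 1) * (2 * a + 3) \<le> 4 * (a + 1)^2\<close>.\<close>

lemma central_even: "((2 * a) choose a)^2 * (2 * a + 1) \<le> 16 ^ a"
proof (induction a)
  case (Suc a)
  let ?c = "(2 * a) choose a" let ?d = "(2 * Suc a) choose Suc a"
  have 1: "Suc a * ?d = 2 * (2 * a + 1) * ?c"
  proof -
    have "Suc a * ?d = (2 * a + 2) * ((2 * a + 1) choose a)"
      using Suc_times_binomial_eq[of "2 * a + 1" a] by (simp add: mult.commute)
    hence "Suc a * ?d = 2 * (Suc a * ((2 * a + 1) choose a))" by simp
    moreover have "Suc a * ((2 * a + 1) choose a) = (2 * a + 1) * ?c"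
    proof -
      have "(2 * a + 1) choose a = (2 * a + 1) choose (Suc a)"
        by (subst binomial_symmetric) auto
      thus ?thesis using Suc_times_binomial_eq[of "2 * a" a] by (simp add: mult.commute)
    qed
    ultimately show ?thesis by (simp only: mult.assoc)
  qed
  have "(Suc a)^2 * (?d^2 * (2 * a + 3)) = (Suc a * ?d)^2 * (2 * a + 3)" by (simp only: power_mult_distrib mult.assoc)
  also have "\<dots> = 4 * (2 * a + 1) * (2 * a + 3) * (?c^2 * (2 * a + 1))"
    unfolding 1 by (simp add: power2_eq_square algebra_simps)
  also have "\<dots> \<le> 16 * (Suc a)^2 * (16 ^ a)"
    by (rule mult_mono[OF _ Suc]) (auto simp: power2_eq_square algebra_simps)
  finally have "(Suc a)^2 * (?d^2 * (2 * a + 3)) \<le> (Suc a)^2 * 16 ^ Suc a" by simp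
  hence "?d^2 * (2 * a + 3) \<le> 16 ^ Suc a" by (metis mult_le_cancel1 zero_less_power zero_less_Suc)
  moreover have "2 * Suc a + 1 = 2 * a + 3" by simp
  ultimately show ?case by (simp only:)
qed simp

lemma central_bound: "(s choose (s div 2))^2 * (s + 1) \<le> 4 ^ s"
proof (cases "even s")
  case True
  then obtain a where "s = 2 * a" by auto
  thus ?thesis using central_even[of a] by (simp add: power_mult)
next
  case False
  then obtain a where s: "s = 2 * a + 1" by (auto elim: oddE)
  let ?c = "(2 * a + 1) choose a"
  have "(2 * a + 1) choose a = (2 * a + 1) choose (Suc a)"
    by (subst binomial_symmetric) auto
  hence "(2 * Suc a) choose (Suc a) = 2 * ?c" by simp
  hence "(2 * ?c)^2 * (2 * Suc a + 1) \<le> 16 ^ Suc a" using central_even[of "Suc a"] by (simp only:)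
  hence "4 * (?c^2 * (2 * a + 3)) \<le> 16 ^ Suc a"
    unfolding power_mult_distrib by (simp add: algebra_simps del: binomial_Suc_Suc)
  hence "?c^2 * (2 * a + 3) \<le> 4 * 16 ^ a" by (simp only: power_Suc)
  moreover have "?c^2 * (2 * a + 2) \<le> ?c^2 * (2 * a + 3)" by (rule mult_left_mono) auto
  ultimately show ?thesis using s by (simp add: power_add power_mult)
qed

lemma central_bound_real:
  assumes "16 * L^2 \<le> s" "L > 0"
  shows "4 * real L * real (s choose (s div 2)) \<le> 2 ^ s"
proof -
  have "(4 * L * (s choose (s div 2)))^2 = 16 * L^2 * (s choose (s div 2))^2"
    by (simp add: power_mult_distrib)
  also have "\<dots> \<le> (s + 1) * (s choose (s div 2))^2" using assms(1) by (intro mult_right_mono) auto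
  also have "\<dots> \<le> 4 ^ s" using central_bound[of s] by (simp add: mult.commute)
  also have "(4::nat) ^ s = (2 ^ s)^2" by (simp add: power2_eq_square power_mult_distrib[symmetric])
  finally have "4 * L * (s choose (s div 2)) \<le> 2 ^ s" by (simp add: power2_nat_le_eq_le)
  hence "real (4 * L * (s choose (s div 2))) \<le> real (2 ^ s)" by (simp only: of_nat_le_iff)
  thus ?thesis by simp
qed

lemma bop_step:
  assumes "\<And>x. \<bar>F x\<bar> \<le> m" "16 * L^2 \<le> s" "L > 0"
  shows "\<bar>bop s F (v + 1) - bop s F v\<bar> \<le> 2 ^ s * m / (2 * real L)"
proof -
  have m0: "m \<ge> 0" using assms(1)[of 0] by linarith
  have "2 * real (s choose (s div 2)) * m * (2 * real L) \<le> 2 ^ s * m"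
    using mult_right_mono[OF central_bound_real[OF assms(2,3)] m0] by (simp add: algebra_simps)
  hence "2 * real (s choose (s div 2)) * m \<le> 2 ^ s * m / (2 * real L)"
    using assms(3) by (simp add: field_simps)
  moreover have "\<bar>bop s F (v + 1) - bop s F v\<bar> \<le> 2 * real (s choose (s div 2)) * m"
    using assms(1) by (rule bop_lipschitz)
  ultimately show ?thesis by linarith
qed

lemma bop_lipschitz_dist:
  assumes "\<And>v. \<bar>bop s F (v + 1) - bop s F v\<bar> \<le> c"
  shows "\<bar>bop s F v - bop s F v'\<bar> \<le> c * real_of_int \<bar>v - v'\<bar>"
proof -
  have 1: "\<bar>bop s F (v + int k) - bop s F v\<bar> \<le> c * real k" for v k
  proof (induction k)
    case (Suc k)
    thus ?case using assms[of "v + int k"] by (auto simp: algebra_simps)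
  qed simp
  show ?thesis
  proof (cases "v' \<le> v")
    case True
    thus ?thesis using 1[of v' "nat (v - v')"] by simp
  next
    case False
    thus ?thesis using 1[of v "nat (v' - v)"] by (simp add: abs_minus_commute)
  qed
qed

section \<open>Equidistribution of binomial sums modulo \<open>L\<close>\<close>

definition res :: "nat \<Rightarrow> int \<Rightarrow> real" where "res L x = of_bool (int L dvd x)"

lemma sum_res:
  assumes "L > 0"
  shows "(\<Sum>r<L. f r * res L (x + int r)) = f (nat ((- x) mod int L))"
proof -
  have eq: "int L dvd (x + int r) \<longleftrightarrow> r = nat ((- x) mod int L)" if "r < L" for r
  proof -
    have "int L dvd (x + int r) \<longleftrightarrow> (int r) mod int L = (- x) mod int L"
      by (metis add.commute diff_minus_eq_add mod_eq_dvd_iff)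
    thus ?thesis using that assms by (auto simp: nat_eq_iff)
  qed
  have n: "nat ((- x) mod int L) < L" using assms by (simp add: nat_less_iff)
  have "(\<Sum>r<L. f r * res L (x + int r)) = (\<Sum>r<L. if r = nat ((- x) mod int L) then f r else 0)"
    by (rule sum.cong) (auto simp: res_def eq)
  also have "\<dots> = f (nat ((- x) mod int L))" using n by simp
  finally show ?thesis .
qed

text \<open>The difference of two shifts of \<open>res L\<close> is a single discrete derivative of
  a function bounded by 1, namely the periodic indicator \<open>P\<close> of a window of
  \<open>r\<close> residues. Hence \<open>bop_step\<close> is applied once and not \<open>r\<close>
  times.\<close>

lemma bop_res_diff:
  assumes "16 * L^2 \<le> s" "L > 0" "r < L"
  shows "\<bar>bop s (res L) v - bop s (res L) (v + int r)\<bar> \<le> 2 ^ s / (2 * real L)"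
proof -
  define P where "P x = (of_bool ((x + int r) mod int L < int r) :: real)" for x :: int
  have P: "P (x + 1) - P x = res L (x + 1 + int r) - res L (x + 1)" for x
  proof -
    define y where "y = (x + int r) mod int L"
    have y: "0 \<le> y" "y < int L" using assms by (auto simp: y_def)
    have s: "(x + 1 + int r) mod int L = (if y + 1 = int L then 0 else y + 1)"
    proof -
      have "(x + 1 + int r) mod int L = (y + 1) mod int L" unfolding y_def
        by (metis add.assoc add.commute mod_add_left_eq)
      thus ?thesis using y by auto
    qed
    have r1: "int L dvd (x + 1 + int r) \<longleftrightarrow> y + 1 = int L"
      using s y by (auto simp: dvd_eq_mod_eq_0)
    have r2: "int L dvd (x + 1) \<longleftrightarrow> y + 1 = int r \<or> (r = 0 \<and> y + 1 = int L)"
    proof -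
      have "int L dvd (x + 1) \<longleftrightarrow> (x + 1 + int r) mod int L = int r mod int L"
        by (simp add: mod_eq_dvd_iff)
      also have "\<dots> \<longleftrightarrow> (if y + 1 = int L then 0 else y + 1) = int r" using assms s by simp
      finally show ?thesis using y assms by auto
    qed
    have P1: "P (x + 1) = of_bool ((if y + 1 = int L then 0 else y + 1) < int r)" using s by (simp add: P_def)
    have P0: "P x = of_bool (y < int r)" by (simp add: P_def y_def)
    show ?thesis unfolding res_def r1 r2 P1 P0 using y assms(3) by auto
  qed
  have "bop s P (v - 1 + 1) - bop s P (v - 1) = bop s (\<lambda>x. P (x + 1) - P x) (v - 1)"
    by (simp only: bop_diff bop_shift)
  also have "\<dots> = bop s (\<lambda>x. res L (x + (1 + int r)) - res L (x + 1)) (v - 1)" by (simp add: P add.assoc)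
  also have "\<dots> = bop s (res L) (v + int r) - bop s (res L) v" by (simp only: bop_diff bop_shift) (simp add: algebra_simps)
  finally show ?thesis
    using bop_step[of P 1 L s "v - 1"] assms by (simp add: P_def abs_minus_commute)
qed

text \<open>The \<open>L\<close> shifts add up to exactly \<open>2 ^ s\<close>, so each of them
  differs from the mean by at most the largest gap between two shifts.\<close>

lemma bop_res_half:
  assumes "16 * L^2 \<le> s" "L > 0"
  shows "\<bar>bop s (res L) v - 2 ^ s / real L\<bar> \<le> 2 ^ s / (2 * real L)"
proof -
  have "(\<Sum>r<L. bop s (res L) (v + int r)) = bop s (\<lambda>x. \<Sum>r<L. res L (x + int r)) v"
    by (simp add: bop_sum bop_shift)
  also have "(\<lambda>x. \<Sum>r<L. res L (x + int r)) = (\<lambda>x. 1)"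
    using sum_res[OF assms(2), of "\<lambda>_. 1"] by auto
  finally have m: "(\<Sum>r<L. bop s (res L) (v + int r)) = 2 ^ s" by (simp add: bop_const)
  have "real L * bop s (res L) v - 2 ^ s = (\<Sum>r<L. bop s (res L) v - bop s (res L) (v + int r))"
    by (simp add: sum_subtractf m)
  also have "\<bar>\<dots>\<bar> \<le> (\<Sum>r<L. 2 ^ s / (2 * real L))"
    by (rule order.trans[OF sum_abs sum_mono]) (use bop_res_diff[OF assms] in auto)
  also have "\<dots> = 2 ^ s / 2" using assms by simp
  finally have "\<bar>real L * bop s (res L) v - 2 ^ s\<bar> \<le> 2 ^ s / 2" .
  hence "\<bar>real L * bop s (res L) v - 2 ^ s\<bar> / real L \<le> 2 ^ s / 2 / real L"
    by (rule divide_right_mono) simp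
  moreover have "\<bar>real L * bop s (res L) v - 2 ^ s\<bar> / real L = \<bar>bop s (res L) v - 2 ^ s / real L\<bar>"
  proof -
    have "bop s (res L) v - 2 ^ s / real L = (real L * bop s (res L) v - 2 ^ s) / real L"
      using assms by (simp add: field_simps)
    thus ?thesis by (simp add: abs_divide)
  qed
  ultimately show ?thesis by simp
qed

text \<open>Convolution with a binomial distribution of standard deviation well above \<open>L\<close> halves the supremum of an
  \<open>L\<close>-periodic function of mean zero. Iterating over \<open>h\<close> pieces of the string gives equidistribution
  modulo \<open>L\<close> up to \<open>2 ^ (- h)\<close>, which is far smaller than unimodality alone would give.\<close>

definition balanced :: "nat \<Rightarrow> (int \<Rightarrow> real) \<Rightarrow> bool" where
  "balanced L F \<longleftrightarrow> (\<forall>x y. x mod int L = y mod int L \<longrightarrow> F x = F y) \<and> (\<forall>v. (\<Sum>r<L. F (v - int r)) = 0)"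

lemma balanced_periodic:
  assumes "balanced L F" "x mod int L = y mod int L"
  shows "F x = F y"
  by (rule assms(1)[unfolded balanced_def, THEN conjunct1, rule_format, OF assms(2)])

lemma balanced_zero: "balanced L F \<Longrightarrow> (\<Sum>r<L. F (v - int r)) = 0"
  by (erule balanced_def[THEN iffD1, THEN conjunct2, rule_format])

lemma balancedI:
  assumes "\<And>x y. x mod int L = y mod int L \<Longrightarrow> F x = F y" "\<And>v. (\<Sum>r<L. F (v - int r)) = 0"
  shows "balanced L F"
  unfolding balanced_def by (intro conjI allI impI assms)

lemma balanced_bop: "balanced L F \<Longrightarrow> balanced L (bop s F)"
proof (induction s)
  case 0
  have "bop 0 F = F" by (rule ext) simp
  thus ?case using 0 by simp
next
  case (Suc s)
  hence bal: "balanced L (bop s F)" by simp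
  have "bop (Suc s) F x = bop (Suc s) F y" if "x mod int L = y mod int L" for x y
  proof -
    have "(x - 1) mod int L = (y - 1) mod int L" using that by (metis mod_diff_left_eq)
    thus ?thesis using balanced_periodic[OF bal that] balanced_periodic[OF bal, of "x - 1" "y - 1"] by simp
  qed
  moreover have "(\<Sum>r<L. bop (Suc s) F (v - int r)) = 0" for v
    using balanced_zero[OF bal, of v] balanced_zero[OF bal, of "v - 1"] by (simp add: sum.distrib algebra_simps)
  ultimately show ?case by (rule balancedI)
qed

lemma bop_contract:
  assumes "16 * L^2 \<le> s" "L > 0" "balanced L F" "\<And>x. \<bar>F x\<bar> \<le> m"
  shows "\<bar>bop s F v\<bar> \<le> 2 ^ s * m / 2"
proof -
  have "F x = (\<Sum>r<L. F (- int r) * res L (x + int r))" for x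
  proof -
    have "F (- int (nat ((- x) mod int L))) = F x"
      by (rule balanced_periodic[OF assms(3)]) (use assms(2) in \<open>simp add: mod_minus_eq\<close>)
    thus ?thesis using sum_res[OF assms(2), of "\<lambda>r. F (- int r)" x] by simp
  qed
  hence "F = (\<lambda>x. \<Sum>r<L. F (- int r) * res L (x + int r))" by (rule ext)
  hence "bop s F v = bop s (\<lambda>x. \<Sum>r<L. F (- int r) * res L (x + int r)) v"
    by (rule arg_cong[where f = "\<lambda>G. bop s G v"])
  also have "\<dots> = (\<Sum>r<L. F (- int r) * bop s (res L) (v + int r))"
    by (simp add: bop_sum bop_scale bop_shift)
  \<comment> \<open>\<open>F\<close> sums to zero over a period, so the mean of the kernel may be
    subtracted; what remains of the kernel is at most half of its mean by
    \<open>bop_res_half\<close>.\<close>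
  also have "\<dots> = (\<Sum>r<L. F (- int r) * (bop s (res L) (v + int r) - 2 ^ s / real L))"
  proof -
    have "(\<Sum>r<L. F (- int r)) = 0" using balanced_zero[OF assms(3), of 0] by simp
    hence "(\<Sum>r<L. F (- int r) * (2 ^ s / real L)) = 0" by (metis sum_distrib_right mult_zero_left)
    thus ?thesis by (simp add: right_diff_distrib sum_subtractf)
  qed
  also have "\<bar>\<dots>\<bar> \<le> (\<Sum>r<L. m * (2 ^ s / (2 * real L)))"
    by (rule order.trans[OF sum_abs sum_mono])
      (simp only: abs_mult, intro mult_mono bop_res_half[OF assms(1,2)] assms(4) abs_ge_zero order.trans[OF abs_ge_zero assms(4)])
  also have "\<dots> = 2 ^ s * m / 2" using assms by simp
  finally show ?thesis .
qed

lemma bop_res_uniform: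
  assumes "16 * L^2 \<le> s'" "L > 0" "h * s' \<le> s"
  shows "\<bar>bop s (res L) v - 2 ^ s / real L\<bar> \<le> 2 ^ s / 2 ^ h"
proof -
  define F where "F x = res L x - 1 / real L" for x
  have bal: "balanced L F"
  proof (rule balancedI)
    fix x y :: int assume "x mod int L = y mod int L"
    thus "F x = F y" by (simp add: F_def res_def dvd_eq_mod_eq_0)
  next
    fix v
    have "(\<Sum>r<L. res L (v - int r)) = (\<Sum>r<L. 1 * res L (- v + int r))"
    proof (rule sum.cong)
      fix r
      show "res L (v - int r) = 1 * res L (- v + int r)"
        unfolding res_def using dvd_minus_iff[of "int L" "v - int r"] by simp
    qed simp
    also have "\<dots> = 1" by (rule sum_res[OF assms(2), of "\<lambda>_. 1"])
    finally show "(\<Sum>r<L. F (v - int r)) = 0" using assms by (simp add: F_def sum_subtractf)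
  qed
  have b: "\<bar>F x\<bar> \<le> 1" for x
    using assms(2) by (auto simp: F_def res_def abs_if field_simps)
  have it: "\<bar>bop (k * s') F v\<bar> \<le> 2 ^ (k * s') / 2 ^ k" for k v
  proof (induction k arbitrary: v)
    case (Suc k)
    have "\<bar>bop s' (bop (k * s') F) v\<bar> \<le> 2 ^ s' * (2 ^ (k * s') / 2 ^ k) / 2"
      by (rule bop_contract[OF assms(1,2) balanced_bop[OF bal] Suc])
    thus ?case by (simp add: bop_add power_add)
  qed (use b in simp)
  obtain q where q: "s = q + h * s'" using assms(3) by (metis le_add_diff_inverse2)
  have "\<bar>bop q (bop (h * s') F) v\<bar> \<le> 2 ^ q * (2 ^ (h * s') / 2 ^ h)"
    by (rule bop_abs_le[OF it])
  hence "\<bar>bop s F v\<bar> \<le> 2 ^ s / 2 ^ h" by (simp add: q bop_add power_add)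
  moreover have "bop s F v = bop s (res L) v - 2 ^ s / real L"
    unfolding F_def bop_diff bop_const by simp
  ultimately show ?thesis by simp
qed

section \<open>Exponential tail bounds\<close>

lemma bop_powi:
  assumes "z > 0"
  shows "bop s (\<lambda>x. z powi (c * x)) v = (1 + z powi (- c)) ^ s * z powi (c * v)"
proof (induction s arbitrary: v)
  case (Suc s)
  have "z powi (c * (v - 1)) = z powi (c * v) * z powi (- c)"
    using assms by (simp add: algebra_simps power_int_add[symmetric])
  thus ?case unfolding bop.simps Suc by (simp add: algebra_simps)
qed simp

text \<open>The base \<open>z\<close> is tuned to the scale \<sigma>: over
  \<open>s \<le> \<sigma>^2\<close> symmetric steps the exponential moment grows only by
  \<open>exp (1 / 2) \<le> 2\<close>, while a deviation of \<open>\<Lambda> * \<sigma>\<close> from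
  the mean gains \<open>4 ^ \<Lambda>\<close>. This simple exponential decay suffices, since the
  window \<open>Y0\<close> only has to be polynomial in \<open>w\<close>.\<close>

lemma chernoff_factor:
  assumes "s \<le> \<sigma>^2" "\<sigma> > 0"
  defines "z \<equiv> 1 + 1 / real \<sigma>"
  shows "(z + 1 / z) ^ s \<le> 2 * 2 ^ s" "z ^ (2 * \<Lambda> * \<sigma>) \<ge> 4 ^ \<Lambda>"
proof -
  have s0: "real \<sigma> > 0" using assms by simp
  have z: "z > 1" using s0 by (simp add: z_def)
  have "z + 1 / z \<le> 2 * (1 + 1 / (2 * real \<sigma>^2))"
  proof -
    define h where "h = 1 / real \<sigma>"
    have h: "h > 0" using s0 by (simp add: h_def)
    have "1 / (1 + h) \<le> 1 - h + h^2"
    proof -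
      have "(1 - h + h^2) * (1 + h) = 1 + h^3" by (simp add: algebra_simps power2_eq_square power3_eq_cube)
      hence "1 \<le> (1 - h + h^2) * (1 + h)" using h by simp
      thus ?thesis using h by (simp add: divide_le_eq)
    qed
    thus ?thesis by (simp add: z_def h_def power_divide algebra_simps)
  qed
  moreover have "1 + 1 / (2 * real \<sigma>^2) \<le> exp (1 / (2 * real \<sigma>^2))" by (rule exp_ge_add_one_self)
  ultimately have "z + 1 / z \<le> 2 * exp (1 / (2 * real \<sigma>^2))"
    by (meson mult_left_mono order.trans zero_le_numeral)
  hence "(z + 1 / z) ^ s \<le> (2 * exp (1 / (2 * real \<sigma>^2))) ^ s"
    using z by (intro power_mono) auto
  also have "\<dots> = 2 ^ s * exp (real s / (2 * real \<sigma>^2))" by (simp add: power_mult_distrib exp_of_nat_mult[symmetric])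
  also have "real s \<le> real \<sigma>^2" using assms(1) by (metis of_nat_le_iff of_nat_power)
  hence "exp (real s / (2 * real \<sigma>^2)) \<le> exp (1 / 2)" using s0 by (simp add: field_simps)
  also have "exp (1 / 2 :: real) \<le> 2"
  proof -
    have "exp (1/2 :: real) ^ 2 = exp 1" by (simp add: exp_of_nat_mult[symmetric])
    also have "\<dots> \<le> 2 ^ 2" using exp_le by simp
    finally show ?thesis by (rule power2_le_imp_le) simp
  qed
  finally show "(z + 1 / z) ^ s \<le> 2 * 2 ^ s" by (simp add: mult.commute)
  have "1 + real \<sigma> * (1 / real \<sigma>) \<le> z ^ \<sigma>" unfolding z_def
    by (rule Bernoulli_inequality) (use s0 in \<open>auto intro: order.trans[of _ 0]\<close>)
  hence "2 \<le> z ^ \<sigma>" using s0 by simp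
  hence "2 ^ (2 * \<Lambda>) \<le> (z ^ \<sigma>) ^ (2 * \<Lambda>)" by (intro power_mono) auto
  moreover have "(z ^ \<sigma>) ^ (2 * \<Lambda>) = z ^ (2 * \<Lambda> * \<sigma>)" by (metis power_mult mult.commute)
  moreover have "(2::real) ^ (2 * \<Lambda>) = 4 ^ \<Lambda>" by (simp add: power_mult)
  ultimately show "z ^ (2 * \<Lambda> * \<sigma>) \<ge> 4 ^ \<Lambda>" by simp
qed

lemma bop_lower_tail:
  assumes "s \<le> \<sigma>^2" "\<sigma> > 0" "2 * v + 2 * int (\<Lambda> * \<sigma>) \<le> int s"
  shows "bop s (\<lambda>x. of_bool (x > 0)) v \<le> 2 * 2 ^ s / 4 ^ \<Lambda>"
proof -
  define z where "z = 1 + 1 / real \<sigma>"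
  have z: "z > 1" using assms by (simp add: z_def)
  note cf = chernoff_factor[OF assms(1,2), folded z_def]
  have "bop s (\<lambda>x. of_bool (x > 0)) v \<le> bop s (\<lambda>x. z powi (2 * x)) v"
    using z by (intro bop_mono) (auto simp: one_le_power_int)
  also have "\<dots> = (1 + z powi (- 2)) ^ s * z powi (2 * v)" using z by (intro bop_powi) auto
  also have "\<dots> \<le> (1 + z powi (- 2)) ^ s * z powi (int s - int (2 * \<Lambda> * \<sigma>))"
  proof (rule mult_left_mono)
    show "z powi (2 * v) \<le> z powi (int s - int (2 * \<Lambda> * \<sigma>))"
      using z assms(3) by (intro power_int_increasing) auto
  qed (use z in auto)
  also have "z powi (int s - int (2 * \<Lambda> * \<sigma>)) = z ^ s / z ^ (2 * \<Lambda> * \<sigma>)" using z power_int_diff[of z "int s" "int (2 * \<Lambda> * \<sigma>)"] by (simp only: power_int_of_nat) simp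
  also have "(1 + z powi (- 2)) ^ s * (z ^ s / z ^ (2 * \<Lambda> * \<sigma>)) = (z + 1 / z) ^ s / z ^ (2 * \<Lambda> * \<sigma>)"
  proof -
    have "z powi (- 2) = 1 / z^2" by (simp add: power_int_minus inverse_eq_divide)
    hence "(1 + z powi (- 2)) * z = z + 1 / z" using z by (simp add: field_simps power2_eq_square)
    thus ?thesis by (simp add: power_mult_distrib[symmetric])
  qed
  also have "\<dots> \<le> 2 * 2 ^ s / 4 ^ \<Lambda>"
    using cf z by (intro frac_le) auto
  finally show ?thesis .
qed

lemma bop_upper_tail:
  assumes "s \<le> \<sigma>^2" "\<sigma> > 0" "2 * v \<ge> int s + 2 * int (\<Lambda> * \<sigma>)"
  shows "bop s (\<lambda>x. of_bool (x \<le> 0)) v \<le> 2 * 2 ^ s / 4 ^ \<Lambda>"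
proof -
  define z where "z = 1 + 1 / real \<sigma>"
  have z: "z > 1" using assms by (simp add: z_def)
  note cf = chernoff_factor[OF assms(1,2), folded z_def]
  have "bop s (\<lambda>x. of_bool (x \<le> 0)) v \<le> bop s (\<lambda>x. z powi (-2 * x)) v"
    using z by (intro bop_mono) (auto simp: one_le_power_int)
  also have "\<dots> = (1 + z powi (- (-2))) ^ s * z powi (-2 * v)" using z by (intro bop_powi) auto
  also have "\<dots> \<le> (1 + z powi (- (-2))) ^ s * z powi (- int s - int (2 * \<Lambda> * \<sigma>))"
  proof (rule mult_left_mono)
    show "z powi (-2 * v) \<le> z powi (- int s - int (2 * \<Lambda> * \<sigma>))"
      using z assms(3) by (intro power_int_increasing) auto
  qed (use z in auto)
  also have "z powi (- int s - int (2 * \<Lambda> * \<sigma>)) = 1 / z ^ s / z ^ (2 * \<Lambda> * \<sigma>)" using z by (simp add: power_int_diff power_int_minus inverse_eq_divide del: of_nat_mult)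
  also have "(1 + z powi (- (-2))) ^ s * (1 / z ^ s / z ^ (2 * \<Lambda> * \<sigma>)) = (z + 1 / z) ^ s / z ^ (2 * \<Lambda> * \<sigma>)"
  proof -
    have "(1 + z^2) * (1 / z) = z + 1 / z" using z by (simp add: field_simps power2_eq_square)
    hence "(1 + z^2) ^ s * (1 / z) ^ s = (z + 1 / z) ^ s" by (simp add: power_mult_distrib[symmetric])
    hence "(1 + z^2) ^ s * (1 / z ^ s) = (z + 1 / z) ^ s" by (simp add: power_divide)
    moreover have "(1 + z powi (- (-2))) ^ s * (1 / z ^ s / z ^ (2 * \<Lambda> * \<sigma>)) = ((1 + z^2) ^ s * (1 / z ^ s)) / z ^ (2 * \<Lambda> * \<sigma>)" by simp
    ultimately show ?thesis by (simp only:)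
  qed
  also have "\<dots> \<le> 2 * 2 ^ s / 4 ^ \<Lambda>"
    using cf z by (intro frac_le) auto
  finally show ?thesis .
qed

subsection \<open>Representations with a header\<close>

text \<open>An array is stored as a header and \<open>M\<close> bits of memory. A query knows the header and the number of ones
  modulo \<open>2 ^ l\<close> for free and reads the memory, which may be placed at any offset.\<close>

definition query_ok :: "nat \<Rightarrow> nat \<Rightarrow> nat \<Rightarrow> nat \<Rightarrow> nat \<Rightarrow> (bool list \<Rightarrow> 'h) \<Rightarrow> (bool list \<Rightarrow> bool list) \<Rightarrow> bool" where
  "query_ok W s l M p hdr mem \<longleftrightarrow> (\<forall>A. length A = s \<longrightarrow> length (mem A) = M) \<and>
     (\<forall>\<rho> h a u. \<exists>g. reads W p g \<and> (\<forall>A\<in>arrays s l \<rho>. \<forall>m. hdr A = h \<longrightarrow> u \<le> s \<longrightarrow>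
        take M (drop a m) = mem A \<longrightarrow> g m = ones (take u A)))"

text \<open>A preliminary form in which headers have any type and are only counted per residue
  class. That a header fixes the number of ones makes it possible to sort them later.\<close>

definition prerep :: "nat \<Rightarrow> nat \<Rightarrow> nat \<Rightarrow> nat \<Rightarrow> nat \<Rightarrow> nat \<Rightarrow> (bool list \<Rightarrow> 'h) \<Rightarrow> (bool list \<Rightarrow> bool list) \<Rightarrow> bool" where
  "prerep W s l M K p hdr mem \<longleftrightarrow> query_ok W s l M p hdr mem \<and>
     (\<forall>\<rho>. card (hdr ` arrays s l \<rho>) \<le> K) \<and>
     (\<forall>\<rho>. \<forall>A\<in>arrays s l \<rho>. \<forall>A'\<in>arrays s l \<rho>. hdr A = hdr A' \<longrightarrow> ones A = ones A')"

text \<open>Headers are numbers below \<open>K\<close>, sorted by the number of ones within each residue class: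
  \<open>N \<rho> v\<close> is the threshold that separates the arrays with fewer than \<open>v\<close> ones.\<close>

definition rep :: "nat \<Rightarrow> nat \<Rightarrow> nat \<Rightarrow> nat \<Rightarrow> nat \<Rightarrow> nat \<Rightarrow> (bool list \<Rightarrow> nat) \<Rightarrow> (bool list \<Rightarrow> bool list) \<Rightarrow> (nat \<Rightarrow> nat \<Rightarrow> nat) \<Rightarrow> bool" where
  "rep W s l M K p hdr mem N \<longleftrightarrow> query_ok W s l M p hdr mem \<and>
     (\<forall>A. length A = s \<longrightarrow> hdr A < K) \<and>
     (\<forall>\<rho> v. N \<rho> v \<le> K) \<and> (\<forall>\<rho> v v'. v \<le> v' \<longrightarrow> N \<rho> v \<le> N \<rho> v') \<and>
     (\<forall>\<rho> v. \<forall>A\<in>arrays s l \<rho>. hdr A < N \<rho> v \<longleftrightarrow> ones A < v)"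

text \<open>Header and memory answer every rank query, and the ranks determine the array.\<close>

lemma query_ok_inj:
  assumes "query_ok W s l M p hdr mem"
  shows "inj_on (\<lambda>A. (hdr A, mem A)) (arrays s l \<rho>)"
proof (rule inj_onI)
  fix A A' assume A: "A \<in> arrays s l \<rho>" "A' \<in> arrays s l \<rho>" "(hdr A, mem A) = (hdr A', mem A')"
  have len: "length A = s" "length A' = s" using A by (auto simp: arrays_def)
  have lm: "length (mem A) = M" using assms len by (auto simp: query_ok_def)
  show "A = A'"
  proof (rule eq_if_ranks_eq[OF len])
    fix u assume u: "u \<le> s"
    obtain g where "\<forall>A\<in>arrays s l \<rho>. \<forall>m. hdr A = hdr A' \<longrightarrow> u \<le> s \<longrightarrow>
        take M (drop 0 m) = mem A \<longrightarrow> g m = ones (take u A)"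
      using assms unfolding query_ok_def by meson
    from this[rule_format, of A "mem A"] this[rule_format, of A' "mem A"]
    show "ones (take u A) = ones (take u A')" using A u lm by simp
  qed
qed

lemma query_ok_card:
  assumes "query_ok W s l M p hdr mem" "S \<subseteq> arrays s l \<rho>"
  shows "card S \<le> card (hdr ` S) * 2 ^ M"
proof -
  have fin: "finite S" by (rule finite_subset[OF assms(2)]) simp
  have "inj_on (\<lambda>A. (hdr A, mem A)) S" using query_ok_inj[OF assms(1)] assms(2) inj_on_subset by blast
  moreover have "(\<lambda>A. (hdr A, mem A)) ` S \<subseteq> hdr ` S \<times> {B. length B = M}"
    using assms by (auto simp: query_ok_def arrays_def)
  ultimately have "card S \<le> card (hdr ` S \<times> {B :: bool list. length B = M})"
    by (rule card_inj_on_le) (simp add: fin finite_lists)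
  thus ?thesis by (simp add: card_cartesian_product card_lists)
qed

text \<open>Pigeonhole on both sides of a threshold; together the two bounds pin \<open>N\<close> in
  \<open>N_bounds\<close>.\<close>

lemma rep_card_less:
  assumes "rep W s l M K p hdr mem N"
  shows "card {A \<in> arrays s l \<rho>. ones A < v} \<le> N \<rho> v * 2 ^ M"
    and "card {A \<in> arrays s l \<rho>. \<not> ones A < v} \<le> (K - N \<rho> v) * 2 ^ M"
proof -
  have q: "query_ok W s l M p hdr mem" using assms by (simp add: rep_def)
  have "hdr ` {A \<in> arrays s l \<rho>. ones A < v} \<subseteq> {..<N \<rho> v}" using assms by (auto simp: rep_def)
  hence "card (hdr ` {A \<in> arrays s l \<rho>. ones A < v}) \<le> N \<rho> v"
    by (metis card_lessThan card_mono finite_lessThan)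
  thus "card {A \<in> arrays s l \<rho>. ones A < v} \<le> N \<rho> v * 2 ^ M"
    by (intro order.trans[OF query_ok_card[OF q, of _ \<rho>]]) auto
  have "hdr ` {A \<in> arrays s l \<rho>. \<not> ones A < v} \<subseteq> {N \<rho> v..<K}"
  proof
    fix k assume "k \<in> hdr ` {A \<in> arrays s l \<rho>. \<not> ones A < v}"
    then obtain A where A: "A \<in> arrays s l \<rho>" "\<not> ones A < v" "k = hdr A" by auto
    hence "\<not> hdr A < N \<rho> v" "hdr A < K" using assms by (auto simp: rep_def arrays_def)
    thus "k \<in> {N \<rho> v..<K}" using A by simp
  qed
  hence "card (hdr ` {A \<in> arrays s l \<rho>. \<not> ones A < v}) \<le> K - N \<rho> v"
    by (metis card_atLeastLessThan card_mono finite_atLeastLessThan)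
  thus "card {A \<in> arrays s l \<rho>. \<not> ones A < v} \<le> (K - N \<rho> v) * 2 ^ M"
    by (intro order.trans[OF query_ok_card[OF q, of _ \<rho>]]) auto
qed

lemma prerepD:
  assumes "prerep W s l M K p hdr mem"
  shows "query_ok W s l M p hdr mem" "card (hdr ` arrays s l \<rho>) \<le> K"
    "A \<in> arrays s l \<rho> \<Longrightarrow> A' \<in> arrays s l \<rho> \<Longrightarrow> hdr A = hdr A' \<Longrightarrow> ones A = ones A'"
  using assms[unfolded prerep_def, THEN conjunct1] assms[unfolded prerep_def, THEN conjunct2, THEN conjunct1]
    assms[unfolded prerep_def, THEN conjunct2, THEN conjunct2, rule_format, of A \<rho> A'] by auto

lemma prerepI:
  assumes "query_ok W s l M p hdr mem" "\<And>\<rho>. card (hdr ` arrays s l \<rho>) \<le> K"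
    "\<And>\<rho> A A'. A \<in> arrays s l \<rho> \<Longrightarrow> A' \<in> arrays s l \<rho> \<Longrightarrow> hdr A = hdr A' \<Longrightarrow> ones A = ones A'"
  shows "prerep W s l M K p hdr mem"
  unfolding prerep_def by (intro conjI allI ballI impI) (rule assms; assumption)+

text \<open>Since a header fixes the number of ones, the headers of a class can be renumbered by
  increasing number of ones: \<open>N \<rho> v\<close> counts those below \<open>v\<close>, and
  \<open>b\<close> numbers the headers that share the same number.\<close>

lemma prerep_imp_rep:
  assumes "prerep W s l M K p hdr mem"
  shows "\<exists>hdr' N. rep W s l M K p hdr' mem N"
proof -
  have q: "query_ok W s l M p hdr mem"
    and cardK: "\<And>\<rho>. card (hdr ` arrays s l \<rho>) \<le> K"
    and same_ones: "\<And>\<rho> A A'. A \<in> arrays s l \<rho> \<Longrightarrow> A' \<in> arrays s l \<rho> \<Longrightarrow> hdr A = hdr A' \<Longrightarrow> ones A = ones A'"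
    using prerepD[OF assms] by this
  define H where "H \<rho> = hdr ` arrays s l \<rho>" for \<rho>
  have finH: "finite (H \<rho>)" for \<rho> by (simp add: H_def)
  define val where "val \<rho> h = ones (SOME A. A \<in> arrays s l \<rho> \<and> hdr A = h)" for \<rho> h
  have val: "val \<rho> (hdr A) = ones A" if "A \<in> arrays s l \<rho>" for \<rho> A
  proof -
    have "(SOME B. B \<in> arrays s l \<rho> \<and> hdr B = hdr A) \<in> arrays s l \<rho> \<and> hdr (SOME B. B \<in> arrays s l \<rho> \<and> hdr B = hdr A) = hdr A"
      by (rule someI[of _ A]) (use that in simp)
    thus ?thesis unfolding val_def by (intro same_ones[OF _ that]) auto
  qed
  define N where "N \<rho> v = card {h \<in> H \<rho>. val \<rho> h < v}" for \<rho> v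
  have "\<exists>b. bij_betw b {h \<in> H \<rho>. val \<rho> h = v} {0..<card {h \<in> H \<rho>. val \<rho> h = v}}" for \<rho> v
    by (rule ex_bij_betw_finite_nat) (simp add: finH)
  then obtain b where b: "\<And>\<rho> v. bij_betw (b \<rho> v) {h \<in> H \<rho>. val \<rho> h = v} {0..<card {h \<in> H \<rho>. val \<rho> h = v}}" by metis
  \<comment> \<open>The class is recomputed from \<open>ones A\<close>, because the new header has
    to be a function of the array alone.\<close>
  define hdr' where "hdr' A = (let \<rho> = ones A mod 2 ^ l in N \<rho> (ones A) + b \<rho> (ones A) (hdr A))" for A
  have hdr': "hdr' A = N \<rho> (ones A) + b \<rho> (ones A) (hdr A)" if "A \<in> arrays s l \<rho>" for A \<rho>
    using that by (simp add: hdr'_def arrays_def)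
  have inH: "hdr A \<in> {h \<in> H \<rho>. val \<rho> h = ones A}" if "A \<in> arrays s l \<rho>" for A \<rho>
    using that val[OF that] by (auto simp: H_def)
  have b_less: "b \<rho> (ones A) (hdr A) < card {h \<in> H \<rho>. val \<rho> h = ones A}" if "A \<in> arrays s l \<rho>" for A \<rho>
    using bij_betwE[OF b] inH[OF that] by fastforce
  have Nmono: "N \<rho> v \<le> N \<rho> v'" if "v \<le> v'" for \<rho> v v'
    unfolding N_def by (rule card_mono) (use that finH in auto)
  have NK: "N \<rho> v \<le> K" for \<rho> v
    unfolding N_def by (rule order.trans[OF card_mono cardK[of \<rho>]]) (auto simp: H_def)
  have NSuc: "N \<rho> v + card {h \<in> H \<rho>. val \<rho> h = v} = N \<rho> (Suc v)" for \<rho> v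
    unfolding N_def by (subst card_Un_disjoint[symmetric]) (auto simp: finH intro!: arg_cong[where f = card])
  have hN: "hdr' A < N \<rho> v \<longleftrightarrow> ones A < v" if A: "A \<in> arrays s l \<rho>" for A \<rho> v
  proof
    assume "ones A < v"
    hence "N \<rho> (Suc (ones A)) \<le> N \<rho> v" by (intro Nmono) simp
    thus "hdr' A < N \<rho> v" using NSuc[of \<rho> "ones A"] b_less[OF A] hdr'[OF A] by simp
  next
    assume "hdr' A < N \<rho> v"
    thus "ones A < v" using Nmono[of v "ones A" \<rho>] hdr'[OF A] by linarith
  qed
  have inj: "hdr A = hdr A'" if A: "A \<in> arrays s l \<rho>" "A' \<in> arrays s l \<rho>" and eq: "hdr' A = hdr' A'" for A A' \<rho>
  proof -
    have on: "ones A = ones A'"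
      using hN[OF A(1), of "ones A'"] hN[OF A(2), of "ones A'"] hN[OF A(1), of "ones A"] hN[OF A(2), of "ones A"] eq by auto
    hence eqb: "b \<rho> (ones A) (hdr A) = b \<rho> (ones A) (hdr A')"
      using eq hdr'[OF A(1)] hdr'[OF A(2)] by simp
    have in2: "hdr A' \<in> {h \<in> H \<rho>. val \<rho> h = ones A}" unfolding on by (rule inH[OF A(2)])
    show ?thesis by (rule inj_onD[OF bij_betw_imp_inj_on[OF b[of \<rho> "ones A"]] eqb inH[OF A(1)] in2])
  qed
  have "hdr' A < K" if "length A = s" for A
  proof -
    have "A \<in> arrays s l (ones A mod 2 ^ l)" using that by (simp add: arrays_def)
    from hN[OF this, of "Suc (ones A)"] show ?thesis using NK[of "ones A mod 2 ^ l" "Suc (ones A)"] by simp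
  qed
  moreover have "query_ok W s l M p hdr' mem"
    unfolding query_ok_def
  proof (intro conjI allI)
    fix A show "length A = s \<longrightarrow> length (mem A) = M" using q by (simp add: query_ok_def)
  next
    fix \<rho> k o' u
    show "\<exists>g. reads W p g \<and> (\<forall>A\<in>arrays s l \<rho>. \<forall>m. hdr' A = k \<longrightarrow> u \<le> s \<longrightarrow>
        take M (drop o' m) = mem A \<longrightarrow> g m = ones (take u A))"
    proof (cases "\<exists>A\<in>arrays s l \<rho>. hdr' A = k")
      case True
      then obtain A0 where A0: "A0 \<in> arrays s l \<rho>" "hdr' A0 = k" by blast
      obtain g where "reads W p g" "\<forall>A\<in>arrays s l \<rho>. \<forall>m. hdr A = hdr A0 \<longrightarrow> u \<le> s \<longrightarrow>
          take M (drop o' m) = mem A \<longrightarrow> g m = ones (take u A)"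
        using q unfolding query_ok_def by meson
      moreover have "hdr A = hdr A0" if "A \<in> arrays s l \<rho>" "hdr' A = k" for A
        by (rule inj[OF that(1) A0(1)]) (use that A0 in simp)
      ultimately show ?thesis by (intro exI[of _ g]) blast
    next
      case False
      thus ?thesis using reads.const[of W p 0] by blast
    qed
  qed
  ultimately have "rep W s l M K p hdr' mem N" unfolding rep_def using hN NK Nmono by simp
  thus ?thesis by blast
qed

text \<open>Within the coarser class, the arrays with and without the finer residue have disjoint
  sets of headers, as a header fixes the number of ones. The arrays that are dropped need at least
  their number divided by \<open>2 ^ M\<close> headers, so passing to the finer class does not
  increase the absolute waste.\<close>

lemma prerep_refine:
  assumes "prerep W s l M K p hdr mem" "l \<le> l'"
    and "\<And>\<rho>. card (arrays s l' \<rho>) + K * 2 ^ M \<le> K' * 2 ^ M + card (arrays s l (\<rho> mod 2 ^ l))"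
  shows "prerep W s l' M K' p hdr mem"
proof -
  have q: "query_ok W s l M p hdr mem"
    and cardK: "\<And>\<rho>. card (hdr ` arrays s l \<rho>) \<le> K"
    and same_ones: "\<And>\<rho> A A'. A \<in> arrays s l \<rho> \<Longrightarrow> A' \<in> arrays s l \<rho> \<Longrightarrow> hdr A = hdr A' \<Longrightarrow> ones A = ones A'"
    using prerepD[OF assms(1)] by this
  have sub: "arrays s l' \<rho> \<subseteq> arrays s l (\<rho> mod 2 ^ l)" for \<rho>
    using assms(2) by (auto simp: arrays_def mod_mod_cancel le_imp_power_dvd)
  have "query_ok W s l' M p hdr mem" unfolding query_ok_def
  proof (intro conjI allI)
    fix A show "length A = s \<longrightarrow> length (mem A) = M" using q by (simp add: query_ok_def)
  next
    fix \<rho> h o' u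
    obtain g where "reads W p g" "\<forall>A\<in>arrays s l (\<rho> mod 2 ^ l). \<forall>m. hdr A = h \<longrightarrow> u \<le> s \<longrightarrow>
          take M (drop o' m) = mem A \<longrightarrow> g m = ones (take u A)"
      using q unfolding query_ok_def by meson
    thus "\<exists>g. reads W p g \<and> (\<forall>A\<in>arrays s l' \<rho>. \<forall>m. hdr A = h \<longrightarrow> u \<le> s \<longrightarrow>
          take M (drop o' m) = mem A \<longrightarrow> g m = ones (take u A))" using sub by (meson subsetD)
  qed
  moreover have "card (hdr ` arrays s l' \<rho>) \<le> K'" for \<rho>
  proof -
    let ?R = "arrays s l (\<rho> mod 2 ^ l)" let ?S = "arrays s l' \<rho>"
    have dis: "hdr ` ?S \<inter> hdr ` (?R - ?S) = {}"
    proof (rule ccontr)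
      assume "\<not> ?thesis"
      then obtain A A' where "A \<in> ?S" "A' \<in> ?R" "A' \<notin> ?S" "hdr A = hdr A'" by auto
      moreover from this have "ones A = ones A'" using same_ones[of A "\<rho> mod 2 ^ l" A'] sub[of \<rho>] by blast
      ultimately show False by (auto simp: arrays_def)
    qed
    have "card (hdr ` ?S) + card (hdr ` (?R - ?S)) = card (hdr ` ?R)"
      using sub[of \<rho>] dis by (subst card_Un_disjoint[symmetric]) (auto intro!: arg_cong[where f = card])
    hence 1: "(card (hdr ` ?S) + card (hdr ` (?R - ?S))) * 2 ^ M \<le> K * 2 ^ M" using cardK[of "\<rho> mod 2 ^ l"] by simp
    have 2: "card (?R - ?S) \<le> card (hdr ` (?R - ?S)) * 2 ^ M" by (rule query_ok_card[OF q]) auto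
    have 3: "card (?R - ?S) + card ?S = card ?R"
      using sub[of \<rho>] by (subst card_Un_disjoint[symmetric]) (auto intro!: arg_cong[where f = card])
    have "card (hdr ` ?S) * 2 ^ M \<le> K' * 2 ^ M"
      using 1 2 3 assms(3)[of \<rho>] by (simp only: add_mult_distrib)
    thus ?thesis by simp
  qed
  moreover have "ones A = ones A'" if "A \<in> arrays s l' \<rho>" "A' \<in> arrays s l' \<rho>" "hdr A = hdr A'" for A A' \<rho>
    using that same_ones[of A "\<rho> mod 2 ^ l" A'] sub[of \<rho>] by blast
  ultimately show ?thesis by (rule prerepI)
qed

text \<open>Arrays are indexed among those with the same number of ones; the low \<open>M\<close>
  bits of the index form the memory, the rest goes to the header. Rounding costs at most one header
  for each of the \<open>s + 1\<close> numbers of ones.\<close>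

lemma prerep_base:
  assumes "s + 1 = \<kappa> + M" "M \<le> W" "\<kappa> > 0"
  shows "\<exists>(hdr :: bool list \<Rightarrow> nat \<times> nat) mem. prerep W s 0 M (2 ^ (\<kappa> - 1) + s + 1) 1 hdr mem"
proof -
  define X where "X v = {A. length A = s \<and> ones A = v}" for v
  have fin: "finite (X v)" for v unfolding X_def by (rule finite_subset[OF _ finite_lists[of s]]) auto
  have "\<exists>b. bij_betw b (X v) {0..<card (X v)}" for v by (rule ex_bij_betw_finite_nat) (rule fin)
  then obtain b where b: "\<And>v. bij_betw (b v) (X v) {0..<card (X v)}" by metis
  define ix where "ix A = b (ones A) A" for A
  have ix: "ix A < card (X (ones A))" if "length A = s" for A
    using bij_betwE[OF b[of "ones A"]] that unfolding ix_def X_def by force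
  define hdr where "hdr A = (ones A, ix A div 2 ^ M)" for A
  define mem where "mem A = bl M (ix A)" for A
  have "card (hdr ` arrays s 0 \<rho>) \<le> 2 ^ (\<kappa> - 1) + s + 1" for \<rho>
  proof -
    have "hdr ` arrays s 0 \<rho> \<subseteq> (SIGMA v:{..s}. {..card (X v) div 2 ^ M})"
      using ix ones_le by (auto simp: hdr_def arrays_def intro: div_le_mono less_imp_le)
    hence "card (hdr ` arrays s 0 \<rho>) \<le> card (SIGMA v:{..s}. {..card (X v) div 2 ^ M})"
      by (rule card_mono[rotated]) auto
    also have "\<dots> = (\<Sum>v\<le>s. card (X v) div 2 ^ M + 1)" by simp
    also have "\<dots> = (\<Sum>v\<le>s. card (X v) div 2 ^ M) + s + 1" by (simp only: sum.distrib) simp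
    also have "(\<Sum>v\<le>s. card (X v) div 2 ^ M) \<le> 2 ^ (\<kappa> - 1)"
    proof -
      have "(\<Sum>v\<le>s. card (X v) div 2 ^ M) * 2 ^ M \<le> (\<Sum>v\<le>s. card (X v))"
        unfolding sum_distrib_right by (rule sum_mono) simp
      also have "\<dots> = card (\<Union>v\<le>s. X v)"
        by (rule card_UN_disjoint[symmetric]) (use fin in \<open>auto simp: X_def\<close>)
      also have "(\<Union>v\<le>s. X v) = {A. length A = s}" using ones_le by (auto simp: X_def)
      also have "card \<dots> = 2 ^ (\<kappa> - 1) * 2 ^ M"
      proof -
        have "s = \<kappa> - 1 + M" using assms by simp
        thus ?thesis by (simp only: card_lists power_add)
      qed
      finally show ?thesis by simp
    qed
    finally show ?thesis by simp
  qed
  moreover have "query_ok W s 0 M 1 hdr mem" unfolding query_ok_def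
  proof (intro conjI allI)
    fix A show "length A = s \<longrightarrow> length (mem A) = M" by (simp add: mem_def)
  next
    fix \<rho> h o' u
    \<comment> \<open>As \<open>M \<le> W\<close>, one read returns the whole memory and thereby the
      array.\<close>
    define g where "g x = ones (take u (THE A. length A = s \<and> hdr A = h \<and> mem A = take M x))" for x
    have "reads W 1 (\<lambda>m. g (take W (drop o' m)))" using reads_map[OF reads_one[of W o'], of g] by simp
    moreover have "g (take W (drop o' m)) = ones (take u A)" if A: "length A = s" "hdr A = h" "take M (drop o' m) = mem A" for A m
    proof -
      have "A' = A" if "length A' = s" "hdr A' = h" "mem A' = mem A" for A'
      proof -
        have on: "ones A' = ones A" "ix A' div 2 ^ M = ix A div 2 ^ M" using that A by (auto simp: hdr_def)
        moreover have "ix A' mod 2 ^ M = ix A mod 2 ^ M" using that(3) by (metis mem_def nb_bl)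
        ultimately have "ix A' = ix A" by (metis div_mult_mod_eq)
        hence "b (ones A) A' = b (ones A) A" by (simp add: ix_def on)
        moreover have "A' \<in> X (ones A)" "A \<in> X (ones A)" using that A on by (auto simp: X_def)
        ultimately show ?thesis using bij_betw_imp_inj_on[OF b[of "ones A"]] by (meson inj_onD)
      qed
      hence "(THE A'. length A' = s \<and> hdr A' = h \<and> mem A' = mem A) = A" using A by (intro the_equality) auto
      moreover have "take M (take W (drop o' m)) = mem A" using A(3) assms(2) by (simp add: min_absorb1)
      ultimately show ?thesis by (simp add: g_def)
    qed
    ultimately show "\<exists>g. reads W 1 g \<and> (\<forall>A\<in>arrays s 0 \<rho>. \<forall>m. hdr A = h \<longrightarrow> u \<le> s \<longrightarrow>
          take M (drop o' m) = mem A \<longrightarrow> g m = ones (take u A))" by (auto simp: arrays_def)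
  qed
  ultimately have "prerep W s 0 M (2 ^ (\<kappa> - 1) + s + 1) 1 hdr mem"
    by (intro prerepI) (auto simp: hdr_def)
  thus ?thesis by blast
qed

subsection \<open>Cells that determine the carry\<close>

text \<open>Let \<open>y\<close> and \<open>x\<close> be the prefix sums modulo \<open>2 ^ l\<close> before and after a block with header \<open>k\<close>.
  Then \<open>carry\<close> is the increase of the prefix sum divided by \<open>2 ^ l\<close>, expressed by thresholds so that it
  makes sense for all triples. A cell of resolution \<open>t\<close> fixes the leading \<open>t\<close> bits of \<open>y\<close>, \<open>x\<close> and \<open>k\<close>
  (all bits, if there are fewer, by truncated subtraction); it is determined if all its triples are valid and have the same carry.\<close>

definition carry :: "(nat \<Rightarrow> nat \<Rightarrow> nat) \<Rightarrow> nat \<Rightarrow> nat \<Rightarrow> nat \<Rightarrow> nat \<Rightarrow> nat \<Rightarrow> nat" where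
  "carry N l gm y x k = card {g. 1 \<le> g \<and> g \<le> gm \<and> N ((x + 2 ^ l - y) mod 2 ^ l) (g * 2 ^ l - y) \<le> k}"

definition determined :: "(nat \<Rightarrow> nat \<Rightarrow> nat) \<Rightarrow> nat \<Rightarrow> nat \<Rightarrow> nat \<Rightarrow> nat \<Rightarrow> nat \<Rightarrow> nat \<Rightarrow> nat \<Rightarrow> nat \<Rightarrow> bool" where
  "determined N l \<kappa> K gm t X Y Z \<longleftrightarrow> (\<exists>g. \<forall>y x k. y < 2 ^ l \<longrightarrow> x < 2 ^ l \<longrightarrow> y div 2 ^ (l - t) = X \<longrightarrow>
      x div 2 ^ (l - t) = Y \<longrightarrow> k div 2 ^ (\<kappa> - t) = Z \<longrightarrow> k < K \<and> carry N l gm y x k = g)"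

definition undetermined :: "(nat \<Rightarrow> nat \<Rightarrow> nat) \<Rightarrow> nat \<Rightarrow> nat \<Rightarrow> nat \<Rightarrow> nat \<Rightarrow> nat \<Rightarrow> nat \<Rightarrow> nat \<Rightarrow> nat set" where
  "undetermined N l \<kappa> K gm t X Y = {Z. (\<exists>k<K. k div 2 ^ (\<kappa> - t) = Z) \<and> \<not> determined N l \<kappa> K gm t X Y Z}"

text \<open>The threshold \<open>g * 2 ^ l - y\<close> is passed exactly if
  \<open>g * 2 ^ l \<le> ones A + y\<close>. The bound on \<open>gm\<close> is strict because
  \<open>y\<close> may contribute one more multiple of \<open>2 ^ l\<close> than \<open>s\<close>
  alone.\<close>

lemma quo_eq:
  assumes "rep W s l M K p hdr mem N" "A \<in> arrays s l ((x + 2 ^ l - y) mod 2 ^ l)" "y < 2 ^ l" "s div 2 ^ l < gm"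
  shows "carry N l gm y x (hdr A) = (ones A + y) div 2 ^ l"
proof -
  have le: "(ones A + y) div 2 ^ l \<le> gm"
  proof -
    have "ones A \<le> s" using assms(2) ones_le[of A] by (simp add: arrays_def)
    hence "(ones A + y) div 2 ^ l \<le> (s + 2 ^ l) div 2 ^ l" using assms(3) by (intro div_le_mono) simp
    also have "\<dots> = s div 2 ^ l + 1" by simp
    finally show ?thesis using assms(4) by simp
  qed
  have "hdr A < N ((x + 2 ^ l - y) mod 2 ^ l) v \<longleftrightarrow> ones A < v" for v
    using assms(1,2) unfolding rep_def by blast
  hence "{g. 1 \<le> g \<and> g \<le> gm \<and> N ((x + 2 ^ l - y) mod 2 ^ l) (g * 2 ^ l - y) \<le> hdr A}
      = {g. 1 \<le> g \<and> g \<le> gm \<and> g * 2 ^ l - y \<le> ones A}" by (simp add: not_less[symmetric])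
  also have "\<dots> = {1..(ones A + y) div 2 ^ l}"
  proof -
    have iff: "g * 2 ^ l - y \<le> ones A \<longleftrightarrow> g \<le> (ones A + y) div 2 ^ l" for g
      by (subst less_eq_div_iff_mult_less_eq) (simp_all only: le_diff_conv zero_less_power zero_less_numeral)
    show ?thesis unfolding iff using le by auto
  qed
  finally show ?thesis by (simp add: carry_def)
qed

lemma neq_cases: "P \<noteq> Q \<Longrightarrow> (P \<and> \<not> Q) \<or> (Q \<and> \<not> P)" by blast

definition incell :: "nat \<Rightarrow> nat \<Rightarrow> nat \<Rightarrow> nat \<Rightarrow> nat \<Rightarrow> nat \<Rightarrow> nat \<Rightarrow> nat \<Rightarrow> nat \<Rightarrow> bool" where
  "incell l \<kappa> t X Y Z y x k \<longleftrightarrow> y < 2 ^ l \<and> x < 2 ^ l \<and> y div 2 ^ (l - t) = X \<and> x div 2 ^ (l - t) = Y \<and> k div 2 ^ (\<kappa> - t) = Z"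

text \<open>A carry counts the thresholds that are passed, so two triples with different carries are
  separated by a single threshold. The excluded \<open>Z\<close> is the cell that may straddle the
  end \<open>K\<close> of the header range.\<close>

lemma und_cases:
  assumes "Z \<in> undetermined N l \<kappa> K gm t X Y" and nK: "Z \<noteq> K div 2 ^ (\<kappa> - t)"
  obtains g y x k y' x' k' where "1 \<le> g" "g \<le> gm" "incell l \<kappa> t X Y Z y x k" "incell l \<kappa> t X Y Z y' x' k'" "k' < K"
     "N ((x + 2 ^ l - y) mod 2 ^ l) (g * 2 ^ l - y) \<le> k" "k' < N ((x' + 2 ^ l - y') mod 2 ^ l) (g * 2 ^ l - y')"
proof -
  obtain k0 where k0: "k0 < K" "k0 div 2 ^ (\<kappa> - t) = Z" using assms by (auto simp: undetermined_def)
  have ltK: "k < K" if "k div 2 ^ (\<kappa> - t) = Z" for k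
  proof (rule ccontr)
    assume "\<not> k < K"
    hence "K div 2 ^ (\<kappa> - t) \<le> Z" using that div_le_mono[of K k "2 ^ (\<kappa> - t)"] by simp
    moreover have "Z \<le> K div 2 ^ (\<kappa> - t)" using k0 div_le_mono[of k0 K "2 ^ (\<kappa> - t)"] by simp
    ultimately show False using nK by simp
  qed
  have nd: "\<exists>y x k. incell l \<kappa> t X Y Z y x k \<and> carry N l gm y x k \<noteq> g" for g
  proof (rule ccontr)
    assume no: "\<not> ?thesis"
    have "determined N l \<kappa> K gm t X Y Z" unfolding determined_def
    proof (intro exI[of _ g] allI impI conjI)
      fix y x k assume c: "y < 2 ^ l" "x < 2 ^ l" "y div 2 ^ (l - t) = X" "x div 2 ^ (l - t) = Y" "k div 2 ^ (\<kappa> - t) = Z"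
      show "k < K" by (rule ltK) fact
      have "incell l \<kappa> t X Y Z y x k" unfolding incell_def by (intro conjI c)
      thus "carry N l gm y x k = g" using no by blast
    qed
    thus False using assms by (simp add: undetermined_def)
  qed
  from nd[of 0] obtain y x k where c: "incell l \<kappa> t X Y Z y x k" by (elim exE conjE)
  from nd[of "carry N l gm y x k"] obtain y' x' k' where c': "incell l \<kappa> t X Y Z y' x' k'" and ne: "carry N l gm y' x' k' \<noteq> carry N l gm y x k"
    by (elim exE conjE)
  define S where "S y x k = {g. 1 \<le> g \<and> g \<le> gm \<and> N ((x + 2 ^ l - y) mod 2 ^ l) (g * 2 ^ l - y) \<le> k}" for y x k
  have "S y' x' k' \<noteq> S y x k" using ne unfolding carry_def S_def by (rule contrapos_nn) simp
  then obtain g where "(g \<in> S y' x' k') \<noteq> (g \<in> S y x k)" by blast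
  hence "(g \<in> S y' x' k' \<and> g \<notin> S y x k) \<or> (g \<in> S y x k \<and> g \<notin> S y' x' k')" by (rule neq_cases)
  moreover have kK: "k < K" "k' < K" using c c' ltK by (simp_all add: incell_def)
  moreover have inS: "g \<in> S y x k \<longleftrightarrow> 1 \<le> g \<and> g \<le> gm \<and> N ((x + 2 ^ l - y) mod 2 ^ l) (g * 2 ^ l - y) \<le> k" for y x k
    unfolding S_def by (rule mem_Collect_eq)
  ultimately consider "g \<in> S y' x' k'" "g \<notin> S y x k" | "g \<in> S y x k" "g \<notin> S y' x' k'" by argo
  thus ?thesis
  proof cases
    case 1
    hence "1 \<le> g" "g \<le> gm" "N ((x' + 2 ^ l - y') mod 2 ^ l) (g * 2 ^ l - y') \<le> k'" "k < N ((x + 2 ^ l - y) mod 2 ^ l) (g * 2 ^ l - y)"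
      unfolding inS by linarith+
    thus ?thesis by (rule that[OF _ _ c' c kK(1)])
  next
    case 2
    hence "1 \<le> g" "g \<le> gm" "N ((x + 2 ^ l - y) mod 2 ^ l) (g * 2 ^ l - y) \<le> k" "k' < N ((x' + 2 ^ l - y') mod 2 ^ l) (g * 2 ^ l - y')"
      unfolding inS by linarith+
    thus ?thesis by (rule that[OF _ _ c c' kK(2)])
  qed
qed

text \<open>From resolution \<open>l\<close> on both residues are exact, so every \<open>g\<close>
  has one fixed threshold, and that threshold cuts at most one cell.\<close>

lemma card_und_fine:
  assumes "l \<le> t"
  shows "card (undetermined N l \<kappa> K gm t X Y) \<le> gm + 1"
proof -
  define f where "f g = N ((Y + 2 ^ l - X) mod 2 ^ l) (g * 2 ^ l - X) div 2 ^ (\<kappa> - t)" for g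
  have "undetermined N l \<kappa> K gm t X Y \<subseteq> insert (K div 2 ^ (\<kappa> - t)) (f ` {1..gm})"
  proof
    fix Z assume Z: "Z \<in> undetermined N l \<kappa> K gm t X Y"
    have l0: "l - t = 0" using assms by simp
    show "Z \<in> insert (K div 2 ^ (\<kappa> - t)) (f ` {1..gm})"
    proof (cases "Z = K div 2 ^ (\<kappa> - t)")
      case False
      from und_cases[OF Z False] obtain g y x k y' x' k' where g: "1 \<le> g" "g \<le> gm"
        and c: "incell l \<kappa> t X Y Z y x k" "incell l \<kappa> t X Y Z y' x' k'"
        and n: "N ((x + 2 ^ l - y) mod 2 ^ l) (g * 2 ^ l - y) \<le> k" "k' < N ((x' + 2 ^ l - y') mod 2 ^ l) (g * 2 ^ l - y')" .
      have e: "y = X" "x = Y" "y' = X" "x' = Y" using c l0 by (simp_all add: incell_def)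
      have z: "k div 2 ^ (\<kappa> - t) = Z" "k' div 2 ^ (\<kappa> - t) = Z" using c by (simp_all add: incell_def)
      have "k' div 2 ^ (\<kappa> - t) \<le> f g" unfolding f_def by (rule div_le_mono) (use n e in simp)
      moreover have "f g \<le> k div 2 ^ (\<kappa> - t)" unfolding f_def by (rule div_le_mono) (use n e in simp)
      ultimately have "Z = f g" using z by simp
      thus ?thesis using g by auto
    qed simp
  qed
  hence "card (undetermined N l \<kappa> K gm t X Y) \<le> card (insert (K div 2 ^ (\<kappa> - t)) (f ` {1..gm}))" by (rule card_mono[rotated]) simp
  also have "\<dots> \<le> Suc (card (f ` {1..gm}))" by (simp add: card_insert_if)
  also have "card (f ` {1..gm}) \<le> gm" using card_image_le[of "{1..gm}" f] by simp
  finally show ?thesis by simp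
qed

definition stp :: "nat \<Rightarrow> int \<Rightarrow> real" where "stp L x = of_bool (x > 0 \<and> int L dvd x)"

text \<open>The assumptions on \<open>bop\<close> say that the thresholds are close to a Lipschitz function of the difference
  \<open>x - y\<close>, and that all but \<open>O(Y0)\<close> of them lie near the two ends of the range of headers.\<close>

locale child =
  fixes W s l M K p :: nat and hdr :: "bool list \<Rightarrow> nat" and mem N and \<kappa> T gm Y0 :: nat
  assumes rep: "rep W s l M K p hdr mem N"
    and size: "s + 1 = M + \<kappa> + l"
    and T\<kappa>: "T + 4 \<le> \<kappa>"
    and K_le: "real K \<le> 2 ^ (\<kappa> - 1) + 2 ^ (\<kappa> - 2 - T)"
    and unif: "\<And>v. \<bar>bop s (res (2 ^ l)) v - 2 ^ s / 2 ^ l\<bar> \<le> 2 ^ s / 2 ^ (l + T + 1)"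
    and lip: "\<And>v. \<bar>bop s (stp (2 ^ l)) (v + 1) - bop s (stp (2 ^ l)) v\<bar> \<le> 2 ^ s / 2 ^ (2 * l)"
    and low: "\<And>v. 2 * v + 2 * int (2 ^ l * Y0) \<le> int s \<Longrightarrow> bop s (\<lambda>x. of_bool (x > 0)) v \<le> 2 ^ s / 2 ^ (l + T + 1)"
    and high: "\<And>v. int s + 2 * int (2 ^ l * Y0) \<le> 2 * v \<Longrightarrow> bop s (\<lambda>x. of_bool (x \<le> 0)) v \<le> 2 ^ s / 2 ^ (l + T + 1)"
begin

text \<open>Carries from \<open>glo\<close> up to, but excluding, \<open>ghi\<close> are the typical
  ones. Truncated subtraction may give \<open>glo = 0\<close>; then no carry lies below the
  window.\<close>

definition glo where "glo = s div 2 div 2 ^ l - Y0 - 1"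
definition ghi where "ghi = s div 2 div 2 ^ l + Y0 + 2"
text \<open>The ideal threshold: the number of arrays below it, measured in headers of
  \<open>2 ^ M\<close> arrays each.\<close>

definition a where "a v = bop s (stp (2 ^ l)) v / 2 ^ M"
abbreviation vv :: "nat \<Rightarrow> nat \<Rightarrow> nat \<Rightarrow> int" where "vv g y x \<equiv> int (g * 2 ^ l) + int x - int y"
abbreviation NN where "NN g y x \<equiv> N ((x + 2 ^ l - y) mod 2 ^ l) (g * 2 ^ l - y)"

lemma scale: "2 ^ s / 2 ^ (l + j) / 2 ^ M = (2 ^ (\<kappa> - 1) / 2 ^ j :: real)"
proof -
  have "s = (\<kappa> - 1) + l + M" using size T\<kappa> by simp
  thus ?thesis by (simp add: power_add)
qed

lemma mod_eq:
  assumes "y < 2 ^ l" "x < 2 ^ l"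
  shows "n mod 2 ^ l = (x + 2 ^ l - y) mod 2 ^ l \<longleftrightarrow> int (2 ^ l) dvd (vv g y x - int n)"
proof -
  have "n mod 2 ^ l = (x + 2 ^ l - y) mod 2 ^ l \<longleftrightarrow> int n mod int (2 ^ l) = int (x + 2 ^ l - y) mod int (2 ^ l)"
    by (metis of_nat_eq_iff zmod_int)
  also have "int (x + 2 ^ l - y) = int x + int (2 ^ l) - int y" using assms by simp
  also have "int n mod int (2 ^ l) = (int x + int (2 ^ l) - int y) mod int (2 ^ l) \<longleftrightarrow> (vv g y x) mod int (2 ^ l) = int n mod int (2 ^ l)"
  proof -
    have "vv g y x = (int x + int (2 ^ l) - int y) + (int g - 1) * int (2 ^ l)" by (simp add: algebra_simps)
    hence "vv g y x mod int (2 ^ l) = (int x + int (2 ^ l) - int y) mod int (2 ^ l)" by (simp only: mod_mult_self1)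
    thus ?thesis by auto
  qed
  also have "\<dots> \<longleftrightarrow> int (2 ^ l) dvd (vv g y x - int n)" by (rule mod_eq_dvd_iff)
  finally show ?thesis .
qed

text \<open>\<open>n + y\<close> is congruent to \<open>x < 2 ^ l\<close>, hence it lies below
  \<open>g * 2 ^ l\<close> iff it lies below \<open>g * 2 ^ l + x\<close>. With the second form the
  threshold counts become a function of the one integer \<open>vv g y x\<close>, so that a Lipschitz
  bound in this variable controls both residues.\<close>

lemma less_eq:
  assumes "y < 2 ^ l" "x < 2 ^ l" "int (2 ^ l) dvd (vv g y x - int n)"
  shows "n < g * 2 ^ l - y \<longleftrightarrow> vv g y x - int n > 0"
proof -
  obtain c where c: "vv g y x - int n = int (2 ^ l) * c" using assms(3) by (auto elim: dvdE)
  have L: "int (2 ^ l) > 0" by simp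
  show ?thesis
  proof (cases "c > 0")
    case True
    hence "int (2 ^ l) * 1 \<le> int (2 ^ l) * c" by (intro mult_left_mono) auto
    hence "int n + int y \<le> int (g * 2 ^ l) + int x - int (2 ^ l)" using c by linarith
    hence "int n + int y < int (g * 2 ^ l)" using assms(2) by linarith
    moreover have "vv g y x - int n > 0" unfolding c using True by simp
    ultimately show ?thesis by linarith
  next
    case False
    hence "int (2 ^ l) * c \<le> 0" by (simp add: mult_nonneg_nonpos)
    moreover from this have "int n + int y \<ge> int (g * 2 ^ l)" using c by linarith
    ultimately show ?thesis using c by linarith
  qed
qed

lemma card_arrs_less:
  assumes "y < 2 ^ l" "x < 2 ^ l"
  shows "real (card {A \<in> arrays s l ((x + 2 ^ l - y) mod 2 ^ l). ones A < g * 2 ^ l - y}) = bop s (stp (2 ^ l)) (vv g y x)"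
proof -
  have "{A \<in> arrays s l ((x + 2 ^ l - y) mod 2 ^ l). ones A < g * 2 ^ l - y}
    = {A. length A = s \<and> (vv g y x - int (ones A) > 0 \<and> int (2 ^ l) dvd (vv g y x - int (ones A)))}"
    unfolding arrays_def using mod_eq[OF assms, of _ g] less_eq[OF assms, of g] by auto
  thus ?thesis unfolding stp_def using card_ones[of s "\<lambda>x. x > 0 \<and> int (2 ^ l) dvd x" "vv g y x"] by simp
qed

lemma card_arrs:
  assumes "y < 2 ^ l" "x < 2 ^ l"
  shows "real (card (arrays s l ((x + 2 ^ l - y) mod 2 ^ l))) = bop s (res (2 ^ l)) (vv g y x)"
proof -
  have "arrays s l ((x + 2 ^ l - y) mod 2 ^ l) = {A. length A = s \<and> int (2 ^ l) dvd (vv g y x - int (ones A))}"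
    unfolding arrays_def using mod_eq[OF assms, of _ g] by auto
  thus ?thesis unfolding res_def using card_ones[of s "\<lambda>x. int (2 ^ l) dvd x" "vv g y x"] by simp
qed

text \<open>The arrays below and above a threshold both need their share of headers, and the shares
  add up to nearly \<open>K\<close>. The slack consists of the excess of \<open>K\<close> over
  \<open>2 ^ (\<kappa> - 1)\<close> and of the equidistribution error, each at most
  \<open>2 ^ (\<kappa> - 2 - T)\<close>.\<close>

lemma N_bounds:
  assumes "y < 2 ^ l" "x < 2 ^ l"
  shows "a (vv g y x) \<le> real (NN g y x)" "real (NN g y x) \<le> a (vv g y x) + 2 ^ (\<kappa> - 1 - T)"
proof -
  let ?\<rho> = "(x + 2 ^ l - y) mod 2 ^ l"
  have "card {A \<in> arrays s l ?\<rho>. ones A < g * 2 ^ l - y} \<le> NN g y x * 2 ^ M"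
    by (rule rep_card_less(1)[OF rep])
  hence "real (card {A \<in> arrays s l ?\<rho>. ones A < g * 2 ^ l - y}) \<le> real (NN g y x * 2 ^ M)" by (simp only: of_nat_le_iff)
  thus "a (vv g y x) \<le> real (NN g y x)" unfolding card_arrs_less[OF assms] a_def by (simp add: divide_le_eq)
  have NK: "NN g y x \<le> K" using rep by (auto simp: rep_def)
  have "card {A \<in> arrays s l ?\<rho>. \<not> ones A < g * 2 ^ l - y} \<le> (K - NN g y x) * 2 ^ M"
    by (rule rep_card_less(2)[OF rep])
  moreover have "card (arrays s l ?\<rho>) = card {A \<in> arrays s l ?\<rho>. ones A < g * 2 ^ l - y} + card {A \<in> arrays s l ?\<rho>. \<not> ones A < g * 2 ^ l - y}"
    by (subst card_Un_disjoint[symmetric]) (auto intro!: arg_cong[where f = card])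
  ultimately have "card (arrays s l ?\<rho>) \<le> card {A \<in> arrays s l ?\<rho>. ones A < g * 2 ^ l - y} + (K - NN g y x) * 2 ^ M" by linarith
  hence "real (card (arrays s l ?\<rho>)) \<le> real (card {A \<in> arrays s l ?\<rho>. ones A < g * 2 ^ l - y} + (K - NN g y x) * 2 ^ M)"
    by (simp only: of_nat_le_iff)
  hence "bop s (res (2 ^ l)) (vv g y x) \<le> bop s (stp (2 ^ l)) (vv g y x) + (real K - real (NN g y x)) * 2 ^ M"
    using NK by (simp add: card_arrs[OF assms, of g] card_arrs_less[OF assms, of g] of_nat_diff)
  moreover have "bop s (res (2 ^ l)) (vv g y x) \<ge> 2 ^ s / 2 ^ l - 2 ^ s / 2 ^ (l + T + 1)"
    using unif[of "vv g y x"] by linarith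
  ultimately have "2 ^ s / 2 ^ l - 2 ^ s / 2 ^ (l + T + 1) \<le> bop s (stp (2 ^ l)) (vv g y x) + (real K - real (NN g y x)) * 2 ^ M"
    by linarith
  hence "(2 ^ s / 2 ^ l - 2 ^ s / 2 ^ (l + T + 1)) / 2 ^ M \<le> (bop s (stp (2 ^ l)) (vv g y x) + (real K - real (NN g y x)) * 2 ^ M) / 2 ^ M"
    by (rule divide_right_mono) simp
  hence "2 ^ (\<kappa> - 1) - 2 ^ (\<kappa> - 1) / 2 ^ (T + 1) \<le> a (vv g y x) + real K - real (NN g y x)"
    using scale[of 0] scale[of "T + 1"] by (simp add: diff_divide_distrib add_divide_distrib a_def add.assoc)
  moreover have "(2::real) ^ (\<kappa> - 1) / 2 ^ (T + 1) = 2 ^ (\<kappa> - 2 - T)"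
    using T\<kappa> by (subst power_diff[symmetric]) auto
  moreover have "(2::real) ^ (\<kappa> - 2 - T) + 2 ^ (\<kappa> - 2 - T) = 2 ^ (\<kappa> - 1 - T)"
  proof -
    have "\<kappa> - 1 - T = Suc (\<kappa> - 2 - T)" using T\<kappa> by simp
    thus ?thesis by simp
  qed
  ultimately show "real (NN g y x) \<le> a (vv g y x) + 2 ^ (\<kappa> - 1 - T)" using K_le by linarith
qed

lemma a_nonneg: "a v \<ge> 0"
  unfolding a_def using bop_mono[of "\<lambda>_. 0" "stp (2 ^ l)" s v] by (simp add: stp_def bop_const)

lemma tail_eq: "2 ^ s / 2 ^ (l + T + 1) / 2 ^ M = (2 ^ (\<kappa> - 2 - T) :: real)"
proof -
  have "\<kappa> - 1 = (\<kappa> - 2 - T) + (T + 1)" using T\<kappa> by simp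
  hence "(2::real) ^ (\<kappa> - 1) = 2 ^ (\<kappa> - 2 - T) * 2 ^ (T + 1)" by (simp only: power_add)
  thus ?thesis using scale[of "T + 1"] by (simp add: add.assoc)
qed

lemma a_low:
  assumes "1 \<le> g" "g \<le> glo" "y < 2 ^ l" "x < 2 ^ l"
  shows "a (vv g y x) \<le> 2 ^ (\<kappa> - 2 - T)"
proof -
  let ?c = "s div 2 div 2 ^ l"
  have "g + Y0 + 1 \<le> ?c" using assms(1,2) by (simp add: glo_def)
  hence "(g + Y0 + 1) * 2 ^ l \<le> ?c * 2 ^ l" by (rule mult_right_mono) simp
  also have "\<dots> \<le> s div 2" by simp
  finally have "2 * ((g + Y0 + 1) * 2 ^ l) \<le> s" by linarith
  hence "2 * (g * 2 ^ l) + 2 * (2 ^ l * Y0) + 2 * 2 ^ l \<le> s" by (simp add: algebra_simps)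
  moreover define e1 e2 e3 where "e1 = g * 2 ^ l" and "e2 = 2 ^ l * Y0" and "e3 = (2::nat) ^ l"
  ultimately have "2 * e1 + 2 * e2 + 2 * e3 \<le> s" "x < e3" using assms(4) by simp_all
  hence "int (2 * e1 + 2 * e2 + 2 * e3) \<le> int s" "int x < int e3" by (simp_all only: of_nat_le_iff of_nat_less_iff)
  moreover have "int y \<ge> 0" by simp
  ultimately have "2 * (int e1 + int x - int y) + 2 * int e2 \<le> int s"
    by simp
  hence "2 * vv g y x + 2 * int (2 ^ l * Y0) \<le> int s" by (simp only: e1_def e2_def)
  from low[OF this] have "bop s (stp (2 ^ l)) (vv g y x) \<le> 2 ^ s / 2 ^ (l + T + 1)"
    using bop_mono[of "stp (2 ^ l)" "\<lambda>x. of_bool (x > 0)" s "vv g y x"] by (simp add: stp_def)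
  hence "a (vv g y x) \<le> 2 ^ s / 2 ^ (l + T + 1) / 2 ^ M" unfolding a_def by (rule divide_right_mono) simp
  thus ?thesis by (simp only: tail_eq)
qed

lemma a_high:
  assumes "ghi \<le> g" "y < 2 ^ l" "x < 2 ^ l"
  shows "a (vv g y x) \<ge> 2 ^ (\<kappa> - 1) - 2 ^ (\<kappa> - 1 - T)"
proof -
  let ?c = "s div 2 div 2 ^ l"
  have "s div 2 < Suc ?c * 2 ^ l" by (metis dividend_less_div_times mult.commute mult_Suc_right add.commute zero_less_numeral zero_less_power)
  hence "s \<le> 2 * (Suc ?c * 2 ^ l)" by linarith
  moreover have "(?c + Y0 + 2) * 2 ^ l \<le> g * 2 ^ l" by (rule mult_right_mono) (use assms(1) in \<open>auto simp: ghi_def\<close>)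
  ultimately have "s + 2 * (2 ^ l * Y0) + 2 * 2 ^ l \<le> 2 * (g * 2 ^ l)" by (simp add: algebra_simps)
  moreover define e1 e2 e3 where "e1 = g * 2 ^ l" and "e2 = 2 ^ l * Y0" and "e3 = (2::nat) ^ l"
  ultimately have "s + 2 * e2 + 2 * e3 \<le> 2 * e1" "y < e3" using assms(2) by simp_all
  hence "int (s + 2 * e2 + 2 * e3) \<le> int (2 * e1)" "int y < int e3" by (simp_all only: of_nat_le_iff of_nat_less_iff)
  moreover have "int x \<ge> 0" by simp
  ultimately have "int s + 2 * int e2 \<le> 2 * (int e1 + int x - int y)"
    by simp
  hence "int s + 2 * int (2 ^ l * Y0) \<le> 2 * vv g y x" by (simp only: e1_def e2_def)
  note hi = high[OF this]
  have "bop s (res (2 ^ l)) (vv g y x) \<le> bop s (\<lambda>x. stp (2 ^ l) x + of_bool (x \<le> 0)) (vv g y x)"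
    by (rule bop_mono) (auto simp: res_def stp_def)
  hence "bop s (stp (2 ^ l)) (vv g y x) \<ge> 2 ^ s / 2 ^ l - 2 ^ s / 2 ^ (l + T + 1) - 2 ^ s / 2 ^ (l + T + 1)"
    using hi unif[of "vv g y x"] by (simp only: bop_plus)
  hence "a (vv g y x) \<ge> (2 ^ s / 2 ^ l - 2 ^ s / 2 ^ (l + T + 1) - 2 ^ s / 2 ^ (l + T + 1)) / 2 ^ M"
    unfolding a_def by (rule divide_right_mono) simp
  moreover have "(2 ^ s / 2 ^ l - 2 ^ s / 2 ^ (l + T + 1) - 2 ^ s / 2 ^ (l + T + 1)) / 2 ^ M = (2 ^ (\<kappa> - 1) - 2 ^ (\<kappa> - 2 - T) - 2 ^ (\<kappa> - 2 - T) :: real)"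
    using scale[of 0] tail_eq by (simp only: diff_divide_distrib) simp
  moreover have "(2::real) ^ (\<kappa> - 2 - T) + 2 ^ (\<kappa> - 2 - T) = 2 ^ (\<kappa> - 1 - T)"
  proof -
    have "\<kappa> - 1 - T = Suc (\<kappa> - 2 - T)" using T\<kappa> by simp
    thus ?thesis by simp
  qed
  ultimately show ?thesis by linarith
qed

lemma a_lip:
  fixes g :: nat
  assumes "y div 2 ^ (l - t) = X" "x div 2 ^ (l - t) = Y" "t \<le> T"
  defines "v0 \<equiv> int (g * 2 ^ l) + int (Y * 2 ^ (l - t)) - int (X * 2 ^ (l - t))"
  shows "\<bar>a (vv g y x) - a v0\<bar> \<le> 2 ^ (\<kappa> - t) / 2"
proof -
  have "y = X * 2 ^ (l - t) + y mod 2 ^ (l - t)" "x = Y * 2 ^ (l - t) + x mod 2 ^ (l - t)"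
    using assms(1,2) by (metis div_mult_mod_eq)+
  moreover have "y mod 2 ^ (l - t) < 2 ^ (l - t)" "x mod 2 ^ (l - t) < 2 ^ (l - t)" by simp_all
  \<comment> \<open>The \<open>- 1\<close> matters for \<open>t > l\<close>: there truncated
    subtraction makes the cell a single point, and the bound has to vanish.\<close>
  ultimately have d: "\<bar>vv g y x - v0\<bar> \<le> int (2 ^ (l - t)) - 1" unfolding v0_def by linarith
  have "\<bar>bop s (stp (2 ^ l)) (vv g y x) - bop s (stp (2 ^ l)) v0\<bar> \<le> 2 ^ s / 2 ^ (2 * l) * real_of_int \<bar>vv g y x - v0\<bar>"
    by (rule bop_lipschitz_dist[OF lip])
  also have "\<dots> \<le> 2 ^ s / 2 ^ (2 * l) * (2 ^ (l - t) - 1)"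
  proof (rule mult_left_mono)
    have "real_of_int \<bar>vv g y x - v0\<bar> \<le> real_of_int (int (2 ^ (l - t)) - 1)" using d by (simp only: of_int_le_iff)
    thus "real_of_int \<bar>vv g y x - v0\<bar> \<le> 2 ^ (l - t) - 1" by simp
  qed simp
  also have "\<dots> \<le> 2 ^ s / 2 ^ (l + t)"
  proof (cases "t \<le> l")
    case True
    hence "2 * l = (l + t) + (l - t)" by simp
    hence "(2::real) ^ (2 * l) = 2 ^ (l + t) * 2 ^ (l - t)" by (simp only: power_add)
    hence "2 ^ s / 2 ^ (2 * l) * 2 ^ (l - t) = (2 ^ s / 2 ^ (l + t) :: real)" by simp
    moreover have "2 ^ s / 2 ^ (2 * l) * (2 ^ (l - t) - 1) \<le> (2 ^ s / 2 ^ (2 * l) * 2 ^ (l - t) :: real)"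
      by (rule mult_left_mono) auto
    ultimately show ?thesis by linarith
  qed simp
  finally have "\<bar>bop s (stp (2 ^ l)) (vv g y x) - bop s (stp (2 ^ l)) v0\<bar> / 2 ^ M \<le> 2 ^ s / 2 ^ (l + t) / 2 ^ M"
    by (rule divide_right_mono) simp
  moreover have "\<bar>a (vv g y x) - a v0\<bar> = \<bar>bop s (stp (2 ^ l)) (vv g y x) - bop s (stp (2 ^ l)) v0\<bar> / 2 ^ M"
    by (simp add: a_def flip: diff_divide_distrib)
  moreover have "2 ^ s / 2 ^ (l + t) / 2 ^ M = (2 ^ (\<kappa> - t) / 2 :: real)"
  proof -
    have "\<kappa> = (\<kappa> - t) + t" "\<kappa> = Suc (\<kappa> - 1)" using assms(3) T\<kappa> by simp_all
    hence "2 * (2::real) ^ (\<kappa> - 1) = 2 ^ (\<kappa> - t) * 2 ^ t" by (metis power_Suc power_add)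
    hence "(2::real) ^ (\<kappa> - 1) / 2 ^ t = 2 ^ (\<kappa> - t) / 2" by (simp add: field_simps)
    thus ?thesis by (simp only: scale)
  qed
  ultimately show ?thesis by linarith
qed

text \<open>Over one cell the ideal threshold stays within half a cell width of its value at the
  corner, and \<open>N\<close> is within another half of it, so each \<open>g\<close> spoils at most
  five cells. Only the roughly \<open>2 * Y0\<close> values of \<open>g\<close> in the window are
  charged separately: all smaller ones share the cells 0 and 1, all larger ones share the cells near
  the top of the range.\<close>

lemma card_und_coarse:
  assumes "t \<le> T"
  shows "card (undetermined N l \<kappa> K gm t X Y) \<le> 10 * Y0 + 30"
proof -
  let ?q = "2 ^ (\<kappa> - t) :: nat"
  define q where "q = (2 ^ (\<kappa> - t) :: real)"
  have q0: "q > 0" by (simp add: q_def)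
  have qT: "2 ^ (\<kappa> - 1 - T) \<le> q / 2" "2 ^ (\<kappa> - 2 - T) \<le> q / 2"
  proof -
    have "Suc (\<kappa> - 1 - T) \<le> \<kappa> - t" "Suc (\<kappa> - 2 - T) \<le> \<kappa> - t" using assms T\<kappa> by linarith+
    hence "(2::real) ^ Suc (\<kappa> - 1 - T) \<le> 2 ^ (\<kappa> - t)" "(2::real) ^ Suc (\<kappa> - 2 - T) \<le> 2 ^ (\<kappa> - t)" by (intro power_increasing; simp)+
    thus "2 ^ (\<kappa> - 1 - T) \<le> q / 2" "2 ^ (\<kappa> - 2 - T) \<le> q / 2" by (simp_all add: q_def)
  qed
  define v0 where "v0 g = int (g * 2 ^ l) + int (Y * 2 ^ (l - t)) - int (X * 2 ^ (l - t))" for g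
  define near where "near \<alpha> = {nat \<lfloor>\<alpha>\<rfloor> - 2..nat \<lfloor>\<alpha>\<rfloor> + 2}" for \<alpha> :: real
  have nearI: "Z \<in> near \<alpha>" if "\<alpha> \<ge> 0" "real Z < \<alpha> + 2" "\<alpha> < real Z + 3" for Z \<alpha>
  proof -
    have "real (nat \<lfloor>\<alpha>\<rfloor>) \<le> \<alpha>" "\<alpha> < real (nat \<lfloor>\<alpha>\<rfloor>) + 1" using that(1) by (auto simp: of_nat_nat)
    hence "real Z < real (nat \<lfloor>\<alpha>\<rfloor> + 3)" "real (nat \<lfloor>\<alpha>\<rfloor>) < real (Z + 3)" using that by (simp_all only: of_nat_add of_nat_numeral)
    hence "Z < nat \<lfloor>\<alpha>\<rfloor> + 3" "nat \<lfloor>\<alpha>\<rfloor> < Z + 3" by (simp_all only: of_nat_less_iff)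
    thus ?thesis unfolding near_def by auto
  qed
  have near5: "card (near \<alpha>) \<le> 5" for \<alpha> by (simp add: near_def)
  define B where "B = insert (K div ?q) ({0, 1} \<union> near (2 ^ (\<kappa> - 1) / q) \<union> (\<Union>g\<in>{glo<..<ghi}. near (a (v0 g) / q)))"
  have "undetermined N l \<kappa> K gm t X Y \<subseteq> B"
  proof
    fix Z assume Z: "Z \<in> undetermined N l \<kappa> K gm t X Y"
    show "Z \<in> B"
    proof (cases "Z = K div ?q")
      case True thus ?thesis by (simp add: B_def)
    next
      case False
      from und_cases[OF Z False] obtain g y x k y' x' k' where g: "1 \<le> g" "g \<le> gm"
        and c: "incell l \<kappa> t X Y Z y x k" "incell l \<kappa> t X Y Z y' x' k'" and kK: "k' < K"
        and n: "NN g y x \<le> k" "k' < NN g y' x'" .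
      have cell: "y < 2 ^ l" "x < 2 ^ l" "y div 2 ^ (l - t) = X" "x div 2 ^ (l - t) = Y" "k div ?q = Z"
        "y' < 2 ^ l" "x' < 2 ^ l" "y' div 2 ^ (l - t) = X" "x' div 2 ^ (l - t) = Y" "k' div ?q = Z"
        using c by (simp_all add: incell_def)
      note 2 = cell n kK g
      have "k < ?q * Suc Z" using cell(5) by (metis dividend_less_div_times mult.commute mult_Suc_right add.commute zero_less_numeral zero_less_power)
      hence "real k < real (?q * Suc Z)" by (simp only: of_nat_less_iff)
      hence k1: "real k < q * (real Z + 1)" by (simp add: q_def algebra_simps)
      have "?q * Z \<le> k'" using cell(10) by (metis div_times_less_eq_dividend mult.commute)
      hence "real (?q * Z) \<le> real k'" by (simp only: of_nat_le_iff)
      hence k2: "q * real Z \<le> real k'" by (simp add: q_def)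
      have n1: "a (vv g y x) \<le> real (NN g y x)" by (rule N_bounds) fact+
      have n2: "real (NN g y' x') \<le> a (vv g y' x') + 2 ^ (\<kappa> - 1 - T)" by (rule N_bounds) fact+
      have lo: "a (vv g y x) < q * (real Z + 1)" using n1 k1 n by linarith
      hence lo': "a (vv g y x) < q * real Z + q" by (simp only: distrib_left mult_1_right)
      have hi: "q * real Z < a (vv g y' x') + q / 2" using n2 k2 n qT by linarith
      consider "g \<le> glo" | "ghi \<le> g" | "g \<in> {glo<..<ghi}" by fastforce
      thus ?thesis
      proof cases
        case 1
        have "a (vv g y' x') \<le> 2 ^ (\<kappa> - 2 - T)" by (rule a_low) (use 1 2 in auto)
        hence "q * real Z < q * 2" using hi qT q0 by linarith
        hence "Z < 2" using q0 by simp
        thus ?thesis by (auto simp: B_def)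
      next
        case h: 2
        have "a (vv g y x) \<ge> 2 ^ (\<kappa> - 1) - 2 ^ (\<kappa> - 1 - T)" by (rule a_high) fact+
        hence "2 ^ (\<kappa> - 1) < q * real Z + q * 3" using lo' qT q0 by linarith
        moreover have "q * real Z < 2 ^ (\<kappa> - 1) + q * 2"
          using k2 kK K_le qT q0 by linarith
        ultimately have "Z \<in> near (2 ^ (\<kappa> - 1) / q)" using q0 by (intro nearI) (auto simp: field_simps)
        thus ?thesis by (simp add: B_def)
      next
        case 3
        have l1: "\<bar>a (vv g y x) - a (v0 g)\<bar> \<le> q / 2" unfolding v0_def q_def by (rule a_lip) fact+
        have l2: "\<bar>a (vv g y' x') - a (v0 g)\<bar> \<le> q / 2" unfolding v0_def q_def by (rule a_lip) fact+
        have "q * real Z < a (v0 g) + q * 2" "a (v0 g) < q * real Z + q * 3"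
          using lo' hi l1 l2 q0 by linarith+
        hence "Z \<in> near (a (v0 g) / q)" using q0 a_nonneg by (intro nearI) (auto simp: field_simps)
        thus ?thesis using 3 by (auto simp: B_def)
      qed
    qed
  qed
  moreover have finB: "finite B" by (auto simp: B_def near_def)
  ultimately have "card (undetermined N l \<kappa> K gm t X Y) \<le> card B" by (rule card_mono[rotated])
  also have "card B \<le> Suc (card ({0, 1} \<union> near (2 ^ (\<kappa> - 1) / q) \<union> (\<Union>g\<in>{glo<..<ghi}. near (a (v0 g) / q))))"
    unfolding B_def by (rule card_insert_le_m1[of "Suc _", simplified]) auto
  also have "\<dots> \<le> Suc (card ({0, 1::nat} \<union> near (2 ^ (\<kappa> - 1) / q)) + card (\<Union>g\<in>{glo<..<ghi}. near (a (v0 g) / q)))"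
    by (simp only: Suc_le_mono card_Un_le)
  also have "card ({0, 1::nat} \<union> near (2 ^ (\<kappa> - 1) / q)) \<le> 2 + 5"
    by (rule order.trans[OF card_Un_le]) (use near5[of "2 ^ (\<kappa> - 1) / q"] in simp)
  also have "card (\<Union>g\<in>{glo<..<ghi}. near (a (v0 g) / q)) \<le> (\<Sum>g\<in>{glo<..<ghi}. card (near (a (v0 g) / q)))"
    by (rule card_UN_le) simp
  also have "\<dots> \<le> (\<Sum>g\<in>{glo<..<ghi}. 5)" by (rule sum_mono) (rule near5)
  also have "\<dots> \<le> 5 * (2 * Y0 + 4)" by (simp add: glo_def ghi_def)
  finally show ?thesis by simp
qed

text \<open>By monotonicity of the thresholds, an atypical carry forces the header below the
  threshold of \<open>glo\<close> or not below that of \<open>ghi\<close>, and the tail bounds make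
  both ranges short.\<close>

lemma card_escape:
  assumes "y < 2 ^ l" "x < 2 ^ l" "glo \<le> gm"
  shows "card {k. k < K \<and> carry N l gm y x k \<notin> {glo..<ghi}} \<le> 2 ^ (\<kappa> + 1 - T)"
proof -
  have Nm: "NN g y x \<le> NN g' y x" if "g \<le> g'" for g g'
  proof -
    have "g * 2 ^ l - y \<le> g' * 2 ^ l - y" using that by (intro diff_le_mono mult_right_mono) auto
    thus ?thesis using rep unfolding rep_def by blast
  qed
  define S where "S k = {g. 1 \<le> g \<and> g \<le> gm \<and> NN g y x \<le> k}" for k
  have fS: "finite (S k)" for k by (rule finite_subset[of _ "{..gm}"]) (auto simp: S_def)
  have q: "carry N l gm y x k = card (S k)" for k by (simp add: carry_def S_def)
  have lo: "k < NN glo y x" if "card (S k) < glo" for k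
  proof (rule ccontr)
    assume "\<not> k < NN glo y x"
    hence "NN g y x \<le> k" if "g \<le> glo" for g using Nm[OF that] by linarith
    hence "{1..glo} \<subseteq> S k" using assms(3) by (auto simp: S_def)
    hence "card {1..glo} \<le> card (S k)" by (rule card_mono[OF fS])
    thus False using that by simp
  qed
  have hi: "NN ghi y x \<le> k" if "ghi \<le> card (S k)" for k
  proof (rule ccontr)
    assume n: "\<not> NN ghi y x \<le> k"
    have "S k \<subseteq> {1..<ghi}"
    proof
      fix g assume g: "g \<in> S k"
      hence "g < ghi" using n Nm[of ghi g] by (force simp: S_def)
      thus "g \<in> {1..<ghi}" using g by (simp add: S_def)
    qed
    hence "card (S k) \<le> card {1..<ghi}" by (rule card_mono[rotated]) simp
    thus False using that by (simp add: ghi_def)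
  qed
  \<comment> \<open>For \<open>glo = 0\<close> there is nothing to bound, and \<open>a_low\<close>
    is available only from \<open>g = 1\<close> on.\<close>
  define lb where "lb = (if glo = 0 then 0 else NN glo y x)"
  have "{k. k < K \<and> carry N l gm y x k \<notin> {glo..<ghi}} \<subseteq> {..<lb} \<union> {NN ghi y x..<K}"
    unfolding q lb_def using lo hi by force
  hence "card {k. k < K \<and> carry N l gm y x k \<notin> {glo..<ghi}} \<le> card ({..<lb} \<union> {NN ghi y x..<K})"
    by (rule card_mono[rotated]) simp
  also have "\<dots> \<le> lb + (K - NN ghi y x)" by (rule order.trans[OF card_Un_le]) simp
  finally have c: "card {k. k < K \<and> carry N l gm y x k \<notin> {glo..<ghi}} \<le> lb + (K - NN ghi y x)" .
  have e: "(2::real) ^ (\<kappa> - T) = 2 * 2 ^ (\<kappa> - 1 - T)" "(2::real) ^ (\<kappa> - 1 - T) = 2 * 2 ^ (\<kappa> - 2 - T)"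
  proof -
    have "\<kappa> - T = Suc (\<kappa> - 1 - T)" "\<kappa> - 1 - T = Suc (\<kappa> - 2 - T)" using T\<kappa> by simp_all
    thus "(2::real) ^ (\<kappa> - T) = 2 * 2 ^ (\<kappa> - 1 - T)" "(2::real) ^ (\<kappa> - 1 - T) = 2 * 2 ^ (\<kappa> - 2 - T)" by (metis power_Suc)+
  qed
  have 1: "real lb \<le> 2 ^ (\<kappa> - 2 - T) + 2 ^ (\<kappa> - 1 - T)"
    using N_bounds(2)[OF assms(1,2), of glo] a_low[of glo y x] assms by (cases "glo = 0") (auto simp: lb_def)
  have 2: "real (NN ghi y x) \<ge> 2 ^ (\<kappa> - 1) - 2 ^ (\<kappa> - 1 - T)"
    using N_bounds(1)[OF assms(1,2), of ghi] a_high[of ghi y x] assms by linarith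
  have NK: "NN ghi y x \<le> K" using rep by (auto simp: rep_def)
  have e': "(2::real) ^ (\<kappa> + 1 - T) = 2 * 2 ^ (\<kappa> - T)" using T\<kappa> by (simp add: Suc_diff_le)
  have "real (lb + (K - NN ghi y x)) \<le> real (2 ^ (\<kappa> + 1 - T))"
    using 1 2 e e' K_le NK by (simp add: of_nat_diff)
  thus ?thesis using c by (simp only: of_nat_le_iff)
qed

end

subsection \<open>Combining blocks\<close>

lemma length_concat_upt:
  "(\<And>j. j < b \<Longrightarrow> length (f j) = len j) \<Longrightarrow> length (concat (map f [0..<b])) = sum len {..<b}"
  by (induction b) auto

lemma concat_upt_split:
  assumes "i < b"
  shows "concat (map f [0..<b]) = concat (map f [0..<i]) @ f i @ concat (map f [Suc i..<b])"
proof -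
  have "[0..<b] = [0..<i] @ i # [Suc i..<b]"
    using assms by (metis le_add1 less_imp_le_nat upt_add_eq_append upt_conv_Cons add_0 le_add_diff_inverse)
  thus ?thesis by simp
qed

lemma take_drop_concat:
  assumes "i < b" "\<And>j. j < b \<Longrightarrow> length (f j) = len j"
  shows "take (len i) (drop (sum len {..<i}) (concat (map f [0..<b]) @ ms)) = f i"
proof -
  have "length (concat (map f [0..<i])) = sum len {..<i}"
    by (rule length_concat_upt) (use assms in auto)
  thus ?thesis using assms(2)[OF assms(1)] by (simp add: concat_upt_split[OF assms(1)])
qed

lemma concat_take_drop:
  "length xs = sum len {..<b} \<Longrightarrow> concat (map (\<lambda>j. take (len j) (drop (sum len {..<j}) xs)) [0..<b]) = xs"
proof (induction b arbitrary: xs)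
  case (Suc b)
  let ?ys = "take (sum len {..<b}) xs"
  have ly: "length ?ys = sum len {..<b}" using Suc.prems by simp
  have "concat (map (\<lambda>j. take (len j) (drop (sum len {..<j}) xs)) [0..<b]) = concat (map (\<lambda>j. take (len j) (drop (sum len {..<j}) ?ys)) [0..<b])"
  proof (rule arg_cong[where f = concat], rule map_cong[OF refl])
    fix j assume "j \<in> set [0..<b]"
    hence "sum len {..<Suc j} \<le> sum len {..<b}" by (intro sum_mono2) auto
    thus "take (len j) (drop (sum len {..<j}) xs) = take (len j) (drop (sum len {..<j}) ?ys)"
      by (simp add: drop_take min_absorb1)
  qed
  also have "\<dots> = ?ys" by (rule Suc.IH[OF ly])
  finally show ?case using Suc.prems by simp
qed simp

lemma seg_child:
  assumes "take M' (drop a m) = memx" "length memx = M'" "length e \<le> pos" "pos + len \<le> length e + M'"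
  shows "take len (drop (a + (pos - length e)) m) = take len (drop pos (e @ memx))"
proof -
  have "drop pos (e @ memx) = drop (pos - length e) (take M' (drop a m))" using assms by simp
  also have "\<dots> = take (M' - (pos - length e)) (drop (a + (pos - length e)) m)" by (simp add: drop_take add.commute)
  finally show ?thesis using assms by (simp add: min_absorb1)
qed

text \<open>A slot may lie in the header part \<open>e\<close>, in the memory, or across the border.
  Truncated subtraction lets one read at a fixed position serve all three cases.\<close>

lemma seg_read:
  assumes "take M' (drop a m) = memx" "length memx = M'" "pos + len \<le> length e + M'" "len \<le> W"
  shows "take len (drop pos e @ take W (drop (a + (pos - length e)) m)) = take len (drop pos (e @ memx))"
proof (cases "length e \<le> pos")
  case True
  thus ?thesis using seg_child[OF assms(1,2) True assms(3)] assms(4) by (simp add: min_absorb1)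
next
  case False
  define q where "q = len - length (drop pos e)"
  have q: "q \<le> W" "q \<le> M'" using assms False by (auto simp: q_def)
  have "take q (take W (drop a m)) = take q memx" using q assms(1) by (auto simp: min_absorb1)
  thus ?thesis using False by (simp add: q_def)
qed

lemma reads3:
  assumes "reads W 1 f1" "reads W 1 f2" "reads W 1 f3" "\<And>x y z. reads W p (g x y z)"
  shows "reads W (p + 3) (\<lambda>m. g (f1 m) (f2 m) (f3 m) m)"
proof -
  have 1: "reads W (1 + p) (\<lambda>m. g x y (f3 m) m)" for x y by (rule reads_bind[OF assms(3) assms(4)])
  have 2: "reads W (1 + (1 + p)) (\<lambda>m. g x (f2 m) (f3 m) m)" for x by (rule reads_bind[OF assms(2), of _ "\<lambda>y m. g x y (f3 m) m"]) (rule 1)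
  have 3: "reads W (1 + (1 + (1 + p))) (\<lambda>m. g (f1 m) (f2 m) (f3 m) m)" by (rule reads_bind[OF assms(1), of _ "\<lambda>x m. g x (f2 m) (f3 m) m"]) (rule 2)
  thus ?thesis by (simp add: numeral_3_eq_3)
qed

text \<open>Serves to cut the resolutions of an ambiguous array down to the total \<open>D\<close>
  while each block stays at or below its own determining resolution.\<close>

lemma ex_bounded_sum:
  fixes n :: nat and D' :: nat
  assumes "D' \<le> sum f {..<n}"
  shows "\<exists>t. (\<forall>j<n. t j \<le> f j) \<and> sum t {..<n} = D'"
  using assms
proof (induction n arbitrary: D')
  case (Suc n)
  define d where "d = min D' (sum f {..<n})"
  have "d \<le> sum f {..<n}" by (simp add: d_def)
  from Suc.IH[OF this] obtain t where t: "\<forall>j<n. t j \<le> f j" "sum t {..<n} = d" by blast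
  have eq: "sum (t(n := D' - d)) {..<n} = sum t {..<n}" by (rule sum.cong) auto
  show ?case
    by (rule exI[of _ "t(n := D' - d)"]) (use t eq Suc.prems in \<open>auto simp: less_Suc_eq d_def min_def split: if_splits\<close>)
qed simp

text \<open>\<open>M'2\<close> reserves room for the leading bits: \<open>l\<close> for the leftmost
  residue, and three times the total resolution, since a block charges its header and the residues
  at both ends. \<open>M'1\<close> keeps the child memories out of the header.
  \<open>D < 2 * T\<close> means that at most one block can exceed resolution \<open>T\<close> when
  the total is \<open>D\<close>. \<open>esc\<close> makes room for a prefix sum of \<open>wP\<close>
  bits next to the index of an atypical child header.\<close>

locale node =
  fixes W l \<kappa> K p b T D TE wP M' Wb n2 Gt gx :: nat and s M gm :: "nat \<Rightarrow> nat"
    and hdr :: "nat \<Rightarrow> bool list \<Rightarrow> nat" and mem :: "nat \<Rightarrow> bool list \<Rightarrow> bool list"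
    and N :: "nat \<Rightarrow> nat \<Rightarrow> nat \<Rightarrow> nat" and Typ :: "nat \<Rightarrow> nat set"
  assumes b0: "b > 0"
    and reps: "\<And>j. j < b \<Longrightarrow> rep W (s j) l (M j) K p (hdr j) (mem j) (N j)"
    and K_le: "K \<le> 2 ^ \<kappa>"
    and gm: "\<And>j. j < b \<Longrightarrow> s j div 2 ^ l < gm j" "\<And>j. j < b \<Longrightarrow> gm j \<le> gx"
    and l\<kappa>: "l \<le> \<kappa>" and lW: "l + \<kappa> \<le> W"
    and und1: "\<And>j t X Y. j < b \<Longrightarrow> t < T \<Longrightarrow> card (undetermined (N j) l \<kappa> K (gm j) t X Y) \<le> Wb"
    and und2: "\<And>j t X Y. j < b \<Longrightarrow> T \<le> t \<Longrightarrow> card (undetermined (N j) l \<kappa> K (gm j) t X Y) \<le> n2"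
    and esc: "\<And>j y x. j < b \<Longrightarrow> y < 2 ^ l \<Longrightarrow> x < 2 ^ l \<Longrightarrow>
       card {k. k < K \<and> carry (N j) l (gm j) y x k \<notin> Typ j} * 2 ^ wP \<le> 2 ^ (\<kappa> - TE)"
    and Typ: "\<And>j. j < b \<Longrightarrow> finite (Typ j)" "\<And>j. j < b \<Longrightarrow> card (Typ j) \<le> Gt"
    and sP: "sum s {..<b} < 2 ^ wP"
    and M'1: "sum M {..<b} \<le> M'" and M'2: "M' + l + 3 * (D + 2 * TE) \<le> b * (l + \<kappa>) + sum M {..<b}"
    and pos: "Wb > 0" "n2 > 0" "Gt > 0"
    and DT: "D < 2 * T" "D \<le> \<kappa>" "TE \<le> \<kappa>"
begin

text \<open>The prefix sums \<open>R\<close> modulo \<open>2 ^ l\<close> and the child headers \<open>kk\<close> are split into leading bits (in the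
  header) and the remaining bits (in the memory): \<open>t j\<close> leading bits of \<open>kk j\<close>, and \<open>r t j\<close> of \<open>R j\<close>.
  An array is \<open>clean\<close> if some \<open>t\<close> with \<open>sum t \<le> D\<close> suffices to determine all carries. Otherwise the carries are
  written into the header; this is affordable because few arrays are not clean. If several carries
  are atypical (the set \<open>E\<close>), each of the blocks concerned has so few possible headers that its slot has room
  for the full prefix sum (\<open>code\<close>), and \<open>gs\<close> records \<open>None\<close> for it. The first
  \<open>hdr_len\<close> bits of the remaining bits also go to the header, which makes the memory length constant.\<close>

definition off where "off j = sum s {..<j}"
definition blk where "blk j A = take (s j) (drop (off j) A)"
definition P where "P j A = ones (take (off j) A)"
definition R where "R j A = P j A mod 2 ^ l"
definition kk where "kk j A = hdr j (blk j A)"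
definition qq where "qq j y x k = carry (N j) l (gm j) y x k"
definition g where "g j A = qq j (R j A) (R (Suc j) A) (kk j A)"
definition dt where "dt j t y x k = determined (N j) l \<kappa> K (gm j) t (y div 2 ^ (l - t)) (x div 2 ^ (l - t)) (k div 2 ^ (\<kappa> - t))"
definition \<tau> where "\<tau> j y x k = (LEAST t. dt j t y x k)"
text \<open>The residue \<open>R j\<close> bounds block \<open>j - 1\<close> on the right and block
  \<open>j\<close> on the left, so it must serve the larger of the two resolutions.
  \<open>R 0\<close> is zero and counts as wholly leading, hence takes no memory.\<close>

definition r where "r t j = (if j = 0 then l else max (t (j - 1)) (t j))"
definition len where "len t j = (l - r t j) + (\<kappa> - t j)"
definition lows :: "(nat \<Rightarrow> nat) \<Rightarrow> (nat \<Rightarrow> nat) \<Rightarrow> (nat \<Rightarrow> nat) \<Rightarrow> bool list \<Rightarrow> bool list" where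
  "lows t x k ms = concat (map (\<lambda>j. bl (l - r t j) (x j) @ bl (\<kappa> - t j) (k j)) [0..<b]) @ ms"
definition hdr_len where "hdr_len t = sum (len t) {..<b} + sum M {..<b} - M'"
definition Es where "Es j y x = {k. k < K \<and> qq j y x k \<notin> Typ j}"
definition ix where "ix j y x = (SOME f. bij_betw f (Es j y x) {0..<card (Es j y x)})"
definition E where "E A = {j. j < b \<and> g j A \<notin> Typ j}"
definition \<tau>A where "\<tau>A A j = \<tau> j (R j A) (R (Suc j) A) (kk j A)"
definition clean where "clean A \<longleftrightarrow> sum (\<tau>A A) {..<b} \<le> D"
definition em where "em A \<longleftrightarrow> \<not> clean A \<and> card (E A) > 1"
definition jj where "jj A = (SOME (i, j). i \<in> E A \<and> j \<in> E A \<and> i \<noteq> j)"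
definition ttE where "ttE i j = (\<lambda>m. if m = i \<or> m = j then TE else 0)"
definition tv where "tv A = (if clean A then \<tau>A A else if card (E A) > 1 then ttE (fst (jj A)) (snd (jj A))
   else (SOME t. (\<forall>j<b. t j \<le> \<tau>A A j) \<and> sum t {..<b} = D))"
definition code where "code j A = ix j (R j A) (R (Suc j) A) (kk j A) * 2 ^ wP + P (Suc j) A"
definition k' where "k' A j = (if em A \<and> j \<in> E A then code j A else kk j A)"
definition gs where "gs A j = (if em A \<and> j \<in> E A then None else Some (g j A))"
definition mems where "mems A = concat (map (\<lambda>j. mem j (blk j A)) [0..<b])"
definition lowsA where "lowsA A = lows (tv A) (\<lambda>j. R j A) (k' A) (mems A)"
definition header where
  "header A = (restrict (tv A) {..<b}, restrict (\<lambda>j. R j A div 2 ^ (l - r (tv A) j)) {..<b},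
     restrict (\<lambda>j. k' A j div 2 ^ (\<kappa> - tv A j)) {..<b}, restrict (gs A) {..<b}, P b A, take (hdr_len (tv A)) (lowsA A))"
definition memory where "memory A = drop (hdr_len (tv A)) (lowsA A)"

lemma off_Suc: "off (Suc j) = off j + s j" by (simp add: off_def)

lemma off_le: "j \<le> b \<Longrightarrow> off j \<le> off b" unfolding off_def by (rule sum_mono2) auto

lemma P_Suc: "P (Suc j) A = P j A + ones (blk j A)"
  by (simp add: P_def off_Suc take_add ones_append blk_def)

lemma P0: "P 0 A = 0" by (simp add: P_def off_def ones_def)

lemma R0: "R 0 A = 0" by (simp add: R_def P0)

lemma R_less: "R j A < 2 ^ l" by (simp add: R_def)

lemma length_blk: "length A = off b \<Longrightarrow> j < b \<Longrightarrow> length (blk j A) = s j"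
  using off_le[of "Suc j"] by (simp add: blk_def off_Suc)

lemma diff_mod: "(((p1 + d) mod m) + m - p1 mod m) mod m = d mod (m :: nat)"
proof (cases "m = 0")
  case False
  hence le: "p1 mod m \<le> m" by (simp add: less_imp_le)
  have "(((p1 + d) mod m) + m - p1 mod m) mod m = (((p1 + d) mod m) + (m - p1 mod m)) mod m" using le by simp
  also have "\<dots> = (p1 mod m + d + (m - p1 mod m)) mod m" by (metis mod_add_left_eq)
  also have "p1 mod m + d + (m - p1 mod m) = d + m" using le by simp
  finally show ?thesis by simp
qed simp

lemma blk_arrs:
  assumes "length A = off b" "j < b"
  shows "blk j A \<in> arrays (s j) l ((R (Suc j) A + 2 ^ l - R j A) mod 2 ^ l)"
  using length_blk[OF assms] diff_mod[of "P j A" "ones (blk j A)" "2 ^ l"] by (simp add: arrays_def R_def P_Suc)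

lemma kk_less:
  assumes "length A = off b" "j < b"
  shows "kk j A < K"
  using reps[OF assms(2)] length_blk[OF assms] by (simp add: rep_def kk_def)

lemma g_eq:
  assumes "length A = off b" "j < b"
  shows "P (Suc j) A div 2 ^ l = P j A div 2 ^ l + g j A"
proof -
  have "g j A = (ones (blk j A) + R j A) div 2 ^ l"
    unfolding g_def qq_def kk_def by (rule quo_eq[OF reps[OF assms(2)] blk_arrs[OF assms] R_less gm(1)[OF assms(2)]])
  moreover have "P (Suc j) A = ones (blk j A) + R j A + P j A div 2 ^ l * 2 ^ l"
    using div_mult_mod_eq[of "P j A" "2 ^ l"] by (simp only: P_Suc R_def)
  ultimately show ?thesis by simp
qed

lemma g_le:
  assumes "length A = off b" "j < b"
  shows "g j A \<le> gx"
proof -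
  have "g j A \<le> card {1..gm j}" unfolding g_def qq_def carry_def by (rule card_mono) auto
  thus ?thesis using gm(2)[OF assms(2)] by simp
qed

lemma P_sum:
  assumes "length A = off b" "i \<le> j" "j \<le> b"
  shows "P j A = (P i A div 2 ^ l + (\<Sum>m\<in>{i..<j}. g m A)) * 2 ^ l + R j A"
proof -
  have "P j A div 2 ^ l = P i A div 2 ^ l + (\<Sum>m\<in>{i..<j}. g m A)" using assms(2,3)
  proof (induction rule: dec_induct)
    case (step m)
    thus ?case using g_eq[OF assms(1), of m] by simp
  qed simp
  thus ?thesis by (metis R_def div_mult_mod_eq)
qed

lemma dt_\<kappa>:
  assumes "k < K" "y < 2 ^ l" "x < 2 ^ l"
  shows "dt j \<kappa> y x k"
  unfolding dt_def determined_def
  by (intro exI[of _ "carry (N j) l (gm j) y x k"]) (use assms l\<kappa> in simp)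

lemma \<tau>_le: "k < K \<Longrightarrow> y < 2 ^ l \<Longrightarrow> x < 2 ^ l \<Longrightarrow> \<tau> j y x k \<le> \<kappa>"
  unfolding \<tau>_def by (rule Least_le) (rule dt_\<kappa>)

lemma finite_Es: "finite (Es j y x)" by (rule finite_subset[of _ "{..<K}"]) (auto simp: Es_def)

lemma ix_bij: "bij_betw (ix j y x) (Es j y x) {0..<card (Es j y x)}"
  unfolding ix_def by (rule someI_ex[OF ex_bij_betw_finite_nat[OF finite_Es]])

lemma E_Es: "length A = off b \<Longrightarrow> j \<in> E A \<Longrightarrow> kk j A \<in> Es j (R j A) (R (Suc j) A)"
  using kk_less by (auto simp: E_def Es_def g_def)

lemma P_le: "length A = off b \<Longrightarrow> j \<le> b \<Longrightarrow> P j A < 2 ^ wP"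
  using sP ones_le[of "take (off j) A"] off_le[of j] by (simp add: P_def off_def)

lemma code_less:
  assumes "length A = off b" "j \<in> E A"
  shows "code j A < 2 ^ (\<kappa> - TE)"
proof -
  have j: "j < b" using assms by (simp add: E_def)
  have "ix j (R j A) (R (Suc j) A) (kk j A) < card (Es j (R j A) (R (Suc j) A))"
    using bij_betwE[OF ix_bij] E_Es[OF assms] by fastforce
  hence "Suc (ix j (R j A) (R (Suc j) A) (kk j A)) * 2 ^ wP \<le> card (Es j (R j A) (R (Suc j) A)) * 2 ^ wP"
    by (intro mult_right_mono) auto
  also have "\<dots> \<le> 2 ^ (\<kappa> - TE)" using esc[OF j R_less R_less] by (simp add: Es_def qq_def)
  finally show ?thesis using P_le[OF assms(1), of "Suc j"] j by (simp add: code_def)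
qed

lemma k'_less:
  assumes "length A = off b" "j < b"
  shows "k' A j < 2 ^ \<kappa>"
proof (cases "em A \<and> j \<in> E A")
  case True
  hence "k' A j < 2 ^ (\<kappa> - TE)" using code_less[OF assms(1)] by (simp add: k'_def)
  also have "\<dots> \<le> (2::nat) ^ \<kappa>" by (rule power_increasing) auto
  finally show ?thesis .
next
  case False
  hence "k' A j = kk j A" by (auto simp: k'_def)
  thus ?thesis using kk_less[OF assms] K_le by simp
qed

lemma jj: "card (E A) > 1 \<Longrightarrow> fst (jj A) \<in> E A \<and> snd (jj A) \<in> E A \<and> fst (jj A) \<noteq> snd (jj A)"
proof -
  assume "card (E A) > 1"
  then obtain i j where "i \<in> E A" "j \<in> E A" "i \<noteq> j" by (metis One_nat_def card_le_Suc0_iff_eq card.infinite not_less not_less_zero)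
  hence "case (i, j) of (i, j) \<Rightarrow> i \<in> E A \<and> j \<in> E A \<and> i \<noteq> j" by simp
  from someI[of "\<lambda>(i, j). i \<in> E A \<and> j \<in> E A \<and> i \<noteq> j", OF this] show ?thesis
    unfolding jj_def by (simp add: case_prod_beta)
qed

lemma sum_ttE: "i < b \<Longrightarrow> j < b \<Longrightarrow> i \<noteq> j \<Longrightarrow> sum (ttE i j) {..<b} = 2 * TE"
proof -
  assume a: "i < b" "j < b" "i \<noteq> j"
  have "sum (ttE i j) {..<b} = sum (ttE i j) {i, j}"
    by (rule sum.mono_neutral_right) (use a in \<open>auto simp: ttE_def\<close>)
  thus ?thesis using a by (simp add: ttE_def)
qed

lemma tv_amb:
  assumes "\<not> clean A" "\<not> card (E A) > 1"
  shows "\<forall>j<b. tv A j \<le> \<tau>A A j" "sum (tv A) {..<b} = D"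
proof -
  have "\<exists>t. (\<forall>j<b. t j \<le> \<tau>A A j) \<and> sum t {..<b} = D"
    by (rule ex_bounded_sum) (use assms in \<open>simp add: clean_def\<close>)
  from someI_ex[OF this] show "\<forall>j<b. tv A j \<le> \<tau>A A j" "sum (tv A) {..<b} = D"
    using assms by (simp_all add: tv_def)
qed

lemma tv_bounds:
  assumes "length A = off b"
  shows "j < b \<Longrightarrow> tv A j \<le> \<kappa>" "sum (tv A) {..<b} \<le> D + 2 * TE"
proof -
  have \<tau>: "\<tau>A A j \<le> \<kappa>" if "j < b" for j
    unfolding \<tau>A_def by (rule \<tau>_le) (use that kk_less[OF assms] R_less in auto)
  have "(\<forall>j<b. tv A j \<le> \<kappa>) \<and> sum (tv A) {..<b} \<le> D + 2 * TE"
  proof (cases "clean A")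
    case True thus ?thesis using \<tau> by (simp add: tv_def clean_def)
  next
    case nc: False
    show ?thesis
    proof (cases "card (E A) > 1")
      case True
      from jj[OF this] have "fst (jj A) < b" "snd (jj A) < b" "fst (jj A) \<noteq> snd (jj A)" by (auto simp: E_def)
      thus ?thesis using nc True sum_ttE DT by (simp add: tv_def) (simp add: ttE_def)
    next
      case False
      have "tv A j \<le> \<kappa>" if "j < b" for j using tv_amb(1)[OF nc False] \<tau>[OF that] that by (meson order.trans)
      thus ?thesis using tv_amb(2)[OF nc False] by simp
    qed
  qed
  thus "j < b \<Longrightarrow> tv A j \<le> \<kappa>" "sum (tv A) {..<b} \<le> D + 2 * TE" by blast+
qed

lemma sum_r: "sum (r t) {..<Suc n} \<le> l + 2 * sum t {..<n} + t n"
proof (induction n)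
  case 0 show ?case by (simp add: r_def)
next
  case (Suc n)
  have "r t (Suc n) \<le> t n + t (Suc n)" by (simp add: r_def)
  thus ?case using Suc by simp
qed

lemma M'_le:
  assumes "sum t {..<b} \<le> D + 2 * TE"
  shows "M' \<le> sum (len t) {..<b} + sum M {..<b}" "hdr_len t \<le> sum (len t) {..<b}"
proof -
  obtain b' where b': "b = Suc b'" using b0 by (cases b) auto
  have "sum (r t) {..<b} \<le> l + 2 * sum t {..<b}" using sum_r[of t b'] b' by simp
  moreover have "b * (l + \<kappa>) \<le> (\<Sum>j<b. len t j + r t j + t j)"
  proof -
    have "(\<Sum>j<b. l + \<kappa>) \<le> (\<Sum>j<b. len t j + r t j + t j)" by (rule sum_mono) (simp add: len_def)
    thus ?thesis by simp
  qed
  ultimately show "M' \<le> sum (len t) {..<b} + sum M {..<b}" using assms M'2 by (simp add: sum.distrib)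
  show "hdr_len t \<le> sum (len t) {..<b}" using M'1 by (simp add: hdr_len_def)
qed

lemma length_lows: "length (lows t x k ms) = sum (len t) {..<b} + length ms"
proof -
  have "length (concat (map (\<lambda>j. bl (l - r t j) (x j) @ bl (\<kappa> - t j) (k j)) [0..<b])) = sum (len t) {..<b}"
    by (rule length_concat_upt) (simp add: len_def)
  thus ?thesis by (simp add: lows_def)
qed

lemma length_mem: "length A = off b \<Longrightarrow> j < b \<Longrightarrow> length (mem j (blk j A)) = M j"
  using reps[of j] length_blk[of A j] unfolding rep_def query_ok_def by blast

lemma length_mems: "length A = off b \<Longrightarrow> length (mems A) = sum M {..<b}"
  unfolding mems_def by (rule length_concat_upt) (rule length_mem)

lemma length_lowsA: "length A = off b \<Longrightarrow> length (lowsA A) = sum (len (tv A)) {..<b} + sum M {..<b}"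
  by (simp add: lowsA_def length_lows length_mems)

lemma length_memory: "length A = off b \<Longrightarrow> length (memory A) = M'"
  using M'_le(1)[OF tv_bounds(2)] by (simp add: memory_def length_lowsA hdr_len_def)

lemma r_restrict: "j < b \<Longrightarrow> r (restrict t {..<b}) j = r t j" by (auto simp: r_def)

lemma len_restrict: "j < b \<Longrightarrow> len (restrict t {..<b}) j = len t j" by (simp add: len_def r_restrict)

lemma child_index:
  assumes "u \<le> off n" "n > 0"
  shows "\<exists>i<n. off i \<le> u \<and> u \<le> off i + s i"
  using assms
proof (induction n)
  case (Suc n)
  show ?case
  proof (cases "u \<le> off n \<and> n > 0")
    case True thus ?thesis using Suc.IH less_SucI by blast
  next
    case False
    thus ?thesis using Suc.prems by (intro exI[of _ n]) (auto simp: off_Suc off_def)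
  qed
qed simp

lemma rank_split:
  assumes "length A = off b" "i < b" "off i \<le> u" "u \<le> off i + s i"
  shows "ones (take u A) = P i A + ones (take (u - off i) (blk i A))"
proof -
  have "take u A = take (off i) A @ take (u - off i) (drop (off i) A)"
    using assms(3) by (metis le_add_diff_inverse take_add)
  moreover have "take (u - off i) (blk i A) = take (u - off i) (drop (off i) A)"
    using assms(4) by (simp add: blk_def min_absorb1)
  ultimately show ?thesis by (simp add: ones_append P_def)
qed

text \<open>The three extra reads fetch the slots of block \<open>i\<close>, of its right neighbour,
  and of the last earlier block whose slot holds an explicit prefix sum. From that block on the
  carries in the header suffice, and the child query continues with its own residue and
  header.\<close>

lemma query: "query_ok W (off b) l M' (p + 3) header memory"
  unfolding query_ok_def
proof (intro conjI allI)
  fix A show "length A = off b \<longrightarrow> length (memory A) = M'" by (simp add: length_memory)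
next
  fix \<rho> and h :: "(nat \<Rightarrow> nat) \<times> (nat \<Rightarrow> nat) \<times> (nat \<Rightarrow> nat) \<times> (nat \<Rightarrow> nat option) \<times> nat \<times> bool list" and o' u
  obtain t X Z G PB e where h: "h = (t, X, Z, G, PB, e)" by (cases h) auto
  have "\<forall>i \<rho> k a v. \<exists>f. i < b \<longrightarrow> reads W p f \<and> (\<forall>A\<in>arrays (s i) l \<rho>. \<forall>m. hdr i A = k \<longrightarrow> v \<le> s i \<longrightarrow>
        take (M i) (drop a m) = mem i A \<longrightarrow> f m = ones (take v A))"
    using reps unfolding rep_def query_ok_def by meson
  then obtain CH0 where CH0: "\<And>i \<rho> k a v. i < b \<Longrightarrow> reads W p (CH0 i \<rho> k a v) \<and> (\<forall>A\<in>arrays (s i) l \<rho>. \<forall>m. hdr i A = k \<longrightarrow> v \<le> s i \<longrightarrow>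
        take (M i) (drop a m) = mem i A \<longrightarrow> CH0 i \<rho> k a v m = ones (take v A))" by metis
  show "\<exists>f. reads W (p + 3) f \<and> (\<forall>A\<in>arrays (off b) l \<rho>. \<forall>m. header A = h \<longrightarrow> u \<le> off b \<longrightarrow>
        take M' (drop o' m) = memory A \<longrightarrow> f m = ones (take u A))"
  proof (cases "u \<le> off b")
    case False
    thus ?thesis using reads.const[of W "p + 3" 0] by blast
  next
    case True
    then obtain i where i: "i < b" "off i \<le> u" "u \<le> off i + s i" using child_index[of u b] b0 by blast
    define pos where "pos j = sum (len t) {..<j}" for j
    define dec where "dec j sg = (X j * 2 ^ (l - r t j) + nb (take (l - r t j) sg), Z j * 2 ^ (\<kappa> - t j) + nb (drop (l - r t j) sg))" for j sg
    define getp where "getp j m = dec j (take (len t j) (drop (pos j) e @ take W (drop (o' + (pos j - length e)) m)))" for j m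
    define na where "na = {j. j < i \<and> G j = None}"
    \<comment> \<open>For empty \<open>na\<close> this value is arbitrary; the slot read for it is
      then ignored by \<open>Q\<close>.\<close>
    define ai where "ai = Max na"
    define Q where "Q ka = (if na = {} then (\<Sum>j<i. the (G j)) else (ka mod 2 ^ wP) div 2 ^ l + (\<Sum>j\<in>{Suc ai..<i}. the (G j)))" for ka :: nat
    define ki where "ki x1 x2 = (if G i = None then inv_into (Es i (fst x1) (fst x2)) (ix i (fst x1) (fst x2)) (snd x1 div 2 ^ wP) else snd x1)"
      for x1 x2 :: "nat \<times> nat"
    define mpos where "mpos = sum (len t) {..<b} + sum M {..<i}"
    define CH where "CH x1 x2 = CH0 i ((fst x2 + 2 ^ l - fst x1) mod 2 ^ l) (ki x1 x2) (o' + (mpos - length e)) (u - off i)"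
      for x1 x2 :: "nat \<times> nat"
    define F where "F x1 x2 x3 m = Q (snd x3) * 2 ^ l + fst x1 + CH x1 x2 m" for x1 x2 x3 :: "nat \<times> nat" and m
    \<comment> \<open>The right end of the last block has no slot, but its residue is that of the
      whole array, which the query knows.\<close>
    define f2 where "f2 = (if Suc i < b then getp (Suc i) else (\<lambda>m. (\<rho>, 0)))"
    have rd: "reads W 1 (getp j)" for j
      unfolding getp_def using reads_map[OF reads_one[of W "o' + (pos j - length e)"], of "\<lambda>y. dec j (take (len t j) (drop (pos j) e @ y))"] by simp
    have rf2: "reads W 1 f2" using rd[of "Suc i"] reads.const[of W 1 "(\<rho>, 0)"] by (cases "Suc i < b") (simp_all add: f2_def)
    have rF: "reads W p (F x1 x2 x3)" for x1 x2 x3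
      unfolding F_def by (rule reads_map) (use CH0[OF i(1)] in \<open>simp add: CH_def\<close>)
    have rr: "reads W (p + 3) (\<lambda>m. F (getp i m) (f2 m) (getp ai m) m)"
      by (rule reads3[OF rd rf2 rd rF])
    moreover have "F (getp i m) (f2 m) (getp ai m) m = ones (take u A)"
      if A: "A \<in> arrays (off b) l \<rho>" and hA: "header A = h" and mA: "take M' (drop o' m) = memory A" for A m
    proof -
      have lA: "length A = off b" and Rb: "R b A = \<rho>" using A by (auto simp: arrays_def R_def P_def)
      have t: "t = restrict (tv A) {..<b}" and X: "X = restrict (\<lambda>j. R j A div 2 ^ (l - r (tv A) j)) {..<b}"
        and Z: "Z = restrict (\<lambda>j. k' A j div 2 ^ (\<kappa> - tv A j)) {..<b}" and G: "G = restrict (gs A) {..<b}"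
        and e: "e = take (hdr_len (tv A)) (lowsA A)" using hA unfolding h header_def by auto
      have tj: "t j = tv A j" "r t j = r (tv A) j" "len t j = len (tv A) j" if "j < b" for j
        unfolding t using that by (simp_all add: r_restrict len_restrict)
      have slen: "sum (len t) {..<j} = sum (len (tv A)) {..<j}" if "j \<le> b" for j
        by (rule sum.cong) (use that tj in auto)
      have em: "e @ memory A = lowsA A" by (simp add: e memory_def)
      have ccle: "hdr_len (tv A) \<le> sum (len (tv A)) {..<b}" by (rule M'_le(2)[OF tv_bounds(2)[OF lA]])
      have le: "length e = hdr_len (tv A)" using ccle by (simp add: e length_lowsA[OF lA])
      have ltot: "length e + M' = sum (len (tv A)) {..<b} + sum M {..<b}"
        using M'_le(1)[OF tv_bounds(2)[OF lA]] by (simp add: le hdr_len_def)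
      have gp: "getp j m = (R j A, k' A j)" if j: "j < b" for j
      proof -
        have "sum (len (tv A)) {..<Suc j} \<le> sum (len (tv A)) {..<b}" by (rule sum_mono2) (use j in auto)
        hence "pos j + len t j \<le> length e + M'" using ltot slen[of j] tj[OF j] j by (simp add: pos_def)
        moreover have "len t j \<le> W" using lW by (simp add: len_def)
        ultimately have "take (len t j) (drop (pos j) e @ take W (drop (o' + (pos j - length e)) m)) = take (len t j) (drop (pos j) (e @ memory A))"
          by (intro seg_read[OF mA length_memory[OF lA]])
        also have "\<dots> = bl (l - r (tv A) j) (R j A) @ bl (\<kappa> - tv A j) (k' A j)"
          unfolding em lowsA_def lows_def pos_def slen[OF less_imp_le[OF j]] tj(3)[OF j]
          by (rule take_drop_concat[OF j]) (simp add: len_def)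
        finally have "getp j m = dec j (bl (l - r (tv A) j) (R j A) @ bl (\<kappa> - tv A j) (k' A j))" by (simp add: getp_def)
        thus ?thesis unfolding dec_def tj[OF j] using j by (simp add: X Z nb_bl, intro conjI div_mult_mod_eq)
      qed
      have gi: "getp i m = (R i A, k' A i)" by (rule gp[OF i(1)])
      have f2: "fst (f2 m) = R (Suc i) A"
      proof (cases "Suc i < b")
        case True thus ?thesis by (simp add: f2_def gp)
      next
        case False
        hence "Suc i = b" using i by simp
        thus ?thesis using Rb by (simp add: f2_def)
      qed
      have QP: "Q (snd (getp ai m)) * 2 ^ l + R i A = P i A"
      proof (cases "na = {}")
        case True
        have "the (G j) = g j A" if "j < i" for j
        proof -
          have "G j \<noteq> None" using True that by (auto simp: na_def)
          thus ?thesis using that i(1) by (auto simp: G gs_def split: if_splits)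
        qed
        hence "(\<Sum>j<i. the (G j)) = (\<Sum>j\<in>{0..<i}. g j A)" by (intro sum.cong) auto
        thus ?thesis using P_sum[OF lA, of 0 i] i(1) True by (simp add: Q_def P0)
      next
        case False
        have fin: "finite na" by (simp add: na_def)
        have "ai \<in> na" unfolding ai_def by (rule Max_in[OF fin False])
        hence ai: "ai < i" "G ai = None" by (auto simp: na_def)
        hence aiE: "em A" "ai \<in> E A" using i(1) by (auto simp: G gs_def split: if_splits)
        have gj: "the (G j) = g j A" if "j \<in> {Suc ai..<i}" for j
        proof -
          have "j \<notin> na"
          proof
            assume "j \<in> na"
            hence "j \<le> ai" unfolding ai_def by (rule Max_ge[OF fin])
            thus False using that by simp
          qed
          hence "G j \<noteq> None" using that by (auto simp: na_def)
          thus ?thesis using that i(1) by (auto simp: G gs_def split: if_splits)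
        qed
        have "snd (getp ai m) = code ai A" using gp[of ai] ai i(1) aiE by (simp add: k'_def)
        hence "snd (getp ai m) mod 2 ^ wP = P (Suc ai) A" using P_le[OF lA, of "Suc ai"] ai i(1) by (simp add: code_def)
        thus ?thesis using P_sum[OF lA, of "Suc ai" i] ai i(1) False gj by (simp add: Q_def)
      qed
      have kie: "ki (getp i m) (f2 m) = kk i A"
      proof (cases "G i = None")
        case True
        hence iE: "em A" "i \<in> E A" using i(1) by (auto simp: G gs_def split: if_splits)
        have "k' A i div 2 ^ wP = ix i (R i A) (R (Suc i) A) (kk i A)"
          using iE P_le[OF lA, of "Suc i"] i(1) by (simp add: k'_def code_def)
        moreover have "inv_into (Es i (R i A) (R (Suc i) A)) (ix i (R i A) (R (Suc i) A)) (ix i (R i A) (R (Suc i) A) (kk i A)) = kk i A"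
          by (rule inv_into_f_f[OF bij_betw_imp_inj_on[OF ix_bij] E_Es[OF lA iE(2)]])
        ultimately show ?thesis using True by (simp add: ki_def gi f2)
      next
        case False
        hence "\<not> (em A \<and> i \<in> E A)" using i(1) by (auto simp: G gs_def)
        hence "k' A i = kk i A" by (auto simp: k'_def)
        thus ?thesis using False by (simp only: ki_def gi if_False snd_conv)
      qed
      have "take (M i) (drop (o' + (mpos - length e)) m) = take (M i) (drop mpos (e @ memory A))"
      proof (rule seg_child[OF mA length_memory[OF lA]])
        show "length e \<le> mpos" using le ccle slen[of b] by (simp add: mpos_def)
        have "sum M {..<Suc i} \<le> sum M {..<b}" by (rule sum_mono2) (use i in auto)
        thus "mpos + M i \<le> length e + M'" using ltot slen[of b] by (simp add: mpos_def)
      qed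
      also have "drop mpos (e @ memory A) = drop (sum M {..<i}) (mems A)"
      proof -
        let ?c = "concat (map (\<lambda>j. bl (l - r (tv A) j) (R j A) @ bl (\<kappa> - tv A j) (k' A j)) [0..<b])"
        have "length ?c = sum (len (tv A)) {..<b}" by (rule length_concat_upt) (simp add: len_def)
        moreover have "mpos = sum (len (tv A)) {..<b} + sum M {..<i}" using slen[of b] by (simp add: mpos_def)
        ultimately show ?thesis unfolding em lowsA_def lows_def by simp
      qed
      also have "take (M i) (drop (sum M {..<i}) (mems A)) = mem i (blk i A)"
        using take_drop_concat[OF i(1), of "\<lambda>j. mem j (blk j A)" M "[]"] length_mem[OF lA] by (simp add: mems_def)
      finally have mm: "take (M i) (drop (o' + (mpos - length e)) m) = mem i (blk i A)" .
      have "CH (getp i m) (f2 m) m = ones (take (u - off i) (blk i A))"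
      proof -
        have *: "CH (getp i m) (f2 m) = CH0 i ((R (Suc i) A + 2 ^ l - R i A) mod 2 ^ l) (kk i A) (o' + (mpos - length e)) (u - off i)"
          unfolding CH_def kie f2 by (simp add: gi)
        have "hdr i (blk i A) = kk i A" "u - off i \<le> s i" using i by (auto simp: kk_def)
        thus ?thesis unfolding * using CH0[OF i(1), of "(R (Suc i) A + 2 ^ l - R i A) mod 2 ^ l" "kk i A" "o' + (mpos - length e)" "u - off i"]
            blk_arrs[OF lA i(1)] mm by blast
      qed
      thus ?thesis unfolding F_def using QP rank_split[OF lA i] by (simp add: gi)
    qed
    ultimately show ?thesis by (intro exI[of _ "\<lambda>m. F (getp i m) (f2 m) (getp ai m) m"]) blast
  qed
qed

lemma header_det: "header A = header A' \<Longrightarrow> length A = off b \<Longrightarrow> length A' = off b \<Longrightarrow> ones A = ones A'"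
  by (simp add: header_def P_def)

end

subsection \<open>Counting the headers of a combined block\<close>

lemma nb_less: "nb xs < 2 ^ length xs"
proof -
  have "nb xs = nb xs mod 2 ^ length xs" using nb_bl[of "length xs" "nb xs"] bl_nb[of xs] by simp
  also have "\<dots> < 2 ^ length xs" by simp
  finally show ?thesis .
qed

lemma div_coarse: "t \<le> t0 \<Longrightarrow> (y::nat) div 2 ^ (l - t) = y div 2 ^ (l - t0) div 2 ^ ((l - t) - (l - t0))"
proof -
  assume "t \<le> t0"
  hence "l - t = (l - t0) + ((l - t) - (l - t0))" by simp
  hence "(2::nat) ^ (l - t) = 2 ^ (l - t0) * 2 ^ ((l - t) - (l - t0))" by (metis power_add)
  thus ?thesis by (simp only: div_mult2_eq)
qed

lemma div_pow_less: "(y::nat) < 2 ^ l \<Longrightarrow> y div 2 ^ d < 2 ^ (l - d)"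
proof -
  assume y: "y < 2 ^ l"
  have "(2::nat) ^ l \<le> 2 ^ ((l - d) + d)" by (rule power_increasing) auto
  hence "y < 2 ^ (l - d) * 2 ^ d" using y by (simp add: power_add)
  thus ?thesis by (rule less_mult_imp_div_less)
qed

lemma less_pow_if_div_eq:
  assumes "(y::nat) div 2 ^ d = y' div 2 ^ d" "y' < 2 ^ l" "d \<le> l"
  shows "y < 2 ^ l"
proof -
  have "(2::nat) ^ l = 2 ^ d * 2 ^ (l - d)" using assms(3) by (metis le_add_diff_inverse power_add)
  hence "y div 2 ^ l = y' div 2 ^ l" using assms(1) by (simp only: div_mult2_eq)
  also have "\<dots> = 0" using assms(2) by simp
  finally show ?thesis by (simp add: div_eq_0_iff)
qed

lemma card_half:
  assumes "finite U"
  shows "finite {Z :: nat. Z div 2 \<in> U}" "card {Z :: nat. Z div 2 \<in> U} \<le> 2 * card U"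
proof -
  have sub: "{Z :: nat. Z div 2 \<in> U} \<subseteq> (\<lambda>z. 2 * z) ` U \<union> (\<lambda>z. 2 * z + 1) ` U"
  proof
    fix Z assume "Z \<in> {Z :: nat. Z div 2 \<in> U}"
    hence "Z div 2 \<in> U" by simp
    moreover have "Z = 2 * (Z div 2) \<or> Z = 2 * (Z div 2) + 1" by arith
    ultimately show "Z \<in> (\<lambda>z. 2 * z) ` U \<union> (\<lambda>z. 2 * z + 1) ` U" by (metis UnI1 UnI2 imageI)
  qed
  have fin: "finite ((\<lambda>z. 2 * z) ` U \<union> (\<lambda>z. 2 * z + 1) ` U)" using assms by simp
  show "finite {Z :: nat. Z div 2 \<in> U}" by (rule finite_subset[OF sub fin])
  have "card {Z :: nat. Z div 2 \<in> U} \<le> card ((\<lambda>z. 2 * z) ` U \<union> (\<lambda>z. 2 * z + 1) ` U)" by (rule card_mono[OF fin sub])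
  also have "\<dots> \<le> card ((\<lambda>z. 2 * z) ` U) + card ((\<lambda>z. 2 * z + 1) ` U)" by (rule card_Un_le)
  also have "\<dots> \<le> card U + card U" using card_image_le[OF assms] by (intro add_mono)
  finally show "card {Z :: nat. Z div 2 \<in> U} \<le> 2 * card U" by simp
qed

lemma finite_und: "finite (undetermined N l \<kappa> K gm t X Y)"
  by (rule finite_subset[of _ "(\<lambda>k. k div 2 ^ (\<kappa> - t)) ` {..<K}"]) (auto simp: undetermined_def)

lemma prod_le_one_exception:
  fixes u v :: nat and f :: "nat \<Rightarrow> nat"
  assumes "\<And>j. j < b \<Longrightarrow> f j \<le> (if Q j then v else u)" "u > 0" "v > 0"
    and "\<And>i j. i < b \<Longrightarrow> j < b \<Longrightarrow> Q i \<Longrightarrow> Q j \<Longrightarrow> i = j"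
  shows "(\<Prod>j<b. f j) \<le> u ^ b * v"
proof (cases "\<exists>i<b. Q i")
  case True
  then obtain i where i: "i < b" "Q i" by blast
  have "(\<Prod>j<b. f j) \<le> (\<Prod>j<b. if j = i then u * v else u)"
  proof (rule prod_mono)
    fix j assume "j \<in> {..<b}"
    hence j: "j < b" by simp
    show "0 \<le> f j \<and> f j \<le> (if j = i then u * v else u)"
    proof (cases "j = i")
      case True
      have "f j \<le> 1 * v" using assms(1)[OF j] i True by simp
      also have "\<dots> \<le> u * v" by (rule mult_right_mono) (use assms(2) in auto)
      finally show ?thesis using True by simp
    next
      case False
      hence "\<not> Q j" using assms(4)[OF j i(1)] i(2) by blast
      thus ?thesis using assms(1)[OF j] False by simp
    qed
  qed
  also have "\<dots> = (\<Prod>j<b. u * (if j = i then v else 1))" by (rule prod.cong) auto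
  also have "\<dots> = u ^ b * v" using i by (simp add: prod.distrib)
  finally show ?thesis .
next
  case False
  have "(\<Prod>j<b. f j) \<le> (\<Prod>j<b. u)"
  proof (rule prod_mono)
    fix j assume "j \<in> {..<b}"
    thus "0 \<le> f j \<and> f j \<le> u" using False assms(1)[of j] by auto
  qed
  also have "\<dots> \<le> u ^ b * v" using assms(3) by simp
  finally show ?thesis .
qed

context node
begin

lemma dt_cong:
  assumes "y' div 2 ^ (l - t0) = y div 2 ^ (l - t0)" "x' div 2 ^ (l - t0) = x div 2 ^ (l - t0)"
    "kx div 2 ^ (\<kappa> - t0) = k div 2 ^ (\<kappa> - t0)" "t \<le> t0"
  shows "dt j t y' x' kx = dt j t y x k"
proof -
  have "y' div 2 ^ (l - t) = y div 2 ^ (l - t)" "x' div 2 ^ (l - t) = x div 2 ^ (l - t)" "kx div 2 ^ (\<kappa> - t) = k div 2 ^ (\<kappa> - t)"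
    using div_coarse[OF assms(4), of y' l] div_coarse[OF assms(4), of y l] div_coarse[OF assms(4), of x' l]
      div_coarse[OF assms(4), of x l] div_coarse[OF assms(4), of kx \<kappa>] div_coarse[OF assms(4), of k \<kappa>] assms(1-3) by (simp_all only:)
  thus ?thesis unfolding dt_def by (simp only:)
qed

lemma dt_\<tau>: "k < K \<Longrightarrow> y < 2 ^ l \<Longrightarrow> x < 2 ^ l \<Longrightarrow> dt j (\<tau> j y x k) y x k"
  unfolding \<tau>_def by (rule LeastI) (rule dt_\<kappa>)

text \<open>Whether a coarser cell is determined depends only on leading bits that both triples
  share. The minimal determined cells therefore behave like a prefix-free code: changing all lower
  bits leads back to the same cell, hence to a valid header with the same carry.\<close>

lemma \<tau>_cong:
  assumes "k < K" "y < 2 ^ l" "x < 2 ^ l" "y' < 2 ^ l" "x' < 2 ^ l"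
    and c: "y' div 2 ^ (l - \<tau> j y x k) = y div 2 ^ (l - \<tau> j y x k)" "x' div 2 ^ (l - \<tau> j y x k) = x div 2 ^ (l - \<tau> j y x k)"
      "kx div 2 ^ (\<kappa> - \<tau> j y x k) = k div 2 ^ (\<kappa> - \<tau> j y x k)"
  shows "\<tau> j y' x' kx = \<tau> j y x k" "kx < K" "qq j y' x' kx = qq j y x k"
proof -
  let ?t = "\<tau> j y x k"
  have d: "dt j ?t y x k" by (rule dt_\<tau>) fact+
  have "(LEAST t. dt j t y' x' kx) = ?t"
  proof (rule Least_equality)
    show "dt j ?t y' x' kx" using dt_cong[OF c order.refl] d by simp
    fix t assume t: "dt j t y' x' kx"
    show "?t \<le> t"
    proof (rule ccontr)
      assume "\<not> ?t \<le> t"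
      hence lt: "t < ?t" by simp
      hence "dt j t y x k" using dt_cong[OF c less_imp_le[OF lt]] t by simp
      moreover have "\<not> dt j t y x k" by (rule not_less_Least) (use lt in \<open>simp add: \<tau>_def\<close>)
      ultimately show False by contradiction
    qed
  qed
  thus "\<tau> j y' x' kx = ?t" by (simp only: \<tau>_def)
  from d obtain g where g: "\<And>y1 x1 k1. y1 < 2 ^ l \<Longrightarrow> x1 < 2 ^ l \<Longrightarrow> y1 div 2 ^ (l - ?t) = y div 2 ^ (l - ?t) \<Longrightarrow>
      x1 div 2 ^ (l - ?t) = x div 2 ^ (l - ?t) \<Longrightarrow> k1 div 2 ^ (\<kappa> - ?t) = k div 2 ^ (\<kappa> - ?t) \<Longrightarrow> k1 < K \<and> carry (N j) l (gm j) y1 x1 k1 = g"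
    unfolding dt_def determined_def by (elim exE) simp
  show "kx < K" using g[OF assms(4,5) c] by simp
  show "qq j y' x' kx = qq j y x k" using g[OF assms(4,5) c] g[OF assms(2,3) refl refl refl] by (simp add: qq_def)
qed

lemma r_cong: "(\<And>j. j < b \<Longrightarrow> t j = t' j) \<Longrightarrow> j < b \<Longrightarrow> r t j = r t' j" by (auto simp: r_def)

lemma len_cong: "(\<And>j. j < b \<Longrightarrow> t j = t' j) \<Longrightarrow> j < b \<Longrightarrow> len t j = len t' j"
  using r_cong[of t t' j] by (simp add: len_def)

lemma cc_cong:
  assumes "\<And>j. j < b \<Longrightarrow> t j = t' j"
  shows "hdr_len t = hdr_len t'"
proof -
  have "sum (len t) {..<b} = sum (len t') {..<b}" by (rule sum.cong) (use len_cong[OF assms] in auto)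
  thus ?thesis by (simp add: hdr_len_def)
qed

lemma lows_cong:
  assumes "\<And>j. j < b \<Longrightarrow> t j = t' j" "\<And>j. j < b \<Longrightarrow> x j = x' j" "\<And>j. j < b \<Longrightarrow> k j = k1 j"
  shows "lows t x k ms = lows t' x' k1 ms"
proof -
  have "map (\<lambda>j. bl (l - r t j) (x j) @ bl (\<kappa> - t j) (k j)) [0..<b] = map (\<lambda>j. bl (l - r t' j) (x' j) @ bl (\<kappa> - t' j) (k1 j)) [0..<b]"
    by (rule map_cong[OF refl]) (use assms r_cong[OF assms(1)] in auto)
  thus ?thesis by (simp only: lows_def)
qed

definition xx where "xx \<rho> x j = (if j = 0 then 0 else if j = b then \<rho> else x j)" for \<rho> :: nat and x :: "nat \<Rightarrow> nat"

text \<open>Enumerates the clean headers together with all memory contents from the triples of residues, child headers and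
  child memories, so there are at most as many of the former as of the latter.\<close>

definition \<Phi> where "\<Phi> \<rho> = (\<lambda>(x0, k, ms). let x = xx \<rho> x0; t = (\<lambda>j. \<tau> j (x j) (x (Suc j)) (k j)) in
   ((restrict t {..<b}, restrict (\<lambda>j. x j div 2 ^ (l - r t j)) {..<b}, restrict (\<lambda>j. k j div 2 ^ (\<kappa> - t j)) {..<b},
     restrict (\<lambda>j. Some (qq j (x j) (x (Suc j)) (k j))) {..<b}, (\<Sum>j<b. qq j (x j) (x (Suc j)) (k j)) * 2 ^ l + \<rho>,
     take (hdr_len t) (lows t x k ms)), drop (hdr_len t) (lows t x k ms)))"

definition configs where "configs = (PiE {1..<b} (\<lambda>_. {..<2 ^ l :: nat})) \<times> (PiE {..<b} (\<lambda>_. {..<K})) \<times> {ms :: bool list. length ms = sum M {..<b}}"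

text \<open>The leading bits of a clean array can be combined with arbitrary low bits: every
  combination stays in the same determined cells, so it is a valid configuration with the same
  resolutions and carries. Hence every memory content occurs with every clean header.\<close>

lemma clean_onto:
  assumes A: "A \<in> arrays (off b) l \<rho>" "clean A" and mx: "length memx = M'"
  shows "(header A, memx) \<in> \<Phi> \<rho> ` configs"
proof -
  have lA: "length A = off b" and Rb: "R b A = \<rho>" using A by (auto simp: arrays_def R_def P_def)
  define t where "t = tv A"
  have t\<tau>: "t = \<tau>A A" using A(2) by (simp add: t_def tv_def)
  have nem: "\<not> em A" using A(2) by (simp add: em_def)
  hence k'A: "k' A j = kk j A" and gsA: "gs A j = Some (g j A)" for j by (auto simp: k'_def gs_def)
  have M'1: "M' \<le> sum (len t) {..<b} + sum M {..<b}" and ccl: "hdr_len t \<le> sum (len t) {..<b}"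
    unfolding t_def by (rule M'_le[OF tv_bounds(2)[OF lA]])+
  define e where "e = take (hdr_len t) (lowsA A)"
  have le: "length e = hdr_len t" using ccl by (simp add: e_def length_lowsA[OF lA] t_def)
  define lw where "lw = e @ memx"
  have llw: "length lw = sum (len t) {..<b} + sum M {..<b}" using M'1 mx by (simp add: lw_def le hdr_len_def)
  define sg where "sg j = take (len t j) (drop (sum (len t) {..<j}) lw)" for j
  define ms where "ms = drop (sum (len t) {..<b}) lw"
  have lsg: "length (sg j) = len t j" if "j < b" for j
  proof -
    have "sum (len t) {..<Suc j} \<le> sum (len t) {..<b}" by (rule sum_mono2) (use that in auto)
    thus ?thesis using llw by (simp add: sg_def)
  qed
  have lms: "length ms = sum M {..<b}" using llw by (simp add: ms_def)
  \<comment> \<open>Leading bits from \<open>A\<close>, all lower bits from the prescribed string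
    \<open>lw\<close>.\<close>
  define x0 where "x0 j = R j A div 2 ^ (l - r t j) * 2 ^ (l - r t j) + nb (take (l - r t j) (sg j))" for j
  define k0 where "k0 j = kk j A div 2 ^ (\<kappa> - t j) * 2 ^ (\<kappa> - t j) + nb (drop (l - r t j) (sg j))" for j
  have n1: "nb (take (l - r t j) (sg j)) < 2 ^ (l - r t j)" if "j < b" for j
    using nb_less[of "take (l - r t j) (sg j)"] lsg[OF that] by (simp add: len_def)
  have n2: "nb (drop (l - r t j) (sg j)) < 2 ^ (\<kappa> - t j)" if "j < b" for j
    using nb_less[of "drop (l - r t j) (sg j)"] lsg[OF that] by (simp add: len_def)
  have dx: "x0 j div 2 ^ (l - r t j) = R j A div 2 ^ (l - r t j)" "x0 j mod 2 ^ (l - r t j) = nb (take (l - r t j) (sg j))" if "j < b" for j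
    using n1[OF that] by (simp_all add: x0_def)
  have dk: "k0 j div 2 ^ (\<kappa> - t j) = kk j A div 2 ^ (\<kappa> - t j)" "k0 j mod 2 ^ (\<kappa> - t j) = nb (drop (l - r t j) (sg j))" if "j < b" for j
    using n2[OF that] by (simp_all add: k0_def)
  have x0l: "x0 j < 2 ^ l" if "j < b" for j
    by (rule less_pow_if_div_eq[OF dx(1)[OF that] R_less]) simp
  have x00: "x0 0 = 0" by (simp add: x0_def r_def R0 nb_def)
  define x1 where "x1 = restrict x0 {1..<b}"
  define k1 where "k1 = restrict k0 {..<b}"
  define x where "x = xx \<rho> x1"
  have xj: "x j = x0 j" if "j < b" for j using that x00 by (auto simp: x_def xx_def x1_def)
  have xb: "x b = \<rho>" using b0 by (simp add: x_def xx_def)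
  have \<rho>l: "\<rho> < 2 ^ l" using Rb R_less[of b A] by simp
  have xl: "x j < 2 ^ l" if "j \<le> b" for j using that xj[of j] x0l[of j] xb \<rho>l by (cases "j = b") auto
  have cellx: "x j div 2 ^ (l - c) = R j A div 2 ^ (l - c)" if "j \<le> b" "j < b \<Longrightarrow> c \<le> r t j" for j c
  proof (cases "j = b")
    case True thus ?thesis using xb Rb by simp
  next
    case False
    hence j: "j < b" using that by simp
    have "c \<le> r t j" using that j by simp
    from div_coarse[OF this, of "x0 j" l] div_coarse[OF this, of "R j A" l] show ?thesis
      unfolding xj[OF j] using dx(1)[OF j] by (simp only:)
  qed
  have tj: "t j = \<tau> j (R j A) (R (Suc j) A) (kk j A)" for j by (simp add: t\<tau> \<tau>A_def)
  have main: "\<tau> j (x j) (x (Suc j)) (k0 j) = t j" "k0 j < K" "qq j (x j) (x (Suc j)) (k0 j) = g j A" if j: "j < b" for j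
  proof -
    have c1: "x j div 2 ^ (l - t j) = R j A div 2 ^ (l - t j)"
    proof (cases "j = 0")
      case True thus ?thesis using xj[OF j] x00 by (simp add: R0)
    next
      case False
      show ?thesis by (rule cellx) (use j False in \<open>auto simp: r_def\<close>)
    qed
    have c2: "x (Suc j) div 2 ^ (l - t j) = R (Suc j) A div 2 ^ (l - t j)"
      by (rule cellx) (use j in \<open>auto simp: r_def\<close>)
    show "\<tau> j (x j) (x (Suc j)) (k0 j) = t j" "k0 j < K" "qq j (x j) (x (Suc j)) (k0 j) = g j A"
      using \<tau>_cong[OF kk_less[OF lA j] R_less[of j A] R_less[of "Suc j" A] xl[of j] xl[of "Suc j"], of j "k0 j", folded tj, OF _ _ c1 c2 dk(1)[OF j]] j
      by (simp_all add: g_def)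
  qed
  have inc: "(x1, k1, ms) \<in> configs"
    unfolding configs_def x1_def k1_def using x0l main(2) lms by auto
  define t' where "t' j = \<tau> j (x j) (x (Suc j)) (k1 j)" for j
  have t': "t' j = t j" if "j < b" for j using main(1)[OF that] that by (simp add: t'_def k1_def)
  have q': "qq j (x j) (x (Suc j)) (k1 j) = g j A" if "j < b" for j using main(3)[OF that] that by (simp add: k1_def)
  have r': "r t' j = r t j" if "j < b" for j by (rule r_cong[OF t' that])
  have lweq: "lows t' x k1 ms = lw"
  proof -
    have "lows t' x k1 ms = lows t x0 k0 ms" by (rule lows_cong) (use t' xj in \<open>auto simp: k1_def\<close>)
    also have "\<dots> = concat (map sg [0..<b]) @ ms"
    proof -
      have "bl (l - r t j) (x0 j) @ bl (\<kappa> - t j) (k0 j) = sg j" if j: "j < b" for j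
      proof -
        have "bl (l - r t j) (x0 j) = bl (l - r t j) (nb (take (l - r t j) (sg j)))"
          by (rule bl_eq) (use dx(2)[OF j] n1[OF j] in simp)
        also have "\<dots> = take (l - r t j) (sg j)" using bl_nb[of "take (l - r t j) (sg j)"] lsg[OF j] by (simp add: len_def)
        finally have 1: "bl (l - r t j) (x0 j) = take (l - r t j) (sg j)" .
        have "bl (\<kappa> - t j) (k0 j) = bl (\<kappa> - t j) (nb (drop (l - r t j) (sg j)))"
          by (rule bl_eq) (use dk(2)[OF j] n2[OF j] in simp)
        also have "\<dots> = drop (l - r t j) (sg j)" using bl_nb[of "drop (l - r t j) (sg j)"] lsg[OF j] by (simp add: len_def)
        finally show ?thesis using 1 by simp
      qed
      hence "map (\<lambda>j. bl (l - r t j) (x0 j) @ bl (\<kappa> - t j) (k0 j)) [0..<b] = map sg [0..<b]" by (intro map_cong) auto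
      thus ?thesis by (simp only: lows_def)
    qed
    also have "concat (map sg [0..<b]) = take (sum (len t) {..<b}) lw"
    proof -
      have "concat (map sg [0..<b]) = concat (map (\<lambda>j. take (len t j) (drop (sum (len t) {..<j}) (take (sum (len t) {..<b}) lw))) [0..<b])"
      proof (rule arg_cong[where f = concat], rule map_cong[OF refl])
        fix j assume "j \<in> set [0..<b]"
        hence "sum (len t) {..<Suc j} \<le> sum (len t) {..<b}" by (intro sum_mono2) auto
        thus "sg j = take (len t j) (drop (sum (len t) {..<j}) (take (sum (len t) {..<b}) lw))"
          by (simp add: sg_def drop_take min_absorb1)
      qed
      also have "\<dots> = take (sum (len t) {..<b}) lw" by (rule concat_take_drop) (simp add: llw)
      finally show ?thesis .
    qed
    finally show ?thesis by (simp add: ms_def)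
  qed
  have cc': "hdr_len t' = hdr_len t" by (rule cc_cong[OF t'])
  have "\<Phi> \<rho> (x1, k1, ms) = (header A, memx)"
  proof -
    have 1: "restrict t' {..<b} = restrict (tv A) {..<b}" using t' by (auto simp: t_def)
    have 2: "restrict (\<lambda>j. x j div 2 ^ (l - r t' j)) {..<b} = restrict (\<lambda>j. R j A div 2 ^ (l - r (tv A) j)) {..<b}"
      by (rule restrict_ext) (use dx(1) xj r' in \<open>simp add: t_def\<close>)
    have 3: "restrict (\<lambda>j. k1 j div 2 ^ (\<kappa> - t' j)) {..<b} = restrict (\<lambda>j. k' A j div 2 ^ (\<kappa> - tv A j)) {..<b}"
      by (rule restrict_ext) (use dk(1) t' in \<open>simp add: t_def k1_def k'A\<close>)
    have 4: "restrict (\<lambda>j. Some (qq j (x j) (x (Suc j)) (k1 j))) {..<b} = restrict (gs A) {..<b}"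
      by (rule restrict_ext) (use q' in \<open>simp add: gsA\<close>)
    have 5: "(\<Sum>j<b. qq j (x j) (x (Suc j)) (k1 j)) * 2 ^ l + \<rho> = P b A"
    proof -
      have "(\<Sum>j<b. qq j (x j) (x (Suc j)) (k1 j)) = (\<Sum>j\<in>{0..<b}. g j A)" by (rule sum.cong) (use q' in auto)
      thus ?thesis using P_sum[OF lA, of 0 b] Rb by (simp add: P0)
    qed
    have 6: "take (hdr_len t') (lows t' x k1 ms) = take (hdr_len (tv A)) (lowsA A)"
      unfolding lweq cc' lw_def using le by (simp add: e_def t_def)
    have 7: "drop (hdr_len t') (lows t' x k1 ms) = memx"
      unfolding lweq cc' lw_def using le by simp
    have "\<Phi> \<rho> (x1, k1, ms) = ((restrict t' {..<b}, restrict (\<lambda>j. x j div 2 ^ (l - r t' j)) {..<b}, restrict (\<lambda>j. k1 j div 2 ^ (\<kappa> - t' j)) {..<b},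
     restrict (\<lambda>j. Some (qq j (x j) (x (Suc j)) (k1 j))) {..<b}, (\<Sum>j<b. qq j (x j) (x (Suc j)) (k1 j)) * 2 ^ l + \<rho>,
     take (hdr_len t') (lows t' x k1 ms)), drop (hdr_len t') (lows t' x k1 ms))"
      unfolding \<Phi>_def x_def t'_def Let_def by simp
    thus ?thesis unfolding 1 2 3 4 5 6 7 header_def .
  qed
  thus ?thesis using inc by (metis image_eqI)
qed

lemma card_clean: "card (header ` {A \<in> arrays (off b) l \<rho>. clean A}) * 2 ^ M' \<le> (2 ^ l) ^ (b - 1) * K ^ b * 2 ^ sum M {..<b}"
proof -
  let ?H = "header ` {A \<in> arrays (off b) l \<rho>. clean A}"
  have fin: "finite configs" unfolding configs_def by (intro finite_cartesian_product finite_PiE finite_lists) auto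
  have "?H \<times> {m :: bool list. length m = M'} \<subseteq> \<Phi> \<rho> ` configs" using clean_onto by auto
  hence "card (?H \<times> {m :: bool list. length m = M'}) \<le> card configs" by (meson fin surj_card_le)
  thus ?thesis by (simp add: card_cartesian_product card_lists configs_def card_PiE mult.assoc)
qed


section \<open>Headers of arrays that are not clean, with at most one atypical carry\<close>

definition XS where "XS t = PiE {..<b} (\<lambda>j. if j = 0 then {0} else {..<(2::nat) ^ (l - (l - r t j))})"

text \<open>The total length of the inner residues, the child header slots and the child memories;
  \<open>card_XS\<close> is the balance of these bits.\<close>

definition V where "V = (b - 1) * l + b * \<kappa> + sum M {..<b}"

lemma X_in: "restrict (\<lambda>j. R j A div 2 ^ (l - r t j)) {..<b} \<in> XS t"
  unfolding XS_def using div_pow_less[OF R_less] by (auto simp: R0)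

lemma finite_XS: "finite (XS t)" unfolding XS_def by (rule finite_PiE) auto

lemma card_XS:
  assumes "\<And>j. j < b \<Longrightarrow> t j \<le> \<kappa>" "sum t {..<b} \<le> D + 2 * TE"
  shows "card (XS t) * 2 ^ hdr_len t * 2 ^ sum t {..<b} * 2 ^ M' = 2 ^ V"
proof -
  have "card (XS t) = (\<Prod>j<b. card (if j = 0 then {0} else {..<(2::nat) ^ (l - (l - r t j))}))"
    unfolding XS_def by (rule card_PiE) simp
  also have "\<dots> = (\<Prod>j<b. 2 ^ (if j = 0 then 0 else l - (l - r t j)))" by (rule prod.cong) auto
  also have "\<dots> = 2 ^ (\<Sum>j<b. if j = 0 then 0 else l - (l - r t j))" by (simp add: power_sum)
  finally have 1: "card (XS t) = 2 ^ (\<Sum>j<b. if j = 0 then 0 else l - (l - r t j))" .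
  have 2: "hdr_len t + M' = sum (len t) {..<b} + sum M {..<b}" using M'_le(1)[OF assms(2)] by (simp add: hdr_len_def)
  have "(\<Sum>j<b. if j = 0 then 0 else l - (l - r t j)) + sum (len t) {..<b} + sum t {..<b}
      = (\<Sum>j<b. (if j = 0 then 0 else l - (l - r t j)) + len t j + t j)" by (simp add: sum.distrib)
  also have "\<dots> = (\<Sum>j<b. (if j = 0 then 0 else l) + \<kappa>)"
  proof (rule sum.cong[OF refl])
    fix j assume "j \<in> {..<b}"
    hence "t j \<le> \<kappa>" using assms(1) by simp
    thus "(if j = 0 then 0 else l - (l - r t j)) + len t j + t j = (if j = 0 then 0 else l) + \<kappa>"
      by (auto simp: len_def r_def)
  qed
  also have "\<dots> = (b - 1) * l + b * \<kappa>"
  proof -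
    have "(\<Sum>j<b. if j = 0 then 0 else l) = (b - 1) * l"
    proof -
      obtain b' where "b = Suc b'" using b0 by (cases b) auto
      thus ?thesis by (simp del: sum.lessThan_Suc add: sum.lessThan_Suc_shift)
    qed
    thus ?thesis by (simp add: sum.distrib)
  qed
  finally have "(\<Sum>j<b. if j = 0 then 0 else l - (l - r t j)) + hdr_len t + sum t {..<b} + M' = V"
    using 2 by (simp add: V_def)
  thus ?thesis unfolding 1 by (simp only: power_add[symmetric])
qed

lemma XS_cong: "(\<And>j. j < b \<Longrightarrow> t j = t' j) \<Longrightarrow> XS t = XS t'"
  unfolding XS_def by (rule PiE_cong) (use r_cong[of t t'] in auto)

text \<open>If an array is not clean, some \<open>t\<close> with \<open>sum t = D\<close> has undetermined cells at all resolutions \<open>t j - 1\<close>;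
  given the residues, each undetermined cell has only few candidates for the leading bits of the child header.\<close>

definition xc where "xc t X j = (if j = 0 then 0 else X j div 2 ^ ((l - (t j - 1)) - (l - r t j)))" for t X :: "nat \<Rightarrow> nat"
definition xd where "xd \<rho> t X j = (if Suc j < b then X (Suc j) div 2 ^ ((l - (t j - 1)) - (l - r t (Suc j))) else \<rho> div 2 ^ (l - (t j - 1)))"
  for t X :: "nat \<Rightarrow> nat"
definition ZS where "ZS \<rho> t X j = (if t j = 0 then {0} else {Z. Z div 2 \<in> undetermined (N j) l \<kappa> K (gm j) (t j - 1) (xc t X j) (xd \<rho> t X j)})"
definition GS where "GS = (\<Union>i<b. PiE {..<b} (\<lambda>j. if j = i then Some ` {..gx} else Some ` Typ j))"
definition TD where "TD = {t \<in> PiE {..<b} (\<lambda>_. {..D}). sum t {..<b} = D}"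
definition AS where "AS \<rho> t = (\<lambda>((X, Z), G, e). (t, X, Z, G, (\<Sum>j<b. the (G j)) * 2 ^ l + \<rho>, e)) `
   ((SIGMA X:XS t. PiE {..<b} (ZS \<rho> t X)) \<times> GS \<times> {e :: bool list. length e = hdr_len t})"

lemma finite_ZS: "finite (ZS \<rho> t X j)"
  unfolding ZS_def using card_half(1)[OF finite_und] by simp

text \<open>Resolution \<open>t j - 1\<close> was insufficient, which leaves few candidates for that
  many leading bits; the last bit doubles them.\<close>

lemma card_ZS: "j < b \<Longrightarrow> card (ZS \<rho> t X j) \<le> (if t j > T then 2 * n2 else 2 * Wb)"
proof -
  assume j: "j < b"
  show ?thesis
  proof (cases "t j = 0")
    case True thus ?thesis using pos by (simp add: ZS_def)
  next
    case False
    have "card (ZS \<rho> t X j) \<le> 2 * card (undetermined (N j) l \<kappa> K (gm j) (t j - 1) (xc t X j) (xd \<rho> t X j))"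
      unfolding ZS_def using False card_half(2)[OF finite_und] by simp
    also have "\<dots> \<le> (if t j > T then 2 * n2 else 2 * Wb)"
      using und1[OF j, of "t j - 1"] und2[OF j, of "t j - 1"] False by auto
    finally show ?thesis .
  qed
qed

text \<open>Two blocks above resolution \<open>T\<close> would exceed the total
  \<open>D < 2 * T\<close>, so the weak bound \<open>n2\<close> enters only once.\<close>

lemma prod_ZS:
  assumes "sum t {..<b} = D"
  shows "(\<Prod>j<b. card (ZS \<rho> t X j)) \<le> (2 * Wb) ^ b * (2 * n2)"
proof (rule prod_le_one_exception[where Q = "\<lambda>j. t j > T"])
  fix i j assume ij: "i < b" "j < b" "t i > T" "t j > T"
  show "i = j"
  proof (rule ccontr)
    assume "i \<noteq> j"
    hence "t i + t j = sum t {i, j}" by simp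
    also have "\<dots> \<le> sum t {..<b}" by (rule sum_mono2) (use ij in auto)
    finally show False using ij assms DT by simp
  qed
qed (use card_ZS pos in auto)

lemma finite_GS: "finite GS" and card_GS: "card GS \<le> b * ((gx + 1) * Gt ^ b)"
proof -
  have f: "finite (PiE {..<b} (\<lambda>j. if j = i then Some ` {..gx} else Some ` Typ j))" for i
    by (rule finite_PiE) (use Typ in auto)
  show "finite GS" unfolding GS_def using f by simp
  have "card (PiE {..<b} (\<lambda>j. if j = i then Some ` {..gx} else Some ` Typ j)) \<le> (gx + 1) * Gt ^ b" for i
  proof -
    have "card (PiE {..<b} (\<lambda>j. if j = i then Some ` {..gx} else Some ` Typ j)) = (\<Prod>j<b. card (if j = i then Some ` {..gx} else Some ` Typ j))"
      by (rule card_PiE) simp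
    also have "\<dots> \<le> Gt ^ b * (gx + 1)"
      by (rule prod_le_one_exception[where Q = "\<lambda>j. j = i"]) (use Typ pos in \<open>auto simp: card_image\<close>)
    finally show ?thesis by (simp add: mult.commute)
  qed
  hence "(\<Sum>i<b. card (PiE {..<b} (\<lambda>j. if j = i then Some ` {..gx} else Some ` Typ j))) \<le> (\<Sum>i<b. (gx + 1) * Gt ^ b)"
    by (intro sum_mono)
  thus "card GS \<le> b * ((gx + 1) * Gt ^ b)" unfolding GS_def
    by (intro order.trans[OF card_UN_le]) auto
qed

lemma amb_in:
  assumes A: "A \<in> arrays (off b) l \<rho>" "\<not> clean A" "\<not> card (E A) > 1"
  shows "header A \<in> (\<Union>t\<in>TD. AS \<rho> t)"
proof -
  have lA: "length A = off b" and Rb: "R b A = \<rho>" using A by (auto simp: arrays_def R_def P_def)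
  define t where "t = restrict (tv A) {..<b}"
  have tj: "t j = tv A j" if "j < b" for j using that by (simp add: t_def)
  have nem: "\<not> em A" using A by (simp add: em_def)
  hence k'A: "k' A j = kk j A" and gsA: "gs A j = Some (g j A)" for j by (auto simp: k'_def gs_def)
  note amb = tv_amb[OF A(2,3)]
  have st: "sum t {..<b} = D" using amb(2) tj by (metis (mono_tags, lifting) lessThan_iff sum.cong)
  have "t j \<le> D" if "j < b" for j using member_le_sum[of j "{..<b}" t] that st by simp
  hence tTD: "t \<in> TD" unfolding TD_def using st by (auto simp: t_def)
  have rj: "r (tv A) j = r t j" if "j < b" for j by (rule r_cong[OF tj[symmetric] that])
  define X where "X = restrict (\<lambda>j. R j A div 2 ^ (l - r (tv A) j)) {..<b}"
  define Z where "Z = restrict (\<lambda>j. k' A j div 2 ^ (\<kappa> - tv A j)) {..<b}"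
  define G where "G = restrict (gs A) {..<b}"
  define e where "e = take (hdr_len (tv A)) (lowsA A)"
  have XX: "X \<in> XS t" unfolding X_def using X_in[of A "tv A"] XS_cong[of t "tv A"] tj by simp
  have ZZ: "Z \<in> PiE {..<b} (ZS \<rho> t X)"
  proof (rule PiE_I)
    fix j assume "j \<in> {..<b}"
    hence j: "j < b" by simp
    have tk: "t j \<le> \<kappa>" using tv_bounds(1)[OF lA j] tj[OF j] by simp
    show "Z j \<in> ZS \<rho> t X j"
    proof (cases "t j = 0")
      case True
      have "kk j A < 2 ^ \<kappa>" using kk_less[OF lA j] K_le by simp
      thus ?thesis using True j tj[OF j] by (simp add: ZS_def Z_def k'A)
    next
      case False
      let ?s = "t j - 1"
      have "?s < \<tau>A A j" using False amb(1) j tj[OF j] by (metis Suc_diff_1 Suc_le_lessD neq0_conv)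
      hence nd: "\<not> dt j ?s (R j A) (R (Suc j) A) (kk j A)" unfolding \<tau>A_def \<tau>_def by (rule not_less_Least)
      have "\<kappa> - ?s = Suc (\<kappa> - t j)" using False tk by simp
      hence z: "Z j div 2 = kk j A div 2 ^ (\<kappa> - ?s)" using j tj[OF j] by (simp add: Z_def k'A power_Suc2 div_mult2_eq del: power_Suc)
      have x1: "xc t X j = R j A div 2 ^ (l - ?s)"
      proof (cases "j = 0")
        case True thus ?thesis by (simp add: xc_def R0)
      next
        case False
        hence "?s \<le> r t j" by (simp add: r_def)
        from div_coarse[OF this, of "R j A" l] show ?thesis using False j rj[OF j] by (simp add: xc_def X_def)
      qed
      have x2: "xd \<rho> t X j = R (Suc j) A div 2 ^ (l - ?s)"
      proof (cases "Suc j < b")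
        case True
        have "?s \<le> r t (Suc j)" by (simp add: r_def)
        from div_coarse[OF this, of "R (Suc j) A" l] show ?thesis using True rj[OF True] by (simp add: xd_def X_def)
      next
        case False
        hence "Suc j = b" using j by simp
        thus ?thesis using False Rb by (simp add: xd_def)
      qed
      have "Z j div 2 \<in> undetermined (N j) l \<kappa> K (gm j) ?s (xc t X j) (xd \<rho> t X j)"
        unfolding undetermined_def x1 x2 z using nd kk_less[OF lA j] by (auto simp: dt_def)
      thus ?thesis using False by (simp add: ZS_def)
    qed
  qed (simp add: Z_def)
  have GG: "G \<in> GS"
  proof -
    obtain i where i: "i < b" "E A \<subseteq> {i}"
    proof (cases "E A = {}")
      case True thus ?thesis using that[of 0] b0 by simp
    next
      case False
      then obtain i where iE: "i \<in> E A" by blast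
      have fE: "finite (E A)" by (simp add: E_def)
      have "E A \<subseteq> {i}"
      proof
        fix j assume "j \<in> E A"
        thus "j \<in> {i}" using A(3) iE fE by (metis One_nat_def card_le_Suc0_iff_eq not_less singletonI)
      qed
      moreover have "i < b" using iE by (simp add: E_def)
      ultimately show ?thesis using that by blast
    qed
    have "G \<in> PiE {..<b} (\<lambda>j. if j = i then Some ` {..gx} else Some ` Typ j)"
    proof (rule PiE_I)
      fix j assume "j \<in> {..<b}"
      hence j: "j < b" by simp
      show "G j \<in> (if j = i then Some ` {..gx} else Some ` Typ j)"
      proof (cases "j = i")
        case True thus ?thesis using j g_le[OF lA j] by (simp add: G_def gsA)
      next
        case False
        hence "j \<notin> E A" using i(2) by blast
        thus ?thesis using j False by (simp add: G_def gsA E_def)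
      qed
    qed (simp add: G_def)
    thus ?thesis using i(1) unfolding GS_def by blast
  qed
  have PB: "(\<Sum>j<b. the (G j)) * 2 ^ l + \<rho> = P b A"
  proof -
    have "(\<Sum>j<b. the (G j)) = (\<Sum>j\<in>{0..<b}. g j A)" by (rule sum.cong) (auto simp: G_def gsA)
    thus ?thesis using P_sum[OF lA, of 0 b] Rb by (simp add: P0)
  qed
  have ee: "length e = hdr_len t"
  proof -
    have "hdr_len t = hdr_len (tv A)" by (rule cc_cong[OF tj])
    thus ?thesis using M'_le(2)[OF tv_bounds(2)[OF lA]] by (simp add: e_def length_lowsA[OF lA])
  qed
  have "header A = (t, X, Z, G, (\<Sum>j<b. the (G j)) * 2 ^ l + \<rho>, e)"
    unfolding PB by (simp add: header_def t_def X_def Z_def G_def e_def)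
  also have "\<dots> \<in> AS \<rho> t"
    unfolding AS_def by (rule image_eqI[of _ _ "((X, Z), G, e)"]) (use XX ZZ GG ee in auto)
  finally show ?thesis using tTD by blast
qed

text \<open>Of the \<open>2 ^ D\<close> values of the leading child header bits only the candidates
  in \<open>ZS\<close> occur, which saves \<open>2 ^ D\<close> up to the factors for
  \<open>t\<close>, the candidates and the carries. The total number of ones costs nothing, because
  the carries and \<open>\<rho>\<close> give it.\<close>

lemma card_amb:
  "card (header ` {A \<in> arrays (off b) l \<rho>. \<not> clean A \<and> \<not> card (E A) > 1}) * 2 ^ D * 2 ^ M'
     \<le> (D + 1) ^ b * ((2 * Wb) ^ b * (2 * n2) * (b * ((gx + 1) * Gt ^ b))) * 2 ^ V"
proof -
  let ?H = "header ` {A \<in> arrays (off b) l \<rho>. \<not> clean A \<and> \<not> card (E A) > 1}"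
  let ?c = "(2 * Wb) ^ b * (2 * n2) * (b * ((gx + 1) * Gt ^ b))"
  have finTD: "finite TD" unfolding TD_def by (rule finite_subset[of _ "PiE {..<b} (\<lambda>_. {..D})"]) (auto intro: finite_PiE)
  have cTD: "card TD \<le> (D + 1) ^ b"
  proof -
    have "card TD \<le> card (PiE {..<b} (\<lambda>_. {..D}))" unfolding TD_def by (rule card_mono) (auto intro: finite_PiE)
    thus ?thesis by (simp add: card_PiE)
  qed
  have AS: "finite (AS \<rho> t) \<and> card (AS \<rho> t) * 2 ^ D * 2 ^ M' \<le> ?c * 2 ^ V" if t: "t \<in> TD" for t
  proof -
    have st: "sum t {..<b} = D" and tD: "\<And>j. j < b \<Longrightarrow> t j \<le> D" using t by (auto simp: TD_def)
    have finZ: "finite (PiE {..<b} (ZS \<rho> t X))" for X by (rule finite_PiE) (auto intro: finite_ZS)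
    have finS: "finite (SIGMA X:XS t. PiE {..<b} (ZS \<rho> t X))" using finite_XS finZ by auto
    have fin: "finite ((SIGMA X:XS t. PiE {..<b} (ZS \<rho> t X)) \<times> GS \<times> {e :: bool list. length e = hdr_len t})"
      using finS finite_GS finite_lists by auto
    have "card (SIGMA X:XS t. PiE {..<b} (ZS \<rho> t X)) = (\<Sum>X\<in>XS t. card (PiE {..<b} (ZS \<rho> t X)))"
      by (rule card_SigmaI) (auto simp: finite_XS finZ)
    also have "\<dots> \<le> (\<Sum>X\<in>XS t. (2 * Wb) ^ b * (2 * n2))"
      by (rule sum_mono) (use prod_ZS[OF st] in \<open>simp add: card_PiE\<close>)
    finally have c1: "card (SIGMA X:XS t. PiE {..<b} (ZS \<rho> t X)) \<le> card (XS t) * ((2 * Wb) ^ b * (2 * n2))" by simp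
    have "card (AS \<rho> t) \<le> card ((SIGMA X:XS t. PiE {..<b} (ZS \<rho> t X)) \<times> GS \<times> {e :: bool list. length e = hdr_len t})"
      unfolding AS_def by (rule card_image_le[OF fin])
    also have "\<dots> = card (SIGMA X:XS t. PiE {..<b} (ZS \<rho> t X)) * (card GS * 2 ^ hdr_len t)"
      by (simp add: card_cartesian_product card_lists)
    also have "\<dots> \<le> card (XS t) * ((2 * Wb) ^ b * (2 * n2)) * (b * ((gx + 1) * Gt ^ b) * 2 ^ hdr_len t)"
      by (rule mult_mono[OF c1 mult_right_mono[OF card_GS]]) auto
    finally have "card (AS \<rho> t) * (2 ^ D * 2 ^ M') \<le> card (XS t) * ((2 * Wb) ^ b * (2 * n2)) * (b * ((gx + 1) * Gt ^ b) * 2 ^ hdr_len t) * (2 ^ D * 2 ^ M')"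
      by (rule mult_right_mono) simp
    also have "\<dots> = ?c * (card (XS t) * 2 ^ hdr_len t * 2 ^ D * 2 ^ M')" by (simp only: ac_simps)
    also have "card (XS t) * 2 ^ hdr_len t * 2 ^ D * 2 ^ M' = 2 ^ V"
      using card_XS[of t] st tD DT by (metis le_add1 order.trans)
    finally show ?thesis using fin by (simp add: AS_def mult.assoc)
  qed
  have "?H \<subseteq> (\<Union>t\<in>TD. AS \<rho> t)" using amb_in by auto
  hence "card ?H \<le> card (\<Union>t\<in>TD. AS \<rho> t)" by (rule card_mono[rotated]) (use AS finTD in auto)
  also have "\<dots> \<le> (\<Sum>t\<in>TD. card (AS \<rho> t))" by (rule card_UN_le[OF finTD])
  finally have "card ?H * (2 ^ D * 2 ^ M') \<le> (\<Sum>t\<in>TD. card (AS \<rho> t)) * (2 ^ D * 2 ^ M')" by (rule mult_right_mono) simp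
  also have "\<dots> = (\<Sum>t\<in>TD. card (AS \<rho> t) * 2 ^ D * 2 ^ M')" by (simp add: sum_distrib_right mult.assoc)
  also have "\<dots> \<le> (\<Sum>t\<in>TD. ?c * 2 ^ V)" by (rule sum_mono) (use AS in blast)
  also have "\<dots> = card TD * (?c * 2 ^ V)" by simp
  also have "\<dots> \<le> (D + 1) ^ b * (?c * 2 ^ V)" by (rule mult_right_mono[OF cTD]) simp
  finally show ?thesis by (simp only: mult.assoc)
qed

section \<open>Headers of arrays that are not clean, with several atypical carries\<close>

definition EG where "EG = PiE {..<b} (\<lambda>j. insert None (Some ` Typ j))"
definition ES where "ES i j = (\<lambda>(X, G, PB, e). (restrict (ttE i j) {..<b}, X, restrict (\<lambda>_. 0 :: nat) {..<b}, G, PB, e)) `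
   (XS (ttE i j) \<times> EG \<times> {..<(2::nat) ^ wP} \<times> {e :: bool list. length e = hdr_len (ttE i j)})"

lemma esc_in:
  assumes A: "A \<in> arrays (off b) l \<rho>" "\<not> clean A" "card (E A) > 1"
  shows "header A \<in> (\<Union>(i, j)\<in>{(i, j). i < b \<and> j < b \<and> i \<noteq> j}. ES i j)"
proof -
  have lA: "length A = off b" using A by (auto simp: arrays_def)
  have em: "em A" using A by (simp add: em_def)
  define i j where "i = fst (jj A)" and "j = snd (jj A)"
  have ij: "i \<in> E A" "j \<in> E A" "i \<noteq> j" using jj[OF A(3)] by (auto simp: i_def j_def)
  hence ijb: "i < b" "j < b" by (auto simp: E_def)
  have tv: "tv A = ttE i j" using A by (simp add: tv_def i_def j_def)
  have Z: "restrict (\<lambda>m. k' A m div 2 ^ (\<kappa> - tv A m)) {..<b} = restrict (\<lambda>_. 0) {..<b}"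
  proof (rule restrict_ext)
    fix m assume "m \<in> {..<b}"
    hence m: "m < b" by simp
    show "k' A m div 2 ^ (\<kappa> - tv A m) = 0"
    proof (cases "m = i \<or> m = j")
      case True
      hence "m \<in> E A" using ij by blast
      hence "k' A m < 2 ^ (\<kappa> - TE)" using code_less[OF lA] em by (simp add: k'_def)
      thus ?thesis using True by (auto simp: tv ttE_def)
    next
      case False
      thus ?thesis using k'_less[OF lA m] by (simp add: tv ttE_def)
    qed
  qed
  have G: "restrict (gs A) {..<b} \<in> EG"
    unfolding EG_def by (rule restrict_PiE_iff[THEN iffD2]) (auto simp: gs_def E_def em)
  have e: "length (take (hdr_len (tv A)) (lowsA A)) = hdr_len (ttE i j)"
    using M'_le(2)[OF tv_bounds(2)[OF lA]] by (simp add: length_lowsA[OF lA] tv)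
  have "header A = (restrict (ttE i j) {..<b}, restrict (\<lambda>m. R m A div 2 ^ (l - r (ttE i j) m)) {..<b}, restrict (\<lambda>_. 0) {..<b},
      restrict (gs A) {..<b}, P b A, take (hdr_len (tv A)) (lowsA A))"
    unfolding header_def Z tv[symmetric] by (rule refl)
  also have "\<dots> \<in> ES i j" unfolding ES_def
    by (rule image_eqI[of _ _ "(restrict (\<lambda>m. R m A div 2 ^ (l - r (ttE i j) m)) {..<b}, restrict (gs A) {..<b}, P b A, take (hdr_len (tv A)) (lowsA A))"])
      (use G e X_in P_le[OF lA, of b] in auto)
  finally show ?thesis using ijb ij(3) by blast
qed

text \<open>Two atypical blocks have codes below \<open>2 ^ (\<kappa> - TE)\<close>, so
  \<open>2 * TE\<close> leading bits are zero and are saved. This pays for the total number of ones,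
  which a list of carries with \<open>None\<close> entries does not determine; hence the factor
  \<open>2 ^ wP\<close>.\<close>

lemma card_esc:
  "card (header ` {A \<in> arrays (off b) l \<rho>. \<not> clean A \<and> card (E A) > 1}) * 2 ^ (2 * TE) * 2 ^ M'
     \<le> b * b * ((Gt + 1) ^ b * 2 ^ wP) * 2 ^ V"
proof -
  let ?H = "header ` {A \<in> arrays (off b) l \<rho>. \<not> clean A \<and> card (E A) > 1}"
  let ?I = "{(i, j). i < b \<and> j < b \<and> i \<noteq> j}"
  have Isub: "?I \<subseteq> {..<b} \<times> {..<b}" by auto
  have finI: "finite ?I" by (rule finite_subset[OF Isub]) simp
  have cI: "card ?I \<le> b * b" using card_mono[OF _ Isub] by simp
  have finEG: "finite EG" unfolding EG_def by (rule finite_PiE) (use Typ in auto)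
  have cEG: "card EG \<le> (Gt + 1) ^ b"
  proof -
    have "card EG = (\<Prod>j<b. card (insert None (Some ` Typ j)))" unfolding EG_def by (rule card_PiE) simp
    also have "\<dots> \<le> (\<Prod>j<b. Gt + 1)"
    proof (rule prod_mono)
      fix j assume "j \<in> {..<b}"
      hence "finite (Typ j)" "card (Typ j) \<le> Gt" using Typ by auto
      thus "0 \<le> card (insert None (Some ` Typ j)) \<and> card (insert None (Some ` Typ j)) \<le> Gt + 1"
        by (simp add: card_insert_if card_image)
    qed
    finally show ?thesis by simp
  qed
  have ES: "finite (ES i j) \<and> card (ES i j) * 2 ^ (2 * TE) * 2 ^ M' \<le> (Gt + 1) ^ b * 2 ^ wP * 2 ^ V" if ij: "i < b" "j < b" "i \<noteq> j" for i j
  proof -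
    let ?t = "ttE i j"
    have fin: "finite (XS ?t \<times> EG \<times> {..<(2::nat) ^ wP} \<times> {e :: bool list. length e = hdr_len ?t})"
      using finite_XS finEG finite_lists by auto
    have st: "sum ?t {..<b} = 2 * TE" by (rule sum_ttE[OF ij])
    have "card (ES i j) \<le> card (XS ?t \<times> EG \<times> {..<(2::nat) ^ wP} \<times> {e :: bool list. length e = hdr_len ?t})"
      unfolding ES_def by (rule card_image_le[OF fin])
    also have "\<dots> = card (XS ?t) * (card EG * (2 ^ wP * 2 ^ hdr_len ?t))" by (simp add: card_cartesian_product card_lists)
    also have "\<dots> \<le> card (XS ?t) * ((Gt + 1) ^ b * (2 ^ wP * 2 ^ hdr_len ?t))"
      by (rule mult_left_mono[OF mult_right_mono[OF cEG]]) auto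
    finally have "card (ES i j) * (2 ^ (2 * TE) * 2 ^ M') \<le> card (XS ?t) * ((Gt + 1) ^ b * (2 ^ wP * 2 ^ hdr_len ?t)) * (2 ^ (2 * TE) * 2 ^ M')"
      by (rule mult_right_mono) simp
    also have "\<dots> = (Gt + 1) ^ b * 2 ^ wP * (card (XS ?t) * 2 ^ hdr_len ?t * 2 ^ (2 * TE) * 2 ^ M')" by (simp only: ac_simps)
    also have "card (XS ?t) * 2 ^ hdr_len ?t * 2 ^ (2 * TE) * 2 ^ M' = 2 ^ V"
      using card_XS[of ?t] st DT by (simp add: ttE_def)
    finally show ?thesis using fin by (simp add: ES_def mult.assoc)
  qed
  have "?H \<subseteq> (\<Union>(i, j)\<in>?I. ES i j)" using esc_in by auto
  hence "card ?H \<le> card (\<Union>(i, j)\<in>?I. ES i j)" by (rule card_mono[rotated]) (use ES finI in auto)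
  also have "\<dots> \<le> (\<Sum>(i, j)\<in>?I. card (ES i j))" using card_UN_le[OF finI, of "\<lambda>(i, j). ES i j"] by (simp add: case_prod_beta)
  finally have "card ?H * (2 ^ (2 * TE) * 2 ^ M') \<le> (\<Sum>(i, j)\<in>?I. card (ES i j)) * (2 ^ (2 * TE) * 2 ^ M')" by (rule mult_right_mono) simp
  also have "\<dots> = (\<Sum>(i, j)\<in>?I. card (ES i j) * 2 ^ (2 * TE) * 2 ^ M')" by (simp add: sum_distrib_right mult.assoc case_prod_beta)
  also have "\<dots> \<le> (\<Sum>_\<in>?I. (Gt + 1) ^ b * 2 ^ wP * 2 ^ V)" by (rule sum_mono) (use ES in auto)
  also have "\<dots> = card ?I * ((Gt + 1) ^ b * 2 ^ wP * 2 ^ V)" by simp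
  also have "\<dots> \<le> b * b * ((Gt + 1) ^ b * 2 ^ wP * 2 ^ V)" by (rule mult_right_mono[OF cI]) simp
  finally show ?thesis by (simp only: mult.assoc)
qed

theorem prerep_node:
  fixes K' :: nat
  assumes "2 ^ (l * (b - 1)) * real K ^ b * 2 ^ sum M {..<b}
     + 2 ^ V * (real ((D + 1) ^ b * ((2 * Wb) ^ b * (2 * n2) * (b * ((gx + 1) * Gt ^ b)))) / 2 ^ D
       + real (b * b * ((Gt + 1) ^ b * 2 ^ wP)) / 2 ^ (2 * TE)) \<le> real K' * 2 ^ M'"
  shows "prerep W (off b) l M' K' (p + 3) header memory"
proof (rule prerepI[OF query])
  fix \<rho>
  let ?H1 = "header ` {A \<in> arrays (off b) l \<rho>. clean A}"
  let ?H2 = "header ` {A \<in> arrays (off b) l \<rho>. \<not> clean A \<and> \<not> card (E A) > 1}"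
  let ?H3 = "header ` {A \<in> arrays (off b) l \<rho>. \<not> clean A \<and> card (E A) > 1}"
  let ?c2 = "(D + 1) ^ b * ((2 * Wb) ^ b * (2 * n2) * (b * ((gx + 1) * Gt ^ b)))"
  let ?c3 = "b * b * ((Gt + 1) ^ b * 2 ^ wP)"
  have "header ` arrays (off b) l \<rho> = ?H1 \<union> ?H2 \<union> ?H3" by blast
  hence "card (header ` arrays (off b) l \<rho>) \<le> card ?H1 + card ?H2 + card ?H3"
    using card_Un_le[of "?H1 \<union> ?H2" ?H3] card_Un_le[of ?H1 ?H2] by simp
  hence "real (card (header ` arrays (off b) l \<rho>)) \<le> real (card ?H1 + card ?H2 + card ?H3)" by (simp only: of_nat_le_iff)
  hence "real (card (header ` arrays (off b) l \<rho>)) * 2 ^ M' \<le> (real (card ?H1) + real (card ?H2) + real (card ?H3)) * 2 ^ M'"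
    by (intro mult_right_mono) auto
  also have "\<dots> = real (card ?H1) * 2 ^ M' + real (card ?H2) * 2 ^ M' + real (card ?H3) * 2 ^ M'" by (simp only: distrib_right)
  also have "\<dots> \<le> 2 ^ (l * (b - 1)) * real K ^ b * 2 ^ sum M {..<b} + 2 ^ V * (real ?c2 / 2 ^ D) + 2 ^ V * (real ?c3 / 2 ^ (2 * TE))"
  proof (intro add_mono)
    have "real (card ?H1 * 2 ^ M') \<le> real ((2 ^ l) ^ (b - 1) * K ^ b * 2 ^ sum M {..<b})" using card_clean by (simp only: of_nat_le_iff)
    thus "real (card ?H1) * 2 ^ M' \<le> 2 ^ (l * (b - 1)) * real K ^ b * 2 ^ sum M {..<b}" by (simp add: power_mult)
    have "real (card ?H2 * 2 ^ D * 2 ^ M') \<le> real (?c2 * 2 ^ V)" using card_amb by (simp only: of_nat_le_iff)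
    hence "real (card ?H2) * 2 ^ M' * 2 ^ D \<le> 2 ^ V * real ?c2" by (simp only: of_nat_mult of_nat_power of_nat_numeral ac_simps)
    thus "real (card ?H2) * 2 ^ M' \<le> 2 ^ V * (real ?c2 / 2 ^ D)" by (simp only: times_divide_eq_right) (rule mult_imp_le_div_pos; simp)
    have "real (card ?H3 * 2 ^ (2 * TE) * 2 ^ M') \<le> real (?c3 * 2 ^ V)" using card_esc by (simp only: of_nat_le_iff)
    hence "real (card ?H3) * 2 ^ M' * 2 ^ (2 * TE) \<le> 2 ^ V * real ?c3" by (simp only: of_nat_mult of_nat_power of_nat_numeral ac_simps)
    thus "real (card ?H3) * 2 ^ M' \<le> 2 ^ V * (real ?c3 / 2 ^ (2 * TE))" by (simp only: times_divide_eq_right) (rule mult_imp_le_div_pos; simp)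
  qed
  also have "\<dots> \<le> real K' * 2 ^ M'" using assms by (simp only: distrib_left add.assoc)
  finally show "card (header ` arrays (off b) l \<rho>) \<le> K'" by simp
next
  fix \<rho> A A' assume "A \<in> arrays (off b) l \<rho>" "A' \<in> arrays (off b) l \<rho>" "header A = header A'"
  thus "ones A = ones A'" by (intro header_det) (auto simp: arrays_def)
qed

end

subsection \<open>Choice of parameters and recursion\<close>

lemma query_ok_mono:
  assumes "query_ok W s l M p hdr mem" "p \<le> q"
  shows "query_ok W s l M q hdr mem"
  unfolding query_ok_def
proof (intro conjI allI)
  fix A show "length A = s \<longrightarrow> length (mem A) = M" by (rule assms(1)[unfolded query_ok_def, THEN conjunct1, THEN spec])
next
  fix \<rho> h a u
  obtain g where g: "reads W p g" "\<forall>A\<in>arrays s l \<rho>. \<forall>m. hdr A = h \<longrightarrow> u \<le> s \<longrightarrow> take M (drop a m) = mem A \<longrightarrow> g m = ones (take u A)"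
    using assms(1)[unfolded query_ok_def, THEN conjunct2, rule_format, of \<rho> h u a] by (elim exE conjE)
  show "\<exists>g. reads W q g \<and> (\<forall>A\<in>arrays s l \<rho>. \<forall>m. hdr A = h \<longrightarrow> u \<le> s \<longrightarrow> take M (drop a m) = mem A \<longrightarrow> g m = ones (take u A))"
    by (rule exI[of _ g], rule conjI[OF reads_mono[OF g(1) assms(2)] g(2)])
qed

lemma prerep_mono:
  assumes "prerep W s l M K p hdr mem" "K \<le> K'"
  shows "prerep W s l M K' p hdr mem"
  by (rule prerepI[OF prerepD(1)[OF assms(1)] order.trans[OF prerepD(2)[OF assms(1)] assms(2)] prerepD(3)[OF assms(1)]])

lemma rep_mono:
  assumes "rep W s l M K p hdr mem N" "p \<le> q"
  shows "rep W s l M K q hdr mem N"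
  using assms(1) unfolding rep_def
  by (elim conjE) (intro conjI, erule query_ok_mono[OF _ assms(2)], assumption+)

text \<open>One half of the string smooths \<open>stp L\<close> to size
  \<open>O(2 ^ s2 / L)\<close>; a derivative against the other half gains the second factor
  \<open>1 / L\<close>.\<close>

lemma stp_lipschitz:
  assumes "16 * L^2 \<le> s div 2" "L > 0"
  shows "\<bar>bop s (stp L) (v + 1) - bop s (stp L) v\<bar> \<le> 2 ^ s / (real L * real L)"
proof -
  define s1 s2 where "s1 = s div 2" and "s2 = s - s div 2"
  have s: "s = s1 + s2" and h: "16 * L^2 \<le> s1" "16 * L^2 \<le> s2" using assms by (auto simp: s1_def s2_def)
  have b: "\<bar>bop s2 (stp L) x\<bar> \<le> 2 * 2 ^ s2 / real L" for x
  proof -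
    have "bop s2 (stp L) x \<le> bop s2 (res L) x" by (rule bop_mono) (simp add: stp_def res_def)
    moreover have "bop s2 (stp L) x \<ge> bop s2 (\<lambda>_. 0) x" by (rule bop_mono) (simp add: stp_def)
    moreover have "bop s2 (res L) x \<le> 2 ^ s2 / real L + 2 ^ s2 / (2 * real L)" using bop_res_half[OF h(2) assms(2), of x] by linarith
    moreover have "2 ^ s2 / (2 * real L) \<le> 2 ^ s2 / real L" using assms(2) by (intro divide_left_mono) auto
    ultimately show ?thesis by (simp add: bop_const)
  qed
  have "\<bar>bop s1 (bop s2 (stp L)) (v + 1) - bop s1 (bop s2 (stp L)) v\<bar> \<le> 2 ^ s1 * (2 * 2 ^ s2 / real L) / (2 * real L)"
    by (rule bop_step[OF b h(1) assms(2)])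
  thus ?thesis by (simp add: s bop_add power_add)
qed

text \<open>\<open>2 ^ \<beta>\<close> is the maximal branching number, about the fourth root of
  \<open>w\<close>; \<open>2 ^ a0\<close> is the size of the smallest blocks, which fit in O(1)
  words.\<close>

locale params =
  fixes w \<beta> a0 :: nat
  assumes w\<beta>: "2 ^ (4 * \<beta>) \<le> w" "w < 2 ^ (4 * \<beta> + 4)" and \<beta>: "\<beta> \<ge> 3"
    and a0: "400 * w \<le> 2 ^ a0" "2 ^ a0 \<le> 800 * w"
begin

text \<open>\<open>\<kappa>\<close> must exceed the up to
  \<open>3 * (D + 2 * TE) \<le> 84 * w\<close> leading bits of a node. \<open>D\<close> turns
  counting factors up to \<open>2 ^ (2 * w)\<close> into errors \<open>2 ^ (- 10 * w)\<close>.
  \<open>T\<close> lies above \<open>D / 2\<close> and below the precision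
  \<open>9 * w - 5 * a\<close> of \<open>Kv\<close>, where \<open>a \<le> w div 7\<close>.\<close>

definition \<kappa> where "\<kappa> = 100 * w"
definition T where "T = 8 * w"
definition D where "D = 12 * w"
definition wP where "wP = w div 7 + 2"
text \<open>Chosen so that \<open>2 ^ (\<kappa> + 1 - T)\<close> atypical child headers, each paired
  with a prefix sum of \<open>wP\<close> bits, fit into \<open>2 ^ (\<kappa> - TE)\<close>
  codes.\<close>

definition TE where "TE = T - 1 - wP"
text \<open>A window of \<open>Y0\<close> carries is \<open>\<Lambda> = 5 * w\<close> times the
  deviation scale \<open>2 ^ lv a * 2 ^ a0\<close>, which makes the tails
  \<open>O(2 ^ (- 10 * w))\<close>.\<close>

definition Y0 where "Y0 = 5 * w * 2 ^ a0"
text \<open>A base block has at most \<open>2 ^ (a0 + 1) \<le> 1600 * w\<close> bits and is read at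
  once.\<close>

definition W where "W = 1600 * w"
definition lv where "lv a = (a - a0) div 2"
text \<open>The relative excess \<open>2 ^ (5 * a - 9 * w)\<close> of \<open>Kv a\<close> over \<open>2 ^ (\<kappa> - 1)\<close> bounds the redundancy at scale \<open>2 ^ a\<close>;
  combining \<open>b\<close> blocks multiplies it by at most \<open>b ^ 5\<close>.\<close>

definition Kv :: "nat \<Rightarrow> nat" where "Kv a = 2 ^ (\<kappa> - 1) + 2 ^ (\<kappa> - 1 + 5 * a - 9 * w)"
definition Mv where "Mv s a = s + 1 - \<kappa> - lv a"

lemma w_large: "w \<ge> 4096"
proof -
  have "(2::nat) ^ 12 \<le> 2 ^ (4 * \<beta>)" by (rule power_increasing) (use \<beta> in auto)
  thus ?thesis using w\<beta>(1) by simp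
qed

text \<open>The lower bound on \<open>s\<close> provides \<open>10 * w\<close> pieces of length
  \<open>16 * L^2\<close> for equidistribution with \<open>L = 2 ^ lv a\<close>; the upper bound is
  the hypothesis of the tail bounds with \<sigma> equal to \<open>2 ^ lv a * 2 ^ a0\<close>.\<close>

lemma size_bounds:
  assumes "a0 \<le> a" "a \<le> w div 7" "2 ^ a \<le> s" "s \<le> 2 ^ (a + 1)"
  shows "400 * w * 4 ^ lv a \<le> s" "s \<le> (2 ^ lv a * 2 ^ a0)^2" "lv a \<le> a" "lv a + \<kappa> \<le> s" "s + 1 = Mv s a + \<kappa> + lv a" "7 * lv a \<le> w"
proof -
  have "400 * w * 4 ^ lv a \<le> 2 ^ a0 * 2 ^ (2 * lv a)" using a0(1) by (simp add: power_mult)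
  also have "\<dots> = 2 ^ (a0 + 2 * lv a)" by (simp add: power_add)
  also have "\<dots> \<le> 2 ^ a" by (rule power_increasing) (use assms(1) in \<open>auto simp: lv_def\<close>)
  finally show 1: "400 * w * 4 ^ lv a \<le> s" using assms(3) by simp
  have "a + 1 \<le> 2 * a0 + 2 * lv a"
  proof -
    have "(2::nat) ^ 2 \<le> 2 ^ a0" using a0(1) w_large by simp
    hence "2 \<le> a0" by (rule power_le_imp_le_exp[rotated]) simp
    thus ?thesis using assms(1) by (simp add: lv_def)
  qed
  hence "(2::nat) ^ (a + 1) \<le> 2 ^ (2 * a0 + 2 * lv a)" by (intro power_increasing) auto
  also have "\<dots> = (2 ^ lv a * 2 ^ a0)^2" by (simp add: power2_eq_square mult_2 power_add)
  finally show "s \<le> (2 ^ lv a * 2 ^ a0)^2" using assms(4) by simp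
  show l: "lv a \<le> a" by (simp add: lv_def)
  show l7: "7 * lv a \<le> w" using l assms(2) by simp
  have "400 * w \<le> s" by (rule order.trans[OF _ 1]) simp
  thus 2: "lv a + \<kappa> \<le> s" using l7 by (simp add: \<kappa>_def)
  thus "s + 1 = Mv s a + \<kappa> + lv a" by (simp add: Mv_def)
qed

lemma unif_any:
  assumes "a0 \<le> a" "a \<le> w div 7" "2 ^ a \<le> s" "s \<le> 2 ^ (a + 1)" "l \<le> lv a"
  shows "\<bar>bop s (res (2 ^ l)) v - 2 ^ s / 2 ^ l\<bar> \<le> 2 ^ s / 2 ^ (10 * w)"
proof -
  have "16 * (2 ^ l)^2 \<le> 16 * (4::nat) ^ l" by (simp add: power2_eq_square power_mult_distrib[symmetric])
  moreover have "10 * w * (16 * 4 ^ l) \<le> s"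
  proof -
    have "(4::nat) ^ l \<le> 4 ^ lv a" by (rule power_increasing[OF assms(5)]) simp
    hence "160 * w * 4 ^ l \<le> 400 * w * 4 ^ lv a" by (intro mult_mono) auto
    also have "\<dots> \<le> s" by (rule size_bounds(1)[OF assms(1-4)])
    finally show ?thesis by simp
  qed
  ultimately show ?thesis using bop_res_uniform[of "2 ^ l" "16 * 4 ^ l" "10 * w" s v] by simp
qed

lemma Kv_eq: "real (Kv a) = 2 ^ (\<kappa> - 1) * (1 + 2 ^ (5 * a) / 2 ^ (9 * w))"
proof -
  have "\<kappa> - 1 + 5 * a = (\<kappa> - 1 + 5 * a - 9 * w) + 9 * w" using w_large by (simp add: \<kappa>_def)
  hence "(2::real) ^ (\<kappa> - 1) * 2 ^ (5 * a) = 2 ^ (\<kappa> - 1 + 5 * a - 9 * w) * 2 ^ (9 * w)" by (metis power_add)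
  hence "(2::real) ^ (\<kappa> - 1) * (2 ^ (5 * a) / 2 ^ (9 * w)) = 2 ^ (\<kappa> - 1 + 5 * a - 9 * w)" by (simp add: field_simps)
  thus ?thesis by (simp add: Kv_def distrib_left)
qed

lemma child_ok:
  assumes a: "a0 \<le> a" "a \<le> w div 7" "2 ^ a \<le> s" "s \<le> 2 ^ (a + 1)"
    and "rep W s (lv a) (Mv s a) (Kv a) p hdr mem N"
  shows "child W s (lv a) (Mv s a) (Kv a) p hdr mem N \<kappa> T Y0"
proof
  note sb = size_bounds[OF a]
  have lw: "lv a + T + 2 \<le> 10 * w" using sb(6) w_large by (simp add: T_def)
  show "rep W s (lv a) (Mv s a) (Kv a) p hdr mem N" by fact
  show "s + 1 = Mv s a + \<kappa> + lv a" by fact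
  show "T + 4 \<le> \<kappa>" using w_large by (simp add: T_def \<kappa>_def)
  show "real (Kv a) \<le> 2 ^ (\<kappa> - 1) + 2 ^ (\<kappa> - 2 - T)"
  proof -
    have "\<kappa> - 1 + 5 * a - 9 * w \<le> \<kappa> - 2 - T" using a(2) w_large by (simp add: T_def \<kappa>_def)
    hence "(2::real) ^ (\<kappa> - 1 + 5 * a - 9 * w) \<le> 2 ^ (\<kappa> - 2 - T)" by (intro power_increasing) auto
    thus ?thesis by (simp add: Kv_def)
  qed
  have le: "2 ^ s / 2 ^ (10 * w) \<le> (2 ^ s / 2 ^ (lv a + T + 1) :: real)"
    using lw by (intro divide_left_mono power_increasing) auto
  show "\<bar>bop s (res (2 ^ lv a)) v - 2 ^ s / 2 ^ lv a\<bar> \<le> 2 ^ s / 2 ^ (lv a + T + 1)" for v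
    using unif_any[OF a order.refl, of v] le by linarith
  have "16 * (2 ^ lv a)^2 \<le> s div 2"
  proof -
    have "(2 ^ lv a)^2 = (4::nat) ^ lv a" by (simp add: power2_eq_square power_mult_distrib[symmetric])
    moreover have "32 * 4 ^ lv a \<le> s" by (rule order.trans[OF _ sb(1)]) (rule mult_right_mono, use w_large in auto)
    ultimately show ?thesis by (simp add: less_eq_div_iff_mult_less_eq)
  qed
  thus "\<bar>bop s (stp (2 ^ lv a)) (v + 1) - bop s (stp (2 ^ lv a)) v\<bar> \<le> 2 ^ s / 2 ^ (2 * lv a)" for v
    using stp_lipschitz[of "2 ^ lv a" s v] by (simp add: mult_2 power_add)
  have tl: "2 * 2 ^ s / 4 ^ (5 * w) \<le> (2 ^ s / 2 ^ (lv a + T + 1) :: real)"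
  proof -
    have "(4::real) ^ (5 * w) = 2 ^ (10 * w)" using power_mult[of "2::real" 2 "5 * w"] by simp
    moreover have "2 * (2::real) ^ (lv a + T + 1) \<le> 2 ^ (10 * w)"
      using power_increasing[of "lv a + T + 2" "10 * w" "2::real"] lw by simp
    ultimately show ?thesis by (simp add: field_simps)
  qed
  have Y: "5 * w * (2 ^ lv a * 2 ^ a0) = 2 ^ lv a * Y0" by (simp add: Y0_def)
  show "bop s (\<lambda>x. of_bool (0 < x)) v \<le> 2 ^ s / 2 ^ (lv a + T + 1)" if "2 * v + 2 * int (2 ^ lv a * Y0) \<le> int s" for v
    using bop_lower_tail[OF sb(2) _ that[folded Y]] tl by simp
  show "bop s (\<lambda>x. of_bool (x \<le> 0)) v \<le> 2 ^ s / 2 ^ (lv a + T + 1)" if "int s + 2 * int (2 ^ lv a * Y0) \<le> 2 * v" for v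
    using bop_upper_tail[OF sb(2) _ that[folded Y]] tl by simp
qed

lemma rep_base:
  assumes "2 ^ a0 \<le> s" "s \<le> 2 ^ (a0 + 1)" "a0 \<le> w div 7"
  shows "\<exists>hdr mem N. rep W s (lv a0) (Mv s a0) (Kv a0) 1 hdr mem N"
proof -
  have l0: "lv a0 = 0" by (simp add: lv_def)
  note sb = size_bounds[OF order.refl assms(3,1,2)]
  have M: "s + 1 = \<kappa> + Mv s a0" using sb(5) l0 by simp
  have MW: "Mv s a0 \<le> W"
  proof -
    have "s \<le> 2 * 2 ^ a0" using assms(2) by simp
    thus ?thesis using M a0 w_large by (simp add: W_def \<kappa>_def)
  qed
  have k0: "\<kappa> > 0" using w_large by (simp add: \<kappa>_def)
  from prerep_base[OF M MW k0] obtain hdr :: "bool list \<Rightarrow> nat \<times> nat" and mem where pr: "prerep W s 0 (Mv s a0) (2 ^ (\<kappa> - 1) + s + 1) 1 hdr mem" by blast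
  have "s + 1 \<le> 2 ^ (\<kappa> - 1 + 5 * a0 - 9 * w)"
  proof -
    have "s + 1 \<le> 2 * 2 ^ a0 + 1 * 2 ^ a0" by (rule add_mono) (use assms(2) in auto)
    also have "\<dots> \<le> 2 ^ (a0 + 2)" by simp
    also have "\<dots> \<le> 2 ^ (\<kappa> - 1 + 5 * a0 - 9 * w)" by (rule power_increasing) (use w_large in \<open>auto simp: \<kappa>_def\<close>)
    finally show ?thesis .
  qed
  hence "2 ^ (\<kappa> - 1) + s + 1 \<le> Kv a0" by (simp add: Kv_def)
  from prerep_imp_rep[OF prerep_mono[OF pr this]] show ?thesis by (auto simp: l0)
qed

lemma poly_bounds: "D + 1 \<le> w ^ 4" "2 * (10 * Y0 + 30) \<le> w ^ 4" "2 * Y0 + 4 \<le> w ^ 4"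
proof -
  have w2: "w ^ 4 = w * w * (w * w)" by (simp add: power4_eq_xxxx)
  have ww: "4096 * 4096 * (w * w) \<le> w ^ 4" unfolding w2 by (rule mult_right_mono[OF mult_mono]) (use w_large in auto)
  have w1: "w \<le> w * w" "1 \<le> w * w" using w_large by (simp_all add: Suc_le_eq)
  have "Y0 \<le> 5 * w * (800 * w)" unfolding Y0_def by (rule mult_left_mono[OF a0(2)]) simp
  hence Y: "Y0 \<le> 4000 * (w * w)" by simp
  show "D + 1 \<le> w ^ 4" using ww w1 unfolding D_def by linarith
  have "20 * Y0 + 60 \<le> w ^ 4" using ww w1 Y by linarith
  thus "2 * (10 * Y0 + 30) \<le> w ^ 4" by simp
  show "2 * Y0 + 4 \<le> w ^ 4" using ww w1 Y by linarith
qed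

text \<open>With \<open>B = 2 ^ \<beta> \<ge> 8\<close> the exponent is at most
  \<open>64 * B^2 \<le> B^4 \<le> w\<close>. This inequality is the origin of the fourth root in the
  choice of \<open>b\<close> and of \<open>\<beta> \<ge> 3\<close>.\<close>

lemma main_bound:
  assumes "b \<le> 2 ^ \<beta>" "b \<ge> 1"
  shows "((w ^ 4) ^ b) ^ 3 * (2 * (b * b) * 2 ^ b) \<le> 2 ^ w"
proof -
  let ?B = "2 ^ \<beta> :: nat"
  have B8: "8 \<le> ?B" using power_increasing[of 3 \<beta> "2::nat"] \<beta> by simp
  have \<beta>B: "\<beta> + 1 \<le> ?B" by (induction \<beta>) auto
  have "w ^ (12 * b) \<le> (2 ^ (4 * \<beta> + 4)) ^ (12 * b)" by (rule power_mono) (use w\<beta>(2) in auto)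
  hence 1: "((w ^ 4) ^ b) ^ 3 \<le> 2 ^ ((4 * \<beta> + 4) * (12 * b))" by (simp only: power_mult[symmetric]) (simp add: ac_simps)
  have 2: "2 * (b * b) * 2 ^ b \<le> 2 ^ (3 * b + 1)"
  proof -
    have "b \<le> 2 ^ b" by (rule less_imp_le[OF less_exp])
    hence "b * b \<le> 2 ^ b * 2 ^ b" by (intro mult_mono) auto
    hence "2 * (b * b) * 2 ^ b \<le> 2 * (2 ^ b * 2 ^ b) * 2 ^ b" by simp
    also have "\<dots> = 2 ^ (3 * b + 1)" by (simp add: power_add[symmetric])
    finally show ?thesis .
  qed
  have "((w ^ 4) ^ b) ^ 3 * (2 * (b * b) * 2 ^ b) \<le> 2 ^ ((4 * \<beta> + 4) * (12 * b)) * 2 ^ (3 * b + 1)"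
    by (rule mult_mono[OF 1 2]) auto
  also have "\<dots> = 2 ^ ((4 * \<beta> + 4) * (12 * b) + (3 * b + 1))" by (simp only: power_add)
  also have "\<dots> \<le> 2 ^ w"
  proof (rule power_increasing)
    have "(4 * \<beta> + 4) * (12 * b) \<le> (4 * ?B) * (12 * ?B)" by (rule mult_mono) (use \<beta>B assms in auto)
    moreover have "3 * b + 1 \<le> 4 * ?B * ?B"
    proof -
      have "3 * b + 1 \<le> 4 * ?B" using assms B8 by simp
      also have "\<dots> \<le> 4 * ?B * ?B" using B8 by simp
      finally show ?thesis .
    qed
    moreover have "(4 * ?B) * (12 * ?B) = 48 * (?B * ?B)" "4 * ?B * ?B = 4 * (?B * ?B)" by simp_all
    ultimately have "(4 * \<beta> + 4) * (12 * b) + (3 * b + 1) \<le> 64 * (?B * ?B)" by linarith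
    also have "\<dots> \<le> (?B * ?B) * (?B * ?B)"
      using mult_right_mono[OF mult_mono[OF B8 B8], of "?B * ?B"] by simp
    also have "\<dots> = 2 ^ (4 * \<beta>)" by (simp add: power_add[symmetric])
    finally show "(4 * \<beta> + 4) * (12 * b) + (3 * b + 1) \<le> w" using w\<beta>(1) by simp
  qed simp
  finally show ?thesis .
qed

end

text \<open>For \<open>\<rho> \<ge> 2 ^ l\<close> the set of arrays is empty, so only the inequality
  holds in general.\<close>

lemma card_arrs_le: "real (card (arrays s l \<rho>)) \<le> bop s (res (2 ^ l)) (int \<rho>)"
  and card_arrs_eq: "\<rho> < 2 ^ l \<Longrightarrow> real (card (arrays s l \<rho>)) = bop s (res (2 ^ l)) (int \<rho>)"
proof -
  let ?S = "{A. length A = s \<and> int (2 ^ l) dvd (int \<rho> - int (ones A))}"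
  have iff: "int (2 ^ l) dvd (int \<rho> - int n) \<longleftrightarrow> n mod 2 ^ l = \<rho> mod 2 ^ l" for n
    by (metis mod_eq_dvd_iff of_nat_eq_iff zmod_int)
  have c: "real (card ?S) = bop s (res (2 ^ l)) (int \<rho>)"
    unfolding res_def using card_ones[of s "\<lambda>x. int (2 ^ l) dvd x" "int \<rho>"] by simp
  have fin: "finite ?S" by (rule finite_subset[OF _ finite_lists[of s]]) auto
  have "arrays s l \<rho> \<subseteq> ?S" unfolding arrays_def iff by auto
  from card_mono[OF fin this] c show "real (card (arrays s l \<rho>)) \<le> bop s (res (2 ^ l)) (int \<rho>)" by simp
  assume "\<rho> < 2 ^ l"
  hence "arrays s l \<rho> = ?S" unfolding arrays_def iff by simp
  thus "real (card (arrays s l \<rho>)) = bop s (res (2 ^ l)) (int \<rho>)" using c by simp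
qed

lemma pow_le_linear:
  fixes \<epsilon> :: real
  assumes "0 \<le> \<epsilon>" "real b * \<epsilon> \<le> 1"
  shows "(1 + \<epsilon>) ^ b \<le> 1 + 2 * real b * \<epsilon>"
proof -
  have "(1 + \<epsilon>) ^ b \<le> exp \<epsilon> ^ b" using exp_ge_add_one_self[of \<epsilon>] assms(1) by (intro power_mono) auto
  also have "\<dots> = exp (real b * \<epsilon>)" by (simp add: exp_of_nat_mult)
  also have "\<dots> \<le> 1 + real b * \<epsilon> + (real b * \<epsilon>)^2" using assms by (intro exp_bound) auto
  also have "(real b * \<epsilon>)^2 \<le> real b * \<epsilon>" using assms by (simp add: power2_eq_square mult_left_le)
  finally show ?thesis by (simp add: algebra_simps)
qed

lemma split_sizes:
  fixes S b m :: nat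
  assumes "b > 0" "b * m \<le> S" "S \<le> b * (2 * m)"
  defines "s \<equiv> \<lambda>j. (Suc j * S) div b - (j * S) div b"
  shows "m \<le> s j" "s j \<le> 2 * m" "sum s {..<n} = (n * S) div b"
proof -
  have mono: "(j * S) div b \<le> (Suc j * S) div b" for j by (rule div_le_mono) simp
  have "(j * S) div b + m = (j * S + b * m) div b" using assms(1) by simp
  also have "\<dots> \<le> (Suc j * S) div b" by (rule div_le_mono) (use assms(2) in simp)
  finally show "m \<le> s j" by (simp add: s_def)
  have "(Suc j * S) div b \<le> (j * S + b * (2 * m)) div b" by (rule div_le_mono) (use assms(3) in simp)
  also have "\<dots> = (j * S) div b + 2 * m" using assms(1) by simp
  finally show "s j \<le> 2 * m" by (simp add: s_def)
  show "sum s {..<n} = (n * S) div b"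
  proof (induction n)
    case (Suc n)
    thus ?case using mono[of n] by (simp add: s_def)
  qed simp
qed

context params
begin

text \<open>The factor \<open>2 ^ b\<close> arises because every child slot has
  \<open>\<kappa>\<close> bits for only about \<open>2 ^ (\<kappa> - 1)\<close> headers; the factor
  \<open>b\<close> anticipates the passage to the larger modulus of the combined block.\<close>

lemma error_bound:
  assumes "1 \<le> b" "b \<le> 2 ^ \<beta>"
  defines "c2 \<equiv> (D + 1) ^ b * ((2 * (10 * Y0 + 30)) ^ b * (2 * (2 ^ wP + 1)) * (b * ((2 ^ wP + 1) * (2 * Y0 + 3) ^ b)))"
    and "c3 \<equiv> b * b * ((2 * Y0 + 3 + 1) ^ b * 2 ^ wP)"
  shows "real b * 2 ^ b * (real c2 / 2 ^ D + real c3 / 2 ^ (2 * TE)) \<le> 1 / 2 ^ (9 * w)"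
proof -
  let ?Q = "(w ^ 4) ^ b"
  have m: "?Q ^ 3 * (2 * (b * b) * 2 ^ b) \<le> 2 ^ w" by (rule main_bound[OF assms(2,1)])
  have d1: "(D + 1) ^ b \<le> ?Q" "(2 * (10 * Y0 + 30)) ^ b \<le> ?Q" "(2 * Y0 + 3) ^ b \<le> ?Q" "(2 * Y0 + 3 + 1) ^ b \<le> ?Q"
    using poly_bounds by (intro power_mono; simp)+
  have Q1: "1 \<le> ?Q" using w_large by simp
  have bQ: "b \<le> ?Q"
  proof -
    have "b \<le> 2 ^ b" by (rule less_imp_le[OF less_exp])
    also have "(2::nat) ^ b \<le> ?Q"
    proof (rule power_mono)
      have "w ^ 1 \<le> w ^ 4" by (rule power_increasing) (use w_large in auto)
      thus "2 \<le> w ^ 4" using w_large by simp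
    qed simp
    finally show ?thesis .
  qed
  have g2: "((2::nat) ^ wP + 1) * (2 ^ wP + 1) \<le> 2 ^ w"
  proof -
    have "(2::nat) ^ wP + 1 \<le> 2 ^ (wP + 1)" by simp
    hence "((2::nat) ^ wP + 1) * (2 ^ wP + 1) \<le> 2 ^ (wP + 1) * 2 ^ (wP + 1)" by (intro mult_mono) auto
    also have "\<dots> = 2 ^ ((wP + 1) + (wP + 1))" by (simp only: power_add)
    also have "\<dots> \<le> 2 ^ w" by (rule power_increasing) (use w_large in \<open>auto simp: wP_def\<close>)
    finally show ?thesis .
  qed
  have "b * 2 ^ b * c2 \<le> b * 2 ^ b * (?Q * (?Q * (2 * (2 ^ wP + 1)) * (b * ((2 ^ wP + 1) * ?Q))))"
    unfolding c2_def by (intro mult_mono d1 order.refl) auto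
  also have "\<dots> = ?Q ^ 3 * (2 * (b * b) * 2 ^ b) * ((2 ^ wP + 1) * (2 ^ wP + 1))" by (simp only: power3_eq_cube ac_simps)
  also have "\<dots> \<le> 2 ^ w * 2 ^ w" by (rule mult_mono[OF m g2]) auto
  finally have "b * 2 ^ b * c2 \<le> 2 ^ (2 * w)" by (simp only: mult_2 power_add)
  hence "real (b * 2 ^ b * c2) \<le> real (2 ^ (2 * w))" by (simp only: of_nat_le_iff)
  hence 2: "real b * 2 ^ b * real c2 \<le> 2 ^ (2 * w)" by simp
  have "b * 2 ^ b * c3 = b * (b * b * 2 ^ b) * ((2 * Y0 + 3 + 1) ^ b * 2 ^ wP)" unfolding c3_def by (simp only: ac_simps)
  also have "\<dots> \<le> ?Q * (b * b * 2 ^ b) * (?Q * 2 ^ wP)" by (intro mult_mono bQ d1 order.refl) auto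
  also have "\<dots> = (?Q * ?Q * 1 * (1 * (b * b) * 2 ^ b)) * 2 ^ wP" by (simp add: ac_simps)
  also have "\<dots> \<le> (?Q * ?Q * ?Q * (2 * (b * b) * 2 ^ b)) * 2 ^ wP" by (intro mult_mono Q1 order.refl) auto
  also have "\<dots> \<le> 2 ^ w * 2 ^ w"
  proof (rule mult_mono)
    show "?Q * ?Q * ?Q * (2 * (b * b) * 2 ^ b) \<le> 2 ^ w" using m by (simp only: power3_eq_cube)
    show "(2::nat) ^ wP \<le> 2 ^ w" by (rule power_increasing) (use w_large in \<open>auto simp: wP_def\<close>)
  qed auto
  finally have "b * 2 ^ b * c3 \<le> 2 ^ (2 * w)" by (simp only: mult_2 power_add)
  hence "real (b * 2 ^ b * c3) \<le> real (2 ^ (2 * w))" by (simp only: of_nat_le_iff)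
  hence 3: "real b * 2 ^ b * real c3 \<le> 2 ^ (2 * w)" by simp
  have e: "2 ^ (2 * w) / 2 ^ D = 1 / (2::real) ^ (10 * w)"
  proof -
    have "(2::real) ^ D = 2 ^ (2 * w) * 2 ^ (10 * w)" by (simp add: D_def power_add[symmetric])
    thus ?thesis by simp
  qed
  have t2: "real b * 2 ^ b * real c2 / 2 ^ D \<le> 1 / 2 ^ (10 * w)" using divide_right_mono[OF 2, of "2 ^ D"] e by simp
  have "D \<le> 2 * TE" using w_large by (simp add: D_def TE_def T_def wP_def)
  hence "real b * 2 ^ b * real c3 / 2 ^ (2 * TE) \<le> real b * 2 ^ b * real c3 / 2 ^ D"
    by (intro divide_left_mono power_increasing) auto
  hence t3: "real b * 2 ^ b * real c3 / 2 ^ (2 * TE) \<le> 1 / 2 ^ (10 * w)" using divide_right_mono[OF 3, of "2 ^ D"] e by simp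
  have "2 * 2 ^ (9 * w) \<le> (2::real) ^ (10 * w)" using power_increasing[of "9 * w + 1" "10 * w" "2::real"] w_large by simp
  hence "1 / 2 ^ (10 * w) + 1 / 2 ^ (10 * w) \<le> 1 / (2::real) ^ (9 * w)" by (simp add: field_simps)
  thus ?thesis using t2 t3 by (simp add: distrib_left)
qed

text \<open>The node is built with the modulus \<open>2 ^ l\<close> of its children and refined to
  \<open>2 ^ l'\<close> only afterwards. The refinement preserves the absolute waste while the
  residue class shrinks, so the relative waste grows by \<open>q = 2 ^ (l' - l) \<le> b\<close>, on
  top of the factor of about \<open>2 * b\<close> from combining \<open>b\<close> headers.\<close>

lemma rep_step:
  assumes a': "a0 \<le> a'" and b': "1 \<le> \<beta>'" "\<beta>' \<le> \<beta>" and a: "a' + \<beta>' \<le> w div 7"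
    and S: "2 ^ (a' + \<beta>') \<le> S" "S \<le> 2 ^ (a' + \<beta>' + 1)"
    and IH: "\<And>s. 2 ^ a' \<le> s \<Longrightarrow> s \<le> 2 ^ (a' + 1) \<Longrightarrow> \<exists>hdr mem N. rep W s (lv a') (Mv s a') (Kv a') p hdr mem N"
  shows "\<exists>hdr mem N. rep W S (lv (a' + \<beta>')) (Mv S (a' + \<beta>')) (Kv (a' + \<beta>')) (p + 3) hdr mem N"
proof -
  define aa where "aa = a' + \<beta>'"
  define b where "b = (2::nat) ^ \<beta>'"
  define l where "l = lv a'"
  define l' where "l' = lv aa"
  define K where "K = Kv a'"
  define M' where "M' = Mv S aa"
  have aa: "a0 \<le> aa" "aa \<le> w div 7" "2 ^ aa \<le> S" "S \<le> 2 ^ (aa + 1)" using a' a S by (auto simp: aa_def)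
  have b2: "2 \<le> b" using power_increasing[of 1 \<beta>' "2::nat"] b' by (simp add: b_def)
  have bB: "b \<le> 2 ^ \<beta>" unfolding b_def using b' by (intro power_increasing) auto
  have ll: "l \<le> l'" "l' \<le> l + \<beta>'" using b' by (auto simp: l_def l'_def aa_def lv_def)
  define s where "s = (\<lambda>j. (Suc j * S) div b - (j * S) div b)"
  have S1: "b * 2 ^ a' \<le> S" "S \<le> b * (2 * 2 ^ a')" using S by (simp_all add: b_def power_add ac_simps)
  have bpos: "b > 0" using b2 by simp
  note ss = split_sizes[OF bpos S1, folded s_def]
  have s1: "2 ^ a' \<le> s j" "s j \<le> 2 ^ (a' + 1)" for j using ss(1,2)[of j] by (simp_all add: s_def)
  have sumS: "sum s {..<b} = S" using ss(3)[of b] bpos by simp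
  have a'7: "a' + 1 \<le> w div 7" using a b' by simp
  have a'8: "a' \<le> w div 7" using a by simp
  have "\<forall>j. \<exists>h m N. rep W (s j) l (Mv (s j) a') K p h m N" using IH[OF s1] by (simp add: l_def K_def)
  then obtain hdr mem N where rp: "\<And>j. rep W (s j) l (Mv (s j) a') K p (hdr j) (mem j) (N j)" by metis
  define M where "M j = Mv (s j) a'" for j
  have sM: "s j + 1 = M j + \<kappa> + l" for j using size_bounds(5)[OF a' a'8 s1] by (simp add: M_def l_def)
  have ch: "child W (s j) l (M j) K p (hdr j) (mem j) (N j) \<kappa> T Y0" for j
    unfolding M_def l_def K_def by (rule child_ok[OF a' a'8 s1]) (use rp in \<open>simp add: l_def K_def\<close>)
  have sumM: "sum M {..<b} + b * (\<kappa> + l) = S + b"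
  proof -
    have "(\<Sum>j<b. s j + 1) = (\<Sum>j<b. M j + (\<kappa> + l))" by (rule sum.cong) (use sM in auto)
    thus ?thesis by (simp only: sum.distrib sumS) (simp add: distrib_left)
  qed
  have lw: "7 * l \<le> w" "7 * l' \<le> w" using size_bounds(6)[OF a' a'8 s1(1,2)] size_bounds(6)[OF aa] by (auto simp: l_def l'_def)
  have SM': "S + 1 = M' + \<kappa> + l'" using size_bounds(5)[OF aa] by (simp add: M'_def l'_def)
  have b\<kappa>: "2 * \<kappa> \<le> b * \<kappa>" "b \<le> b * \<kappa>" using b2 w_large by (simp_all add: \<kappa>_def)
  have bw: "b \<le> w"
  proof -
    have "(2::nat) ^ \<beta> \<le> 2 ^ (4 * \<beta>)" by (rule power_increasing) auto
    thus ?thesis using bB w\<beta>(1) by linarith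
  qed
  define gm where "gm j = s j div 2 ^ l + 1" for j
  define Typ where "Typ j = {child.glo (s j) l Y0..<child.ghi (s j) l Y0}" for j
  have gmx: "gm j \<le> 2 ^ wP" for j
  proof -
    have "gm j \<le> s j + 1" by (simp add: gm_def)
    also have "s j + 1 \<le> 2 ^ (w div 7) + 2 ^ (w div 7)"
    proof (rule add_mono)
      show "s j \<le> 2 ^ (w div 7)" by (rule order.trans[OF s1(2)]) (rule power_increasing[OF a'7], simp)
    qed simp
    also have "\<dots> \<le> 2 ^ wP" by (simp add: wP_def)
    finally show ?thesis .
  qed
  interpret nd: node W l \<kappa> K p b T D TE wP M' "10 * Y0 + 30" "2 ^ wP + 1" "2 * Y0 + 3" "2 ^ wP" s M gm hdr mem N Typ
  proof
    show "b > 0" by fact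
    show "rep W (s j) l (M j) K p (hdr j) (mem j) (N j)" for j using rp by (simp add: M_def)
    show "K \<le> 2 ^ \<kappa>"
    proof -
      have "\<kappa> = Suc (\<kappa> - 1)" using w_large by (simp add: \<kappa>_def)
      hence "(2::nat) ^ \<kappa> = 2 ^ (\<kappa> - 1) + 2 ^ (\<kappa> - 1)" by (metis mult_2 power_Suc)
      moreover have "(2::nat) ^ (\<kappa> - 1 + 5 * a' - 9 * w) \<le> 2 ^ (\<kappa> - 1)" by (rule power_increasing) (use a'8 in auto)
      ultimately show ?thesis by (simp add: K_def Kv_def)
    qed
    show "s j div 2 ^ l < gm j" for j by (simp add: gm_def)
    show "gm j \<le> 2 ^ wP" for j by (rule gmx)
    show "l \<le> \<kappa>" "l + \<kappa> \<le> W" using lw by (auto simp: \<kappa>_def W_def)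
    show "card (undetermined (N j) l \<kappa> K (gm j) t X Y) \<le> 10 * Y0 + 30" if "t < T" for j t X Y
      by (rule child.card_und_coarse[OF ch]) (use that in simp)
    show "card (undetermined (N j) l \<kappa> K (gm j) t X Y) \<le> 2 ^ wP + 1" if "T \<le> t" for j t X Y
    proof -
      have "l \<le> t" using lw that by (simp add: T_def)
      from card_und_fine[OF this, of "N j" \<kappa> K "gm j" X Y] gmx[of j] show ?thesis by linarith
    qed
    show "card {k. k < K \<and> carry (N j) l (gm j) y x k \<notin> Typ j} * 2 ^ wP \<le> 2 ^ (\<kappa> - TE)" if "y < 2 ^ l" "x < 2 ^ l" for j y x
    proof -
      have "child.glo (s j) l Y0 \<le> s j div 2 div 2 ^ l" using child.glo_def[OF ch] by simp
      also have "\<dots> \<le> gm j" using div_le_mono[of "s j div 2" "s j" "2 ^ l"] by (simp add: gm_def)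
      finally have "card {k. k < K \<and> carry (N j) l (gm j) y x k \<notin> Typ j} \<le> 2 ^ (\<kappa> + 1 - T)"
        unfolding Typ_def by (rule child.card_escape[OF ch that])
      hence "card {k. k < K \<and> carry (N j) l (gm j) y x k \<notin> Typ j} * 2 ^ wP \<le> 2 ^ (\<kappa> + 1 - T) * 2 ^ wP" by (rule mult_right_mono) simp
      also have "\<dots> = 2 ^ (\<kappa> - TE)"
      proof -
        have "\<kappa> + 1 - T + wP = \<kappa> - TE" using w_large by (simp add: \<kappa>_def T_def TE_def wP_def)
        thus ?thesis by (simp only: power_add[symmetric])
      qed
      finally show ?thesis .
    qed
    show "finite (Typ j)" for j by (simp add: Typ_def)
    show "card (Typ j) \<le> 2 * Y0 + 3" for j unfolding Typ_def child.glo_def[OF ch] child.ghi_def[OF ch] by simp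
    show "sum s {..<b} < 2 ^ wP"
    proof -
      have "S \<le> 2 ^ (aa + 1)" by fact
      also have "\<dots> < 2 ^ wP" by (rule power_strict_increasing) (use aa in \<open>auto simp: wP_def\<close>)
      finally show ?thesis by (simp add: sumS)
    qed
    have "l' + b \<le> \<kappa>" using lw bw w_large by (simp add: \<kappa>_def)
    thus "sum M {..<b} \<le> M'" using sumM SM' b\<kappa>(1) unfolding distrib_left by linarith
    have "3 * (D + 2 * TE) \<le> 84 * w" by (simp add: D_def TE_def T_def)
    thus "M' + l + 3 * (D + 2 * TE) \<le> b * (l + \<kappa>) + sum M {..<b}"
      using sumM SM' lw w_large by (simp add: \<kappa>_def add.commute[of l])
    show "10 * Y0 + 30 > 0" "2 ^ wP + 1 > (0::nat)" "2 * Y0 + 3 > 0" by simp_all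
    show "D < 2 * T" "D \<le> \<kappa>" "TE \<le> \<kappa>" using w_large by (simp_all add: D_def T_def \<kappa>_def TE_def)
  qed
  define c2 where "c2 = (D + 1) ^ b * ((2 * (10 * Y0 + 30)) ^ b * (2 * (2 ^ wP + 1)) * (b * ((2 ^ wP + 1) * (2 * Y0 + 3) ^ b)))"
  define c3 where "c3 = b * b * ((2 * Y0 + 3 + 1) ^ b * 2 ^ wP)"
  define \<delta> where "\<delta> = real c2 / 2 ^ D + real c3 / 2 ^ (2 * TE)"
  define \<epsilon> where "\<epsilon> = 2 ^ (5 * a') / (2::real) ^ (9 * w)"
  define X where "X = 2 ^ (l * (b - 1)) * real K ^ b * 2 ^ sum M {..<b} + 2 ^ nd.V * \<delta>"
  define K1 where "K1 = nat \<lceil>X / 2 ^ M'\<rceil>"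
  have \<delta>0: "\<delta> \<ge> 0" by (simp add: \<delta>_def)
  have X0: "X \<ge> 0" using \<delta>0 by (simp add: X_def)
  have K1: "X \<le> real K1 * 2 ^ M'" "real K1 * 2 ^ M' \<le> X + 2 ^ M'"
  proof -
    have "X / 2 ^ M' \<le> real K1" unfolding K1_def by (rule real_nat_ceiling_ge)
    thus "X \<le> real K1 * 2 ^ M'" by (simp add: divide_le_eq)
    have "real K1 = real_of_int \<lceil>X / 2 ^ M'\<rceil>" using X0 by (simp add: K1_def)
    hence "real K1 \<le> X / 2 ^ M' + 1" by linarith
    hence "real K1 * 2 ^ M' \<le> (X / 2 ^ M' + 1) * 2 ^ M'" by (rule mult_right_mono) simp
    thus "real K1 * 2 ^ M' \<le> X + 2 ^ M'" by (simp add: distrib_right)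
  qed
  have pr: "prerep W S l M' K1 (p + 3) nd.header nd.memory"
  proof -
    have "prerep W (nd.off b) l M' K1 (p + 3) nd.header nd.memory"
      by (rule nd.prerep_node) (use K1(1) in \<open>simp only: X_def \<delta>_def c2_def c3_def\<close>)
    thus ?thesis by (simp add: nd.off_def sumS)
  qed
  have K: "real K = 2 ^ (\<kappa> - 1) * (1 + \<epsilon>)" unfolding K_def \<epsilon>_def by (rule Kv_eq)
  have X: "X = 2 ^ S / 2 ^ l * ((1 + \<epsilon>) ^ b + 2 ^ b * \<delta>)"
  proof -
    obtain c where c: "b = Suc c" using b2 by (cases b) auto
    obtain \<kappa>1 where k1: "\<kappa> = Suc \<kappa>1" using w_large by (cases \<kappa>) (auto simp: \<kappa>_def)
    have e1: "l * (b - 1) + b * (\<kappa> - 1) + sum M {..<b} + l = S" using sumM unfolding c k1 by (simp add: algebra_simps)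
    have "(b - 1) * l + l = b * l" unfolding c by simp
    hence e2: "nd.V + l = S + b" using sumM unfolding nd.V_def distrib_left by linarith
    have "2 ^ (l * (b - 1)) * real K ^ b * 2 ^ sum M {..<b} = 2 ^ (l * (b - 1) + b * (\<kappa> - 1) + sum M {..<b}) * (1 + \<epsilon>) ^ b"
      unfolding K by (simp add: power_mult_distrib power_add power_mult[symmetric] mult.commute mult.left_commute)
    also have "(2::real) ^ (l * (b - 1) + b * (\<kappa> - 1) + sum M {..<b}) = 2 ^ S / 2 ^ l"
      unfolding e1[symmetric] by (simp add: power_add)
    finally have x1: "2 ^ (l * (b - 1)) * real K ^ b * 2 ^ sum M {..<b} = 2 ^ S / 2 ^ l * (1 + \<epsilon>) ^ b" .
    have "(2::real) ^ nd.V * 2 ^ l = 2 ^ S * 2 ^ b" using e2 by (metis power_add)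
    hence "(2::real) ^ nd.V = 2 ^ S / 2 ^ l * 2 ^ b" by (simp add: field_simps)
    thus ?thesis unfolding X_def x1 by (simp add: distrib_left)
  qed
  define q where "q = (2::real) ^ (l' - l)"
  have q: "q \<le> real b" "q \<ge> 0" "2 ^ l' = q * 2 ^ l"
  proof -
    have "(2::real) ^ (l' - l) \<le> 2 ^ \<beta>'" using ll by (intro power_increasing) auto
    thus "q \<le> real b" by (simp add: q_def b_def)
    show "q \<ge> 0" by (simp add: q_def)
    show "2 ^ l' = q * 2 ^ l" unfolding q_def using ll(1) by (metis le_add_diff_inverse2 power_add)
  qed
  define \<eta> where "\<eta> = 1 / (2::real) ^ (9 * w)"
  have \<eta>\<epsilon>: "\<eta> \<le> \<epsilon>" unfolding \<eta>_def \<epsilon>_def by (intro divide_right_mono) auto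
  have \<epsilon>0: "\<epsilon> \<ge> 0" by (simp add: \<epsilon>_def)
  have \<epsilon>': "2 ^ (5 * aa) / 2 ^ (9 * w) = real b ^ 5 * \<epsilon>"
    unfolding \<epsilon>_def aa_def b_def by (simp add: power_add power_mult[symmetric] distrib_left mult.commute)
  have b\<epsilon>: "real b * \<epsilon> \<le> 1"
  proof -
    have "real b * 2 ^ (5 * a') = 2 ^ (\<beta>' + 5 * a')" by (simp add: b_def power_add)
    also have "\<dots> \<le> (2::real) ^ (9 * w)" by (rule power_increasing) (use a a'8 in auto)
    finally show ?thesis unfolding \<epsilon>_def by simp
  qed
  have pe: "(1 + \<epsilon>) ^ b \<le> 1 + 2 * real b * \<epsilon>" by (rule pow_le_linear[OF \<epsilon>0 b\<epsilon>])
  have eb: "real b * 2 ^ b * \<delta> \<le> \<eta>" unfolding \<delta>_def c2_def c3_def \<eta>_def by (rule error_bound) (use b2 bB in auto)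
  have t1: "2 * 2 ^ l' / (2::real) ^ (10 * w) \<le> \<eta>"
  proof -
    have "2 * 2 ^ l' * 2 ^ (9 * w) \<le> (2::real) ^ (10 * w)"
      using power_increasing[of "1 + l' + 9 * w" "10 * w" "2::real"] lw w_large by (simp add: power_add)
    thus ?thesis unfolding \<eta>_def by (simp add: field_simps)
  qed
  have t3: "2 / (2::real) ^ \<kappa> \<le> \<eta>"
  proof -
    have "2 * 2 ^ (9 * w) \<le> (2::real) ^ \<kappa>"
      using power_increasing[of "1 + 9 * w" \<kappa> "2::real"] w_large by (simp add: \<kappa>_def)
    thus ?thesis unfolding \<eta>_def by (simp add: field_simps)
  qed
  \<comment> \<open>The terms are the equidistribution errors at both moduli, the waste of the node
    scaled by \<open>q\<close>, and the rounding of \<open>K1\<close> to an integer.\<close>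
  have fin: "2 * 2 ^ l' / 2 ^ (10 * w) + q * ((1 + \<epsilon>) ^ b - 1 + 2 ^ b * \<delta>) + 2 / 2 ^ \<kappa> \<le> real b ^ 5 * \<epsilon>"
  proof -
    have "q * ((1 + \<epsilon>) ^ b - 1 + 2 ^ b * \<delta>) \<le> real b * (2 * real b * \<epsilon> + 2 ^ b * \<delta>)"
    proof (rule mult_mono[OF q(1)])
      show "(1 + \<epsilon>) ^ b - 1 + 2 ^ b * \<delta> \<le> 2 * real b * \<epsilon> + 2 ^ b * \<delta>" using pe by simp
      have "1 \<le> (1 + \<epsilon>) ^ b" using \<epsilon>0 by simp
      thus "0 \<le> (1 + \<epsilon>) ^ b - 1 + 2 ^ b * \<delta>" using \<delta>0 by simp
    qed simp
    also have "\<dots> = 2 * real b ^ 2 * \<epsilon> + real b * 2 ^ b * \<delta>" by (simp add: distrib_left power2_eq_square)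
    finally have "2 * 2 ^ l' / 2 ^ (10 * w) + q * ((1 + \<epsilon>) ^ b - 1 + 2 ^ b * \<delta>) + 2 / 2 ^ \<kappa> \<le> 2 * real b ^ 2 * \<epsilon> + 3 * \<epsilon>"
      using t1 t3 eb \<eta>\<epsilon> by linarith
    also have "\<dots> = (2 * real b ^ 2 + 3) * \<epsilon>" by (simp add: distrib_right)
    also have "\<dots> \<le> real b ^ 5 * \<epsilon>"
    proof (rule mult_right_mono[OF _ \<epsilon>0])
      have rb: "2 \<le> real b" using b2 by simp
      have p3: "8 \<le> real b ^ 3" using power_mono[OF rb, of 3] by simp
      have p2: "4 \<le> real b ^ 2" using power_mono[OF rb, of 2] by simp
      have "8 * real b ^ 2 \<le> real b ^ 3 * real b ^ 2" by (rule mult_right_mono[OF p3]) simp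
      also have "\<dots> = real b ^ 5" by (simp add: power_add[symmetric])
      finally show "2 * real b ^ 2 + 3 \<le> real b ^ 5" using p2 by linarith
    qed
    finally show ?thesis .
  qed
  have KM: "real (Kv aa) * 2 ^ M' = 2 ^ S / 2 ^ l' * (1 + real b ^ 5 * \<epsilon>)"
  proof -
    have "\<kappa> - 1 + M' + l' = S" using SM' w_large by (simp add: \<kappa>_def)
    hence "(2::real) ^ S = 2 ^ (\<kappa> - 1) * 2 ^ M' * 2 ^ l'" by (metis power_add)
    thus ?thesis unfolding Kv_eq \<epsilon>' by simp
  qed
  have pr': "prerep W S l' M' (Kv aa) (p + 3) nd.header nd.memory"
  proof (rule prerep_refine[OF pr ll(1)])
    fix \<rho>
    let ?Z = "(2::real) ^ S / 2 ^ l'"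
    have u1: "real (card (arrays S l' \<rho>)) \<le> ?Z + 2 ^ S / 2 ^ (10 * w)"
      using card_arrs_le[of S l' \<rho>] unif_any[OF aa order.refl, of "int \<rho>"] by (simp add: l'_def abs_le_iff)
    have u2: "real (card (arrays S l (\<rho> mod 2 ^ l))) \<ge> 2 ^ S / 2 ^ l - 2 ^ S / 2 ^ (10 * w)"
      using card_arrs_eq[of "\<rho> mod 2 ^ l" l S] unif_any[OF aa, of l "int (\<rho> mod 2 ^ l)"] ll(1) by (simp add: l'_def abs_le_iff)
    have zl: "2 ^ S / 2 ^ l = ?Z * q" using q(3) by (simp add: q_def)
    have z10: "2 ^ S / (2::real) ^ (10 * w) = ?Z * (2 ^ l' / 2 ^ (10 * w))" by simp
    have zM: "(2::real) ^ M' = ?Z * (2 / 2 ^ \<kappa>)"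
    proof -
      have "(2::real) ^ S * 2 = 2 ^ M' * 2 ^ \<kappa> * 2 ^ l'" using SM' by (metis power_add power_Suc Suc_eq_plus1 mult.commute)
      thus ?thesis by (simp add: field_simps)
    qed
    have "real (card (arrays S l' \<rho>)) + real K1 * 2 ^ M' - real (card (arrays S l (\<rho> mod 2 ^ l)))
       \<le> ?Z + 2 * (2 ^ S / 2 ^ (10 * w)) + (X + 2 ^ M') - 2 ^ S / 2 ^ l" using u1 u2 K1(2) by linarith
    also have "\<dots> = ?Z * (1 + (2 * 2 ^ l' / 2 ^ (10 * w) + q * ((1 + \<epsilon>) ^ b - 1 + 2 ^ b * \<delta>) + 2 / 2 ^ \<kappa>))"
      unfolding X zl z10 zM by (simp add: algebra_simps add_divide_distrib diff_divide_distrib)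
    also have "\<dots> \<le> ?Z * (1 + real b ^ 5 * \<epsilon>)" by (rule mult_left_mono) (use fin in auto)
    also have "\<dots> = real (Kv aa) * 2 ^ M'" by (simp only: KM)
    finally have "real (card (arrays S l' \<rho>)) + real K1 * 2 ^ M' \<le> real (Kv aa) * 2 ^ M' + real (card (arrays S l (\<rho> mod 2 ^ l)))" by linarith
    hence "real (card (arrays S l' \<rho>) + K1 * 2 ^ M') \<le> real (Kv aa * 2 ^ M' + card (arrays S l (\<rho> mod 2 ^ l)))" by simp
    thus "card (arrays S l' \<rho>) + K1 * 2 ^ M' \<le> Kv aa * 2 ^ M' + card (arrays S l (\<rho> mod 2 ^ l))" by (simp only: of_nat_le_iff)
  qed
  from prerep_imp_rep[OF pr'] show ?thesis unfolding M'_def l'_def aa_def by blast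
qed

lemma rep_all:
  assumes "a0 \<le> a" "a \<le> a0 + i * \<beta>" "a \<le> w div 7" "2 ^ a \<le> s" "s \<le> 2 ^ (a + 1)"
  shows "\<exists>hdr mem N. rep W s (lv a) (Mv s a) (Kv a) (1 + 3 * i) hdr mem N"
  using assms
proof (induction i arbitrary: a s)
  case 0
  hence "a = a0" by simp
  thus ?case using rep_base[of s] 0 by simp
next
  case (Suc i)
  show ?case
  proof (cases "a = a0")
    case True
    then obtain hdr mem N where "rep W s (lv a) (Mv s a) (Kv a) 1 hdr mem N" using rep_base[of s] Suc.prems by blast
    from rep_mono[OF this, of "1 + 3 * Suc i"] show ?thesis by auto
  next
    case False
    \<comment> \<open>If fewer than \<open>\<beta>\<close> scales remain, the children are placed
      exactly at scale \<open>a0\<close>.\<close>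
    define \<beta>' where "\<beta>' = min \<beta> (a - a0)"
    define a' where "a' = a - \<beta>'"
    have b': "1 \<le> \<beta>'" "\<beta>' \<le> \<beta>" using False Suc.prems \<beta> by (auto simp: \<beta>'_def)
    have a': "a0 \<le> a'" "a' \<le> a0 + i * \<beta>" "a' + \<beta>' = a" "a' \<le> w div 7" using Suc.prems by (auto simp: a'_def \<beta>'_def min_def)
    have "\<exists>hdr mem N. rep W s (lv (a' + \<beta>')) (Mv s (a' + \<beta>')) (Kv (a' + \<beta>')) (1 + 3 * i + 3) hdr mem N"
      by (rule rep_step[OF a'(1) b']) (use a' Suc in auto)
    thus ?thesis unfolding a'(3) by (simp add: ac_simps)
  qed
qed

end

subsection \<open>The data structure\<close>

text \<open>The arbitrary offset \<open>a\<close> allows several such structures to be stored next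
  to each other.\<close>

definition compact_rank :: "nat \<Rightarrow> nat \<Rightarrow> nat \<Rightarrow> bool" where
  "compact_rank W n p \<longleftrightarrow> (\<exists>enc. (\<forall>A. length A = n \<longrightarrow> length (enc A) = n + 1) \<and>
     (\<forall>a u. \<exists>f. reads W p f \<and> (\<forall>A m. length A = n \<longrightarrow> u \<le> n \<longrightarrow>
        take (n + 1) (drop a m) = enc A \<longrightarrow> f m = ones (take u A))))"

lemma ds_mono:
  assumes "compact_rank W n p" "p \<le> q"
  shows "compact_rank W n q"
proof -
  obtain enc where e: "\<forall>A. length A = n \<longrightarrow> length (enc A) = n + 1"
    and q: "\<forall>a u. \<exists>f. reads W p f \<and> (\<forall>A m. length A = n \<longrightarrow> u \<le> n \<longrightarrow> take (n + 1) (drop a m) = enc A \<longrightarrow> f m = ones (take u A))"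
    using assms(1) unfolding compact_rank_def by (elim exE conjE)
  have "\<exists>f. reads W q f \<and> (\<forall>A m. length A = n \<longrightarrow> u \<le> n \<longrightarrow> take (n + 1) (drop a m) = enc A \<longrightarrow> f m = ones (take u A))" for a u
  proof -
    from q[rule_format, of u a] obtain f where f: "reads W p f"
      "\<forall>A m. length A = n \<longrightarrow> u \<le> n \<longrightarrow> take (n + 1) (drop a m) = enc A \<longrightarrow> f m = ones (take u A)" by (elim exE conjE)
    show ?thesis by (rule exI[of _ f], rule conjI[OF reads_mono[OF f(1) assms(2)] f(2)])
  qed
  thus ?thesis unfolding compact_rank_def using e by (intro exI[of _ enc] conjI allI) auto
qed

lemma ds_small:
  assumes "n + 1 \<le> W"
  shows "compact_rank W n 1"
  unfolding compact_rank_def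
proof (intro exI[of _ "\<lambda>A. A @ [False]"] conjI allI)
  fix A :: "bool list" show "length A = n \<longrightarrow> length (A @ [False]) = n + 1" by simp
next
  fix a u
  have "reads W 1 (\<lambda>m. ones (take u (take n (take W (drop a m)))))"
    using reads_map[OF reads_one[of W a], of "\<lambda>x. ones (take u (take n x))"] by simp
  moreover have "take n (take W (drop a m)) = A" if "length A = n" "take (n + 1) (drop a m) = A @ [False]" for A and m :: "bool list"
  proof -
    have "take n (take W (drop a m)) = take n (take (n + 1) (drop a m))" using assms by (simp add: min_absorb1)
    also have "\<dots> = take n (A @ [False])" by (simp only: that(2))
    finally show ?thesis using that(1) by simp
  qed
  ultimately show "\<exists>f. reads W 1 f \<and> (\<forall>A m. length A = n \<longrightarrow> u \<le> n \<longrightarrow> take (n + 1) (drop a m) = A @ [False] \<longrightarrow> f m = ones (take u A))"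
    by (intro exI[of _ "\<lambda>m. ones (take u (take n (take W (drop a m))))"]) auto
qed

text \<open>Residue and header of the root are written out in \<open>l + \<kappa>\<close> bits,
  which one more read fetches. The identity for \<open>n + 1\<close> shows that the excess is one
  bit.\<close>

lemma rep_imp_ds:
  assumes "rep W n l M K p hdr mem N" "K \<le> 2 ^ \<kappa>" "n + 1 = M + \<kappa> + l" "l + \<kappa> \<le> W"
  shows "compact_rank W n (p + 1)"
proof -
  have q: "query_ok W n l M p hdr mem" and hK: "\<And>A. length A = n \<Longrightarrow> hdr A < K" using assms(1) unfolding rep_def by blast+
  have lm: "length (mem A) = M" if "length A = n" for A using q that unfolding query_ok_def by blast
  define enc where "enc A = bl l (ones A mod 2 ^ l) @ bl \<kappa> (hdr A) @ mem A" for A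
  have len: "length (enc A) = n + 1" if "length A = n" for A using lm[OF that] assms(3) by (simp add: enc_def)
  have "\<exists>f. reads W (p + 1) f \<and> (\<forall>A m. length A = n \<longrightarrow> u \<le> n \<longrightarrow> take (n + 1) (drop a m) = enc A \<longrightarrow> f m = ones (take u A))" for a u
  proof -
    have "\<forall>\<rho> h. \<exists>f. reads W p f \<and> (\<forall>A\<in>arrays n l \<rho>. \<forall>m. hdr A = h \<longrightarrow> u \<le> n \<longrightarrow> take M (drop (a + (l + \<kappa>)) m) = mem A \<longrightarrow> f m = ones (take u A))"
      using q unfolding query_ok_def by blast
    then obtain F where F: "\<And>\<rho> h. reads W p (F \<rho> h)"
      "\<And>\<rho> h A m. A \<in> arrays n l \<rho> \<Longrightarrow> hdr A = h \<Longrightarrow> u \<le> n \<Longrightarrow> take M (drop (a + (l + \<kappa>)) m) = mem A \<Longrightarrow> F \<rho> h m = ones (take u A)"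
      by metis
    define g where "g x = F (nb (take l x)) (nb (take \<kappa> (drop l x)))" for x
    have "reads W (1 + p) (\<lambda>m. g (take W (drop a m)) m)"
      by (rule reads_bind[OF reads_one[unfolded One_nat_def[symmetric]]]) (simp add: g_def F)
    moreover have "g (take W (drop a m)) m = ones (take u A)"
      if A: "length A = n" "u \<le> n" "take (n + 1) (drop a m) = enc A" for A m
    proof -
      have 1: "take (l + \<kappa>) (take W (drop a m)) = bl l (ones A mod 2 ^ l) @ bl \<kappa> (hdr A)"
      proof -
        have "take (l + \<kappa>) (take W (drop a m)) = take (l + \<kappa>) (take (n + 1) (drop a m))"
          using assms(3,4) by (simp add: min_absorb1)
        thus ?thesis unfolding A(3) enc_def by simp
      qed
      have "take l (take W (drop a m)) = take l (take (l + \<kappa>) (take W (drop a m)))" by (simp add: min_def)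
      hence t1: "take l (take W (drop a m)) = bl l (ones A mod 2 ^ l)" unfolding 1 by simp
      have "take \<kappa> (drop l (take W (drop a m))) = drop l (take (l + \<kappa>) (take W (drop a m)))" by (simp only: drop_take) simp
      hence t2: "take \<kappa> (drop l (take W (drop a m))) = bl \<kappa> (hdr A)" unfolding 1 by simp
      have hk: "hdr A mod 2 ^ \<kappa> = hdr A" using hK[OF A(1)] assms(2) by simp
      have "take M (drop (a + (l + \<kappa>)) m) = drop (l + \<kappa>) (take (n + 1) (drop a m))"
        using assms(3) by (simp add: drop_take add.commute)
      also have "\<dots> = mem A" unfolding A(3) enc_def by simp
      finally have mm: "take M (drop (a + (l + \<kappa>)) m) = mem A" .
      have "A \<in> arrays n l (ones A mod 2 ^ l)" using A(1) by (simp add: arrays_def)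
      from F(2)[OF this refl A(2) mm] show ?thesis unfolding g_def t1 t2 nb_bl hk by simp
    qed
    ultimately show ?thesis by (intro exI[of _ "\<lambda>m. g (take W (drop a m)) m"]) simp
  qed
  thus ?thesis unfolding compact_rank_def using len by (intro exI[of _ enc] conjI allI) auto
qed

context params
begin

lemma Kv_le: "a \<le> w div 7 \<Longrightarrow> Kv a \<le> 2 ^ \<kappa>"
proof -
  assume a: "a \<le> w div 7"
  have "\<kappa> = Suc (\<kappa> - 1)" using w_large by (simp add: \<kappa>_def)
  hence "(2::nat) ^ \<kappa> = 2 ^ (\<kappa> - 1) + 2 ^ (\<kappa> - 1)" by (metis mult_2 power_Suc)
  moreover have "(2::nat) ^ (\<kappa> - 1 + 5 * a - 9 * w) \<le> 2 ^ (\<kappa> - 1)" by (rule power_increasing) (use a in auto)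
  ultimately show ?thesis by (simp add: Kv_def)
qed

lemma log_w_le: "log 2 (real w) \<le> 8 * real \<beta>"
proof -
  have "real w \<le> real (2 ^ (4 * \<beta> + 4))" using w\<beta>(2) by (simp only: of_nat_le_iff)
  hence "log 2 (real w) \<le> log 2 (2 ^ (4 * \<beta> + 4))" using w_large by (intro log_mono) auto
  also have "\<dots> = real (4 * \<beta> + 4)" by (simp only: log_pow_cancel[of 2] log_nat_power) simp
  finally show ?thesis using \<beta> by simp
qed

text \<open>A level gains \<open>\<beta>\<close> scales and
  \<open>log 2 w \<le> 8 * \<beta>\<close>, so \<open>i \<le> 8 * x + 1\<close> levels suffice;
  \<open>5 + 24 * x\<close> bounds \<open>2 + 3 * i\<close>.\<close>

lemma ds_all:
  assumes "n \<ge> 1" "7 * log 2 (real n) \<le> real w" "log 2 (real n) \<le> x * log 2 (real w)" "x \<ge> 0" "5 + 24 * x \<le> real p"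
  shows "compact_rank W n p"
proof (cases "n < 2 ^ a0")
  case True
  have "compact_rank W n 1" by (rule ds_small) (use True a0(2) w_large in \<open>simp add: W_def\<close>)
  moreover have "1 \<le> p" using assms(4,5) by linarith
  ultimately show ?thesis by (rule ds_mono)
next
  case False
  obtain a where a: "2 ^ a \<le> n" "n < 2 ^ (a + 1)" using ex_power_ivl1[of 2 n] assms(1) by auto
  have "a0 < a + 1" using False a by (metis not_less order.strict_trans1 power_strict_increasing_iff one_less_numeral_iff semiring_norm(76))
  hence a0a: "a0 \<le> a" by simp
  have "real (2 ^ a) \<le> real n" using a(1) by (simp only: of_nat_le_iff)
  hence "log 2 (2 ^ a) \<le> log 2 (real n)" by (intro log_mono) auto
  hence la: "real a \<le> log 2 (real n)" by simp
  hence "real (7 * a) \<le> real w" using assms(2) by simp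
  hence "7 * a \<le> w" by (simp only: of_nat_le_iff)
  hence aw: "a \<le> w div 7" by simp
  define i where "i = (a - a0) div \<beta> + 1"
  have "a - a0 = (a - a0) div \<beta> * \<beta> + (a - a0) mod \<beta>" by simp
  moreover have "(a - a0) mod \<beta> < \<beta>" using \<beta> by simp
  ultimately have "a - a0 \<le> (a - a0) div \<beta> * \<beta> + \<beta>" by linarith
  hence "a - a0 \<le> i * \<beta>" by (simp only: i_def add_mult_distrib mult_1)
  hence ai: "a \<le> a0 + i * \<beta>" using a0a by simp
  from rep_all[OF a0a ai aw a(1)] a(2) obtain hdr mem N where "rep W n (lv a) (Mv n a) (Kv a) (1 + 3 * i) hdr mem N" by (metis less_imp_le)
  hence "compact_rank W n (1 + 3 * i + 1)"
    by (rule rep_imp_ds[OF _ Kv_le[OF aw]]) (use size_bounds[OF a0a aw a(1) less_imp_le[OF a(2)]] in \<open>auto simp: W_def \<kappa>_def\<close>)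
  moreover have "1 + 3 * i + 1 \<le> p"
  proof -
    have "real ((a - a0) div \<beta>) * real \<beta> \<le> real (a - a0)"
      by (metis div_times_less_eq_dividend of_nat_le_iff of_nat_mult)
    also have "\<dots> \<le> x * log 2 (real w)" using la assms(3) by linarith
    also have "\<dots> \<le> x * (8 * real \<beta>)" by (rule mult_left_mono[OF log_w_le assms(4)])
    finally have "real ((a - a0) div \<beta>) * real \<beta> \<le> (8 * x) * real \<beta>" by simp
    hence "real ((a - a0) div \<beta>) \<le> 8 * x" using \<beta> by simp
    hence "real (1 + 3 * i + 1) \<le> real p" using assms(5) by (simp add: i_def)
    thus ?thesis by (simp only: of_nat_le_iff)
  qed
  ultimately show ?thesis by (rule ds_mono)
qed

end

lemma ex_params:
  assumes "w \<ge> 4096"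
  shows "\<exists>\<beta> a0. params w \<beta> a0"
proof -
  obtain \<beta> where b: "16 ^ \<beta> \<le> w" "w < 16 ^ (\<beta> + 1)" using ex_power_ivl1[of 16 w] assms by auto
  have e: "(2::nat) ^ (4 * k) = 16 ^ k" for k by (simp add: power_mult)
  have e2: "(2::nat) ^ (4 * \<beta> + 4) = 16 ^ (\<beta> + 1)" by (simp add: power_add power_mult)
  have "(16::nat) ^ 3 < 16 ^ (\<beta> + 1)" using b assms by simp
  hence "3 < \<beta> + 1" by (rule power_less_imp_less_exp[rotated]) simp
  moreover obtain a1 where a1: "2 ^ a1 \<le> 400 * w" "400 * w < 2 ^ (a1 + 1)" using ex_power_ivl1[of 2 "400 * w"] assms by auto
  ultimately have "params w \<beta> (a1 + 1)"
    by unfold_locales (use b e[of \<beta>] e2 in auto)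
  thus ?thesis by blast
qed

section \<open>Pieces with explicit prefix sums, and the theorem\<close>

lemma prefix_sum_blocks:
  fixes s :: "nat \<Rightarrow> nat"
  assumes n: "sum s {..<cnt} = n" and cnt: "cnt > 0" and nw: "n < 2 ^ w" and wW: "w \<le> W"
    and d: "\<And>j. compact_rank W (s j) p"
  shows "\<exists>enc. (\<forall>A. length A = n \<longrightarrow> length (enc A) = n + cnt * (w + 1)) \<and>
     (\<forall>u. \<exists>f. reads W (p + 1) f \<and> (\<forall>A xs. length A = n \<longrightarrow> u \<le> n \<longrightarrow> f (enc A @ xs) = ones (take u A)))"
proof -
  have "\<forall>j. \<exists>e. (\<forall>A. length A = s j \<longrightarrow> length (e A) = s j + 1) \<and>
     (\<forall>a u. \<exists>f. reads W p f \<and> (\<forall>A m. length A = s j \<longrightarrow> u \<le> s j \<longrightarrow> take (s j + 1) (drop a m) = e A \<longrightarrow> f m = ones (take u A)))"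
    using d unfolding compact_rank_def by blast
  then obtain e where le: "\<And>j A. length A = s j \<Longrightarrow> length (e j A) = s j + 1"
    and qe: "\<And>j a u. \<exists>f. reads W p f \<and> (\<forall>A m. length A = s j \<longrightarrow> u \<le> s j \<longrightarrow> take (s j + 1) (drop a m) = e j A \<longrightarrow> f m = ones (take u A))"
    by metis
  define off where "off j = sum s {..<j}" for j
  define blk where "blk j A = take (s j) (drop (off j) A)" for j and A :: "bool list"
  define pc where "pc A j = bl w (ones (take (off j) A)) @ e j (blk j A)" for A j
  define len where "len j = w + (s j + 1)" for j
  define enc where "enc A = concat (map (pc A) [0..<cnt])" for A
  have offle: "off j + s j \<le> n" if "j < cnt" for j
  proof -
    have "sum s {..<Suc j} \<le> sum s {..<cnt}" by (rule sum_mono2) (use that in auto)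
    thus ?thesis using n by (simp add: off_def)
  qed
  have lblk: "length (blk j A) = s j" if "length A = n" "j < cnt" for j A using offle[OF that(2)] that(1) by (simp add: blk_def)
  have lpc: "length (pc A j) = len j" if "length A = n" "j < cnt" for j A using le[OF lblk[OF that]] by (simp add: pc_def len_def)
  have "length (enc A) = n + cnt * (w + 1)" if "length A = n" for A
  proof -
    have "length (enc A) = sum len {..<cnt}" unfolding enc_def by (rule length_concat_upt) (rule lpc[OF that])
    also have "\<dots> = (\<Sum>j<cnt. s j + (w + 1))" by (rule sum.cong) (auto simp: len_def)
    finally show ?thesis by (simp only: sum.distrib n) simp
  qed
  moreover have "\<exists>f. reads W (p + 1) f \<and> (\<forall>A xs. length A = n \<longrightarrow> u \<le> n \<longrightarrow> f (enc A @ xs) = ones (take u A))" for u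
  proof (cases "u \<le> n")
    case False
    thus ?thesis using reads.const[of W "p + 1" 0] by blast
  next
    case True
    have "\<exists>i<k. off i \<le> u \<and> u \<le> off i + s i" if "u \<le> off k" "k > 0" for k
      using that
    proof (induction k)
      case (Suc k)
      show ?case
      proof (cases "u \<le> off k \<and> k > 0")
        case True thus ?thesis using Suc.IH less_SucI by blast
      next
        case False
        thus ?thesis using Suc.prems by (intro exI[of _ k]) (auto simp: off_def)
      qed
    qed simp
    from this[of cnt] True cnt n obtain i where i: "i < cnt" "off i \<le> u" "u \<le> off i + s i" by (auto simp: off_def)
    define po where "po = sum len {..<i}"
    from qe[where j = i and a = "po + w" and u = "u - off i"] obtain f where f: "reads W p f"
      "\<And>A m. length A = s i \<Longrightarrow> u - off i \<le> s i \<Longrightarrow> take (s i + 1) (drop (po + w) m) = e i A \<Longrightarrow> f m = ones (take (u - off i) A)" by blast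
    define g where "g x m = nb (take w x) + f m" for x m
    have "reads W (1 + p) (\<lambda>m. g (take W (drop po m)) m)"
      by (rule reads_bind[OF reads_one[unfolded One_nat_def[symmetric]]]) (use reads_map[OF f(1)] in \<open>simp add: g_def\<close>)
    moreover have "g (take W (drop po (enc A @ xs))) (enc A @ xs) = ones (take u A)" if lA: "length A = n" for A xs
    proof -
      have sg: "take (len i) (drop po (enc A @ xs)) = pc A i" unfolding enc_def po_def
        by (rule take_drop_concat[OF i(1)]) (rule lpc[OF lA])
      have "take w (take W (drop po (enc A @ xs))) = take w (take (len i) (drop po (enc A @ xs)))" using wW by (simp add: len_def min_absorb1 del: drop_append take_append)
      hence 1: "take w (take W (drop po (enc A @ xs))) = bl w (ones (take (off i) A))" unfolding sg by (simp add: pc_def)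
      have "take (s i + 1) (drop (po + w) (enc A @ xs)) = drop w (take (len i) (drop po (enc A @ xs)))" by (simp add: drop_take len_def add.commute del: drop_append take_append)
      hence 2: "take (s i + 1) (drop (po + w) (enc A @ xs)) = e i (blk i A)" unfolding sg by (simp add: pc_def)
      have "ones (take (off i) A) < 2 ^ w" using ones_le[of "take (off i) A"] lA nw by (simp add: min_def split: if_splits)
      hence 3: "nb (take w (take W (drop po (enc A @ xs)))) = ones (take (off i) A)" unfolding 1 nb_bl by simp
      have 4: "f (enc A @ xs) = ones (take (u - off i) (blk i A))" by (rule f(2)[OF lblk[OF lA i(1)] _ 2]) (use i in simp)
      have "take u A = take (off i) A @ take (u - off i) (drop (off i) A)" using i(2) by (metis le_add_diff_inverse take_add)
      moreover have "take (u - off i) (blk i A) = take (u - off i) (drop (off i) A)" using i(3) by (simp add: blk_def min_absorb1)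
      ultimately show ?thesis unfolding g_def 3 4 by (simp add: ones_append)
    qed
    ultimately show ?thesis by (intro exI[of _ "\<lambda>m. g (take W (drop po m)) m"]) simp
  qed
  ultimately show ?thesis by (intro exI[of _ enc] conjI allI) auto
qed

text \<open>The required length is exact, so the encoding is padded with \<open>False\<close>; this
  is why the queries must tolerate trailing bits \<open>xs\<close>.\<close>

lemma query_algs_of_reads:
  assumes enc: "\<And>A. length A = n \<Longrightarrow> length (enc A) = L0" and L: "L0 \<le> L1" and w: "w > 0"
    and q: "\<And>u. \<exists>f. reads (c * w) p f \<and> (\<forall>A xs. length A = n \<longrightarrow> u \<le> n \<longrightarrow> f (enc A @ xs) = ones (take u A))"
    and C: "real (p * Suc c) \<le> C"
  shows "\<exists>(enc :: bool list \<Rightarrow> bool list) (query :: nat \<Rightarrow> nat query_alg). \<forall>A. length A = n \<longrightarrow> length (enc A) = L1 \<and>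
     (\<forall>u\<le>n. answer w (enc A) (query u) = rank_query A u \<and> real (num_probes w (enc A) (query u)) \<le> C)"
proof -
  have "\<exists>alg. \<forall>A. length A = n \<longrightarrow> u \<le> n \<longrightarrow> answer w (enc A @ replicate (L1 - L0) False) alg = rank_query A u \<and>
     num_probes w (enc A @ replicate (L1 - L0) False) alg \<le> p * Suc c" for u
  proof -
    from q[of u] obtain f where f: "reads (c * w) p f" "\<forall>A xs. length A = n \<longrightarrow> u \<le> n \<longrightarrow> f (enc A @ xs) = ones (take u A)" by blast
    from reads_imp_query_alg[OF f(1) order.refl w] obtain alg where alg: "\<forall>m. answer w m alg = f m \<and> num_probes w m alg \<le> p * Suc c" by blast
    show ?thesis using alg f(2) rank_query_eq by (intro exI[of _ alg]) simp
  qed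
  then obtain query where query: "\<And>u A. length A = n \<Longrightarrow> u \<le> n \<Longrightarrow> answer w (enc A @ replicate (L1 - L0) False) (query u) = rank_query A u \<and>
     num_probes w (enc A @ replicate (L1 - L0) False) (query u) \<le> p * Suc c" by metis
  have "real (num_probes w (enc A @ replicate (L1 - L0) False) (query u)) \<le> C" if "length A = n" "u \<le> n" for A u
  proof -
    have "real (num_probes w (enc A @ replicate (L1 - L0) False) (query u)) \<le> real (p * Suc c)" using query[OF that] by (simp only: of_nat_le_iff)
    thus ?thesis using C by linarith
  qed
  thus ?thesis using query enc L
    by (intro exI[of _ "\<lambda>A. enc A @ replicate (L1 - L0) False"] exI[of _ query]) simp
qed

theorem theorem1:
  "\<exists>c::real. c > 0 \<and> (\<exists>C::real. C > 0 \<and> (\<exists>n0::nat. \<forall>n\<ge>n0. \<forall>t::real. t \<ge> 1 \<longrightarrow>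
     (\<forall>w::nat. real w \<ge> 7 * log 2 (real n) \<longrightarrow>
       (\<exists>(enc :: bool list \<Rightarrow> bool list) (query :: nat \<Rightarrow> nat query_alg).
         \<forall>A. length A = n \<longrightarrow>
           length (enc A) = n + nat \<lceil>real n / real w powr (c * t)\<rceil> \<and>
           (\<forall>u\<le>n. answer w (enc A) (query u) = rank_query A u \<and>
                   real (num_probes w (enc A) (query u)) \<le> C * t)))))"
\<comment> \<open>\<open>7 * 586 \<ge> 4096\<close> yields \<open>w \<ge> 4096\<close>, as
  \<open>ex_params\<close> demands. The constant 200000 covers 1601 cells for each of at most
  \<open>55 + 24 * t\<close> reads.\<close>
proof (rule exI[of _ "1::real"], rule conjI, simp, rule exI[of _ "200000::real"], rule conjI, simp,
    rule exI[of _ "2 ^ 586 :: nat"], intro allI impI)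
  fix n :: nat and t :: real and w :: nat
  assume n: "2 ^ 586 \<le> n" and t: "1 \<le> t" and w: "7 * log 2 (real n) \<le> real w"
  have n1: "n \<ge> 1" using n by (rule order.trans[rotated]) simp
  have w0: "w \<ge> 4096"
  proof -
    have "real (2 ^ 586) \<le> real n" using n by (simp only: of_nat_le_iff)
    hence "2 powr 586 \<le> real n" by (simp only: powr_numeral of_nat_power of_nat_numeral zero_less_numeral)
    hence "586 \<le> log 2 (real n)" using n1 by (subst le_log_iff) auto
    hence "real 4096 \<le> real w" using w by simp
    thus ?thesis by (simp only: of_nat_le_iff)
  qed
  have nw: "n < 2 ^ w"
  proof -
    have "log 2 (real n) \<le> real w / 7" using w by simp
    also have "\<dots> < real w" using w0 by simp
    finally have "log 2 (real n) < real w" .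
    hence "real n < 2 powr real w" using n1 by (subst (asm) log_less_iff) auto
    hence "real n < real (2 ^ w)" by (simp add: powr_realpow)
    thus ?thesis by (simp only: of_nat_less_iff)
  qed
  obtain \<beta> a0 where "params w \<beta> a0" using ex_params[OF w0] by blast
  then interpret params w \<beta> a0 .
  define L1 where "L1 = n + nat \<lceil>real n / real w powr (1 * t)\<rceil>"
  \<comment> \<open>\<open>53 = 5 + 24 * 2\<close>: the pieces have length at most
    \<open>w powr (t + 2)\<close>, so \<open>ds_all\<close> is used with
    \<open>x = t + 2\<close>.\<close>
  define p where "p = nat \<lceil>53 + 24 * t\<rceil>"
  have p1: "53 + 24 * t \<le> real p" unfolding p_def by (rule real_nat_ceiling_ge)
  have p2: "real p \<le> 54 + 24 * t" using t unfolding p_def by (simp add: of_nat_nat) linarith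
  have wp: "real w powr t > 0" using w0 by simp
  \<comment> \<open>A piece costs \<open>w + 1 \<le> 2 * w\<close> extra bits; the factor 2
    compensates for this.\<close>
  define y where "y = 2 * real w powr (t + 1)"
  define r where "r = nat \<lceil>y\<rceil>"
  have lw: "log 2 (real w) \<ge> 12"
  proof -
    have "2 powr 12 \<le> real w" using w0 by simp
    thus ?thesis using w0 by (subst le_log_iff) auto
  qed
  have w1: "real w powr (t + 1) \<ge> 1" using w0 t by (intro ge_one_powr_ge_zero) auto
  have yr: "y \<le> real r" "real r \<le> 2 * y"
  proof -
    show "y \<le> real r" unfolding r_def by (rule real_nat_ceiling_ge)
    have "real r = real_of_int \<lceil>y\<rceil>" using w1 by (simp add: r_def y_def)
    hence "real r \<le> y + 1" by linarith
    thus "real r \<le> 2 * y" using w1 by (simp add: y_def)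
  qed
  have r0: "r > 0" using yr(1) w1 by (simp add: y_def)
  have dsm: "compact_rank W m p" if m: "1 \<le> m" "m \<le> n" "m \<le> 2 * r" for m
  proof (rule ds_all[OF m(1), of "t + 2"])
    have "log 2 (real m) \<le> log 2 (real n)" using m by (intro log_mono) auto
    thus "7 * log 2 (real m) \<le> real w" using w by linarith
    have "real m \<le> 2 * real r" using m(3) by (metis of_nat_le_iff of_nat_mult of_nat_numeral)
    also have "\<dots> \<le> 2 ^ 3 * real w powr (t + 1)" using yr by (simp add: y_def)
    finally have "log 2 (real m) \<le> log 2 (2 ^ 3 * real w powr (t + 1))" using m(1) by (intro log_mono) auto
    also have "\<dots> = 3 + (t + 1) * log 2 (real w)" using w0 log_pow_cancel[of 2 3] by (simp add: log_mult log_powr)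
    also have "\<dots> \<le> (t + 2) * log 2 (real w)" using lw by (simp add: distrib_right)
    finally show "log 2 (real m) \<le> (t + 2) * log 2 (real w)" .
    show "0 \<le> t + 2" using t by simp
    show "5 + 24 * (t + 2) \<le> real p" using p1 by simp
  qed
  have WW: "W = 1600 * w" by (simp add: W_def)
  have Cb: "real ((p + 1) * Suc 1600) \<le> 200000 * t"
  proof -
    have "real ((p + 1) * Suc 1600) = (real p + 1) * 1601" by simp
    also have "\<dots> \<le> (55 + 24 * t) * 1601" using p2 by simp
    also have "\<dots> \<le> 200000 * t" using t by simp
    finally show ?thesis .
  qed
  show "\<exists>(enc :: bool list \<Rightarrow> bool list) (query :: nat \<Rightarrow> nat query_alg). \<forall>A. length A = n \<longrightarrow>
           length (enc A) = n + nat \<lceil>real n / real w powr (1 * t)\<rceil> \<and>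
           (\<forall>u\<le>n. answer w (enc A) (query u) = rank_query A u \<and>
                   real (num_probes w (enc A) (query u)) \<le> 200000 * t)"
  proof (cases "n < r")
    case True
    from dsm[of n] n1 True have "compact_rank W n p" by simp
    then obtain enc where e: "\<forall>A. length A = n \<longrightarrow> length (enc A) = n + 1"
      and q: "\<forall>a u. \<exists>f. reads W p f \<and> (\<forall>A m. length A = n \<longrightarrow> u \<le> n \<longrightarrow> take (n + 1) (drop a m) = enc A \<longrightarrow> f m = ones (take u A))"
      unfolding compact_rank_def by (elim exE conjE)
    have q': "\<exists>f. reads (1600 * w) (p + 1) f \<and> (\<forall>A xs. length A = n \<longrightarrow> u \<le> n \<longrightarrow> f (enc A @ xs) = ones (take u A))" for u
    proof -
      from q[rule_format, of u 0] obtain f where f: "reads W p f"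
        "\<forall>A m. length A = n \<longrightarrow> u \<le> n \<longrightarrow> take (n + 1) (drop 0 m) = enc A \<longrightarrow> f m = ones (take u A)" by (elim exE conjE)
      have "reads (1600 * w) (p + 1) f" using reads_mono[OF f(1), of "p + 1"] WW by simp
      thus ?thesis using f(2) e by (intro exI[of _ f]) simp
    qed
    have "real n / real w powr (1 * t) > 0" using n1 wp by simp
    hence "\<lceil>real n / real w powr (1 * t)\<rceil> \<ge> 1" by linarith
    hence Le: "n + 1 \<le> n + nat \<lceil>real n / real w powr (1 * t)\<rceil>" by linarith
    show ?thesis by (rule query_algs_of_reads[OF _ Le _ q' Cb]) (use e w0 in auto)
  next
    case False
    define k where "k = n div r"
    have k0: "k > 0" using False r0 by (simp add: k_def div_greater_zero_iff)
    have kr: "k * r \<le> n" by (simp add: k_def)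
    have "n < k * r + r" unfolding k_def using r0 by (metis dividend_less_div_times add.commute)
    also have "\<dots> \<le> k * (2 * r)" using k0 by (cases k) auto
    finally have kr2: "n \<le> k * (2 * r)" by simp
    note ss = split_sizes[OF k0 kr kr2]
    define s where "s j = (Suc j * n) div k - (j * n) div k" for j
    have s: "r \<le> s j" "s j \<le> 2 * r" for j using ss(1,2)[of j] by (simp_all add: s_def)
    have sum: "sum s {..<k} = n"
    proof -
      have "sum s {..<k} = sum (\<lambda>j. Suc j * n div k - j * n div k) {..<k}" by (rule sum.cong) (auto simp: s_def)
      also have "\<dots> = n" using ss(3)[of k] k0 by simp
      finally show ?thesis .
    qed
    \<comment> \<open>\<open>prefix_sum_blocks\<close> asks for a structure at every index, so
      indices beyond \<open>k\<close> receive the admissible size \<open>r\<close>.\<close>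
    define s' where "s' j = (if j < k then s j else r)" for j
    have sum': "sum s' {..<k} = n" using sum by (simp add: s'_def)
    have ds': "compact_rank W (s' j) p" for j
    proof (rule dsm)
      show "1 \<le> s' j" using s(1)[of j] r0 by (simp add: s'_def)
      show "s' j \<le> 2 * r" using s(2)[of j] by (simp add: s'_def)
      show "s' j \<le> n"
      proof (cases "j < k")
        case True
        hence "s j \<le> sum s {..<k}" by (intro member_le_sum) auto
        thus ?thesis using sum True by (simp add: s'_def)
      qed (use False in \<open>simp add: s'_def\<close>)
    qed
    have wW: "w \<le> W" by (simp add: WW)
    from prefix_sum_blocks[OF sum' k0 nw wW ds'] obtain enc where e: "\<forall>A. length A = n \<longrightarrow> length (enc A) = n + k * (w + 1)"
      and q: "\<forall>u. \<exists>f. reads W (p + 1) f \<and> (\<forall>A xs. length A = n \<longrightarrow> u \<le> n \<longrightarrow> f (enc A @ xs) = ones (take u A))" by (elim exE conjE)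
    have Le: "n + k * (w + 1) \<le> n + nat \<lceil>real n / real w powr (1 * t)\<rceil>"
    proof -
      have "real k * real r \<le> real n" using kr by (metis of_nat_le_iff of_nat_mult)
      hence "real k * y \<le> real n" using yr(1) by (meson mult_left_mono of_nat_0_le_iff order.trans)
      hence "real k * (2 * (real w powr t * real w)) \<le> real n" using w0 by (simp add: y_def powr_add)
      moreover have "real k * ((real w + 1) * real w powr t) \<le> real k * (2 * (real w powr t * real w))"
      proof (rule mult_left_mono)
        have "(real w + 1) * real w powr t \<le> (2 * real w) * real w powr t" using w0 wp by (intro mult_right_mono) auto
        thus "(real w + 1) * real w powr t \<le> 2 * (real w powr t * real w)" by (simp add: ac_simps)
      qed simp
      ultimately have "(real k * (real w + 1)) * real w powr t \<le> real n" by (simp add: mult.assoc)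
      hence "real k * (real w + 1) \<le> real n / real w powr (1 * t)" using wp by (simp add: le_divide_eq)
      hence "real (k * (w + 1)) \<le> real n / real w powr (1 * t)" by (simp add: distrib_left)
      hence "real (k * (w + 1)) \<le> real (nat \<lceil>real n / real w powr (1 * t)\<rceil>)" using real_nat_ceiling_ge order.trans by blast
      hence "k * (w + 1) \<le> nat \<lceil>real n / real w powr (1 * t)\<rceil>" by (simp only: of_nat_le_iff)
      thus ?thesis by simp
    qed
    show ?thesis by (rule query_algs_of_reads[OF _ Le _ _ Cb]) (use e q w0 in \<open>auto simp: WW\<close>)
  qed
qed

end
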